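(* Let $G$ be a Lie group whose Lie algebra $\mathfrak g$ carries an invariant inner product $B$. The exponential map $\exp:\mathfrak g\to G$ and the 2-form $\varpi\in\Omega^2(\mathfrak g)$ define a Dirac morphism \[(\exp,\varpi):(\mathfrak g,E_{\mathfrak g},0)\to(G,E_G,\eta).\] It is a strong Dirac morphism over the open subset $\mathfrak g_\natural\subset\mathfrak g$.
   Context: $B$ is an $\mathrm{Ad}$-invariant non-degenerate symmetric bilinear form on $\mathfrak g$, used to identify $\mathfrak g^*\cong\mathfrak g$; $\xi^L,\xi^R$ are left-/right-invariant vector fields, $\theta^L,\theta^R$ the left-/right-Maurer–Cartan forms, $\eta=\frac1{12}B(\theta^L,[\theta^L,\theta^L])$. $\mathbb{T}M=TM\oplus T^*M$ with form $\langle v_1\oplus\alpha_1,v_2\oplus\alpha_2\rangle=\alpha_1(v_2)+\alpha_2(v_1)$. A Dirac manifold $(M,E,\eta)$ is a manifold with a Lagrangian subbundle $E\subset\mathbb{T}M$ and closed 3-form $\eta$ such that $\Gamma(E)$ is closed under the $\eta$-twisted Courant bracket, defined by $\varrho([\![x_1,x_2]\!]_\eta)=[[\mathrm d+\eta,\varrho(x_1)],\varrho(x_2)]$ on $\Omega(M)$ with $\varrho(v\oplus\alpha)=\alpha\wedge\cdot+\iota(v)$. For $\Phi:M\to M'$, $\omega\in\Omega^2(M)$, write $v\oplus\alpha\sim_{(\Phi,\omega)}v'\oplus\alpha'$ (over $m$ and $\Phi(m)$) if $v'=(\mathrm d\Phi)_mv$, $(\mathrm d\Phi)_m^*\alpha'=\alpha+\iota_v\omega_m$.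 $(\Phi,\omega):(M,E,\eta)\to(M',E',\eta')$ is a Dirac morphism if $\eta+\mathrm d\omega=\Phi^*\eta'$ and $E'_{\Phi(m)}=\{w':\exists w\in E_m,\ w\sim_{(\Phi,\omega)}w'\}$ for all $m$; it is strong if in addition no nonzero $w\in E_m$ satisfies $w\sim_{(\Phi,\omega)}0$. $E_G$ (the Cartan–Dirac structure, Dirac relative to $\eta$) is spanned by $\mathsf e(\xi)=(\xi^L-\xi^R)\oplus B(\frac{\theta^L+\theta^R}2,\xi)$, $\xi\in\mathfrak g$. $E_{\mathfrak g}\subset\mathbb{T}\mathfrak g$ is spanned by $\mathsf e_0(\xi)=\mathcal A_0(\xi)\oplus B(\theta_0,\xi)$, $\xi\in\mathfrak g$, where $\mathcal A_0(\xi)$ is the vector field on $\mathfrak g$ with value $-[\xi,\nu]$ at $\nu$ and $\theta_0=\mathrm d\nu$ is the tautological $\mathfrak g$-valued 1-form; it is the graph of the linear Poisson structure on $\mathfrak g^*\cong\mathfrak g$. $\mathfrak g_\natural$ is the set of points where $\mathrm d\exp$ is an isomorphism. $\varpi$ is the primitive of $\exp^*\eta$ obtained from the de Rham homotopy operator for the radial homotopy $(t,\nu)\mapsto t\nu$, $t\in[0,1]$. *)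

theory Defs
  imports "HOL-Analysis.Analysis"
begin

section \<open>Smooth functions between normed spaces\<close>

text \<open>Meant for open \<open>S\<close>.\<close>

primrec Ck_on :: "nat \<Rightarrow> ('a::real_normed_vector) set \<Rightarrow> ('a \<Rightarrow> 'b::real_normed_vector) \<Rightarrow> bool" where
  "Ck_on 0 S f \<longleftrightarrow> continuous_on S f"
| "Ck_on (Suc k) S f \<longleftrightarrow> (\<forall>x\<in>S. f differentiable (at x)) \<and>
     (\<forall>v. Ck_on k S (\<lambda>x. frechet_derivative f (at x) v))"

definition smooth_on :: "('a::real_normed_vector) set \<Rightarrow> ('a \<Rightarrow> 'b::real_normed_vector) \<Rightarrow> bool" where
  "smooth_on S f \<longleftrightarrow> (\<forall>k. Ck_on k S f)"


section \<open>Manifolds\<close>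

text \<open>
  A smooth structure on the type \<open>'m\<close>, modelled on the Euclidean space \<open>'a\<close>, is given by an atlas in
  which each point \<open>p\<close> has a preferred chart, with domain \<open>chart_dom M p\<close> containing \<open>p\<close>. (Every
  atlas yields such data by choosing a chart around each point.)

  The tangent space at \<open>p\<close> is identified with \<open>'a\<close> by means of the preferred chart at \<open>p\<close>; hence
  tangent vectors at any point are elements of \<open>'a\<close>, and covectors are elements of \<open>'a \<Rightarrow>\<^sub>L real\<close>. A
  vector field is a function \<open>'m \<Rightarrow> 'a\<close>, whose value at \<open>p\<close> is always expressed in the preferred chart
  at \<open>p\<close>. As that chart varies (discontinuously) with \<open>p\<close>, smoothness and derivatives are defined
  after passing to a single chart.
\<close>

record ('m, 'a) charts =
  chart_dom :: "'m \<Rightarrow> 'm set"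
  coord :: "'m \<Rightarrow> 'm \<Rightarrow> 'a"

definition chart_img :: "('m, 'a, 'z) charts_scheme \<Rightarrow> 'm \<Rightarrow> 'a set" where
  "chart_img M p = coord M p ` chart_dom M p"

definition chart_inv :: "('m, 'a, 'z) charts_scheme \<Rightarrow> 'm \<Rightarrow> 'a \<Rightarrow> 'm" where
  "chart_inv M p = inv_into (chart_dom M p) (coord M p)"

definition smooth_manifold ::
  "('m::{t2_space, second_countable_topology}, 'a::euclidean_space, 'z) charts_scheme \<Rightarrow> bool" where
  "smooth_manifold M \<longleftrightarrow>
     (\<forall>p. p \<in> chart_dom M p \<and> open (chart_dom M p) \<and> open (chart_img M p) \<and>
          homeomorphism (chart_dom M p) (chart_img M p) (coord M p) (chart_inv M p)) \<and>
     (\<forall>p q. smooth_on (coord M p ` (chart_dom M p \<inter> chart_dom M q)) (coord M q \<circ> chart_inv M p))"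

definition euclidean_charts :: "('a, 'a) charts" where
  "euclidean_charts = \<lparr>chart_dom = (\<lambda>_. UNIV), coord = (\<lambda>_ x. x)\<rparr>"

definition prod_charts ::
  "('m, 'a, 'y) charts_scheme \<Rightarrow> ('n, 'b, 'z) charts_scheme \<Rightarrow> ('m \<times> 'n, 'a \<times> 'b) charts" where
  "prod_charts M N =
     \<lparr>chart_dom = (\<lambda>(p, q). chart_dom M p \<times> chart_dom N q),
      coord = (\<lambda>(p, q) (x, y). (coord M p x, coord N q y))\<rparr>"

definition smooth_map ::
  "('m::topological_space, 'a::real_normed_vector, 'y) charts_scheme \<Rightarrow>
   ('n::topological_space, 'b::real_normed_vector, 'z) charts_scheme \<Rightarrow> ('m \<Rightarrow> 'n) \<Rightarrow> bool" where
  "smooth_map M N f \<longleftrightarrow> continuous_on UNIV f \<and>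
     (\<forall>p q. smooth_on (coord M p ` (chart_dom M p \<inter> f -` chart_dom N q))
              (coord N q \<circ> f \<circ> chart_inv M p))"

text \<open>The differential at \<open>p\<close>, in the preferred charts at \<open>p\<close> and at \<open>f p\<close>.\<close>

definition tangent_map ::
  "('m, 'a::real_normed_vector, 'y) charts_scheme \<Rightarrow> ('n, 'b::real_normed_vector, 'z) charts_scheme \<Rightarrow>
   ('m \<Rightarrow> 'n) \<Rightarrow> 'm \<Rightarrow> 'a \<Rightarrow> 'b" where
  "tangent_map M N f p =
     frechet_derivative (coord N (f p) \<circ> f \<circ> chart_inv M p) (at (coord M p p))"

text \<open>
  \<open>to_chart M q p\<close> takes a tangent vector at \<open>p\<close> to its expression in the preferred chart of \<open>q\<close>,
  where \<open>p \<in> chart_dom M q\<close>; \<open>from_chart M q p\<close> is the inverse.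
\<close>

definition to_chart :: "('m, 'a::real_normed_vector, 'z) charts_scheme \<Rightarrow> 'm \<Rightarrow> 'm \<Rightarrow> 'a \<Rightarrow> 'a" where
  "to_chart M q p = frechet_derivative (coord M q \<circ> chart_inv M p) (at (coord M p p))"

definition from_chart :: "('m, 'a::real_normed_vector, 'z) charts_scheme \<Rightarrow> 'm \<Rightarrow> 'm \<Rightarrow> 'a \<Rightarrow> 'a" where
  "from_chart M q p = frechet_derivative (coord M p \<circ> chart_inv M q) (at (coord M q p))"


subsection \<open>Vector fields\<close>

definition vf_rep :: "('m, 'a::real_normed_vector, 'z) charts_scheme \<Rightarrow> ('m \<Rightarrow> 'a) \<Rightarrow> 'm \<Rightarrow> 'a \<Rightarrow> 'a" where
  "vf_rep M X q y = (let p = chart_inv M q y in to_chart M q p (X p))"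

definition smooth_vf_on :: "('m, 'a::real_normed_vector, 'z) charts_scheme \<Rightarrow> 'm set \<Rightarrow> ('m \<Rightarrow> 'a) \<Rightarrow> bool" where
  "smooth_vf_on M U X \<longleftrightarrow> (\<forall>q. smooth_on (coord M q ` (chart_dom M q \<inter> U)) (vf_rep M X q))"

definition lie_bracket_vf ::
  "('m, 'a::real_normed_vector, 'z) charts_scheme \<Rightarrow> ('m \<Rightarrow> 'a) \<Rightarrow> ('m \<Rightarrow> 'a) \<Rightarrow> 'm \<Rightarrow> 'a" where
  "lie_bracket_vf M X Y p =
     frechet_derivative (vf_rep M Y p) (at (coord M p p)) (X p) -
     frechet_derivative (vf_rep M X p) (at (coord M p p)) (Y p)"


subsection \<open>Differential forms\<close>

text \<open>
  A form with values in \<open>'b\<close> (inhomogeneous in general) assigns to each point a function on finite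
  lists of tangent vectors; its degree \<open>k\<close> component is the restriction to lists of length \<open>k\<close>, which
  has to be \<open>k\<close>-linear and alternating. Components of degree above the dimension are then zero.
\<close>

type_synonym ('m, 'a, 'b) form = "'m \<Rightarrow> 'a list \<Rightarrow> 'b"

definition alternating :: "('a::real_vector list \<Rightarrow> 'b::real_vector) \<Rightarrow> bool" where
  "alternating f \<longleftrightarrow> (\<forall>xs ys. linear (\<lambda>v. f (xs @ v # ys))) \<and> (\<forall>xs. \<not> distinct xs \<longrightarrow> f xs = 0)"

definition form_rep ::
  "('m, 'a::real_normed_vector, 'z) charts_scheme \<Rightarrow> ('m, 'a, 'b) form \<Rightarrow> 'm \<Rightarrow> 'a \<Rightarrow> 'a list \<Rightarrow> 'b" where
  "form_rep M \<phi> q y vs = (let p = chart_inv M q y in \<phi> p (map (from_chart M q p) vs))"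

definition smooth_form ::
  "('m, 'a::real_normed_vector, 'z) charts_scheme \<Rightarrow> ('m, 'a, 'b::real_normed_vector) form \<Rightarrow> bool" where
  "smooth_form M \<phi> \<longleftrightarrow> (\<forall>p. alternating (\<phi> p)) \<and>
     (\<forall>q vs. smooth_on (chart_img M q) (\<lambda>y. form_rep M \<phi> q y vs))"

definition has_degree :: "('m, 'a, 'b::zero) form \<Rightarrow> nat \<Rightarrow> bool" where
  "has_degree \<phi> k \<longleftrightarrow> (\<forall>p vs. length vs \<noteq> k \<longrightarrow> \<phi> p vs = 0)"

definition ext_deriv ::
  "('m, 'a::real_normed_vector, 'z) charts_scheme \<Rightarrow> ('m, 'a, 'b) form \<Rightarrow> ('m, 'a, 'b::real_normed_vector) form" where
  "ext_deriv M \<phi> p vs =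
     (\<Sum>i<length vs. (- 1) ^ i *\<^sub>R
        frechet_derivative (\<lambda>y. form_rep M \<phi> p y (take i vs @ drop (Suc i) vs))
          (at (coord M p p)) (vs ! i))"

text \<open>
  The wedge product of vector-valued forms, the values being multiplied by a bilinear map \<open>b\<close>. It is
  a signed sum over shuffles: the arguments at the positions in \<open>S\<close> go to the first factor, the other
  arguments to the second. There are no factorials, so that
  \<open>(\<alpha> \<and> \<beta>)(v, w) = \<alpha>(v) \<beta>(w) - \<alpha>(w) \<beta>(v)\<close> for 1-forms, which is the normalisation that goes with
  the formula for \<open>ext_deriv\<close>.
\<close>

definition wedge_via ::
  "('b \<Rightarrow> 'c \<Rightarrow> 'd::real_vector) \<Rightarrow> ('m, 'a, 'b) form \<Rightarrow> ('m, 'a, 'c) form \<Rightarrow> ('m, 'a, 'd) form" where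
  "wedge_via b \<phi> \<psi> p vs =
     (\<Sum>S\<in>Pow {..<length vs}.
        (- 1) ^ card {(i, j). i \<in> S \<and> j \<in> {..<length vs} - S \<and> j < i} *\<^sub>R
        b (\<phi> p (nths vs S)) (\<psi> p (nths vs (- S))))"

abbreviation wedge :: "('m, 'a, real) form \<Rightarrow> ('m, 'a, real) form \<Rightarrow> ('m, 'a, real) form" where
  "wedge \<equiv> wedge_via (*)"

definition one_form :: "('m \<Rightarrow> 'a \<Rightarrow> 'b::zero) \<Rightarrow> ('m, 'a, 'b) form" where
  "one_form \<alpha> p vs = (case vs of [v] \<Rightarrow> \<alpha> p v | _ \<Rightarrow> 0)"

definition pullback ::
  "('m, 'a::real_normed_vector, 'y) charts_scheme \<Rightarrow> ('n, 'b::real_normed_vector, 'z) charts_scheme \<Rightarrow>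
   ('m \<Rightarrow> 'n) \<Rightarrow> ('n, 'b, 'c) form \<Rightarrow> ('m, 'a, 'c) form" where
  "pullback M N f \<phi> p vs = \<phi> (f p) (map (tangent_map M N f p) vs)"


section \<open>Dirac structures\<close>

text \<open>
  \<open>'a gtangent\<close> is the fibre \<open>T\<^sub>pM \<oplus> T\<^sub>p\<^sup>*M\<close> of the generalized tangent bundle.
\<close>

type_synonym 'a gtangent = "'a \<times> ('a \<Rightarrow>\<^sub>L real)"

definition pairing :: "('a::real_normed_vector) gtangent \<Rightarrow> 'a gtangent \<Rightarrow> real" where
  "pairing x y = blinfun_apply (snd x) (fst y) + blinfun_apply (snd y) (fst x)"

definition lagrangian :: "('a::real_normed_vector) gtangent set \<Rightarrow> bool" where
  "lagrangian L \<longleftrightarrow> subspace L \<and> L = {x. \<forall>y\<in>L. pairing x y = 0}"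

definition smooth_section_on ::
  "('m, 'a::real_normed_vector, 'z) charts_scheme \<Rightarrow> 'm set \<Rightarrow> ('m \<Rightarrow> 'a gtangent) \<Rightarrow> bool" where
  "smooth_section_on M U x \<longleftrightarrow> smooth_vf_on M U (\<lambda>p. fst (x p)) \<and>
     (\<forall>q v. smooth_on (coord M q ` (chart_dom M q \<inter> U))
        (\<lambda>y. form_rep M (one_form (\<lambda>p. blinfun_apply (snd (x p)))) q y [v]))"

definition smooth_subbundle ::
  "('m::topological_space, 'a::real_normed_vector, 'z) charts_scheme \<Rightarrow> ('m \<Rightarrow> 'a gtangent set) \<Rightarrow> bool" where
  "smooth_subbundle M E \<longleftrightarrow>
     (\<forall>p. \<exists>U (k::nat) s. open U \<and> p \<in> U \<and> (\<forall>i<k. smooth_section_on M U (s i)) \<and>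
        (\<forall>q\<in>U. inj_on (\<lambda>i. s i q) {..<k} \<and> independent ((\<lambda>i. s i q) ` {..<k}) \<and>
                E q = span ((\<lambda>i. s i q) ` {..<k})))"

definition sections ::
  "('m, 'a::real_normed_vector, 'z) charts_scheme \<Rightarrow> ('m \<Rightarrow> 'a gtangent set) \<Rightarrow> ('m \<Rightarrow> 'a gtangent) set" where
  "sections M E = {x. smooth_section_on M UNIV x \<and> (\<forall>p. x p \<in> E p)}"

definition spinor_action ::
  "('m \<Rightarrow> ('a::real_normed_vector) gtangent) \<Rightarrow> ('m, 'a, real) form \<Rightarrow> ('m, 'a, real) form" where
  "spinor_action x \<phi> p vs =
     wedge (one_form (\<lambda>p. blinfun_apply (snd (x p)))) \<phi> p vs + \<phi> p (fst (x p) # vs)"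

definition twisted_deriv ::
  "('m, 'a::real_normed_vector, 'z) charts_scheme \<Rightarrow> ('m, 'a, real) form \<Rightarrow>
   ('m, 'a, real) form \<Rightarrow> ('m, 'a, real) form" where
  "twisted_deriv M \<eta> \<phi> p vs = ext_deriv M \<phi> p vs + wedge \<eta> \<phi> p vs"

text \<open>
  \<open>y\<close> is the \<open>\<eta>\<close>-twisted Courant bracket of \<open>x1\<close> and \<open>x2\<close>, as a derived bracket. The commutators are
  graded: \<open>d + \<eta>\<close> and the spinor action are odd, so the inner one is an anticommutator, and the
  outer one is an ordinary commutator. For smooth sections \<open>x1\<close>, \<open>x2\<close> and a 3-form \<open>\<eta>\<close>, exactly one
  \<open>y\<close> satisfies this.
\<close>

definition is_courant_bracket ::
  "('m, 'a::real_normed_vector, 'z) charts_scheme \<Rightarrow> ('m, 'a, real) form \<Rightarrow>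
   ('m \<Rightarrow> 'a gtangent) \<Rightarrow> ('m \<Rightarrow> 'a gtangent) \<Rightarrow> ('m \<Rightarrow> 'a gtangent) \<Rightarrow> bool" where
  "is_courant_bracket M \<eta> x1 x2 y \<longleftrightarrow>
     smooth_section_on M UNIV y \<and>
     (let D = (\<lambda>\<phi> p vs. twisted_deriv M \<eta> (spinor_action x1 \<phi>) p vs +
                         spinor_action x1 (twisted_deriv M \<eta> \<phi>) p vs)
      in \<forall>\<phi>. smooth_form M \<phi> \<longrightarrow>
           (\<forall>p vs. spinor_action y \<phi> p vs = D (spinor_action x2 \<phi>) p vs - spinor_action x2 (D \<phi>) p vs))"

definition dirac_manifold ::
  "('m::{t2_space, second_countable_topology}, 'a::euclidean_space, 'z) charts_scheme \<Rightarrow>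
   ('m \<Rightarrow> 'a gtangent set) \<Rightarrow> ('m, 'a, real) form \<Rightarrow> bool" where
  "dirac_manifold M E \<eta> \<longleftrightarrow>
     smooth_manifold M \<and> smooth_subbundle M E \<and> (\<forall>p. lagrangian (E p)) \<and>
     smooth_form M \<eta> \<and> has_degree \<eta> 3 \<and> (\<forall>p vs. ext_deriv M \<eta> p vs = 0) \<and>
     (\<forall>x1\<in>sections M E. \<forall>x2\<in>sections M E. \<forall>y. is_courant_bracket M \<eta> x1 x2 y \<longrightarrow> y \<in> sections M E)"

text \<open>The relation \<open>\<sim>\<close> given by \<open>(\<Phi>, \<omega>)\<close>, over the points \<open>m\<close> and \<open>\<Phi> m\<close>.\<close>

definition dirac_related ::
  "('m, 'a::real_normed_vector, 'y) charts_scheme \<Rightarrow> ('n, 'b::real_normed_vector, 'z) charts_scheme \<Rightarrow>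
   ('m \<Rightarrow> 'n) \<Rightarrow> ('m, 'a, real) form \<Rightarrow> 'm \<Rightarrow> 'a gtangent \<Rightarrow> 'b gtangent \<Rightarrow> bool" where
  "dirac_related M N \<Phi> \<omega> m w w' \<longleftrightarrow>
     fst w' = tangent_map M N \<Phi> m (fst w) \<and>
     (\<forall>u. blinfun_apply (snd w') (tangent_map M N \<Phi> m u) = blinfun_apply (snd w) u + \<omega> m [fst w, u])"

definition dirac_morphism ::
  "('m::{t2_space, second_countable_topology}, 'a::euclidean_space, 'y) charts_scheme \<Rightarrow>
   ('m \<Rightarrow> 'a gtangent set) \<Rightarrow> ('m, 'a, real) form \<Rightarrow>
   ('n::{t2_space, second_countable_topology}, 'b::euclidean_space, 'z) charts_scheme \<Rightarrow>
   ('n \<Rightarrow> 'b gtangent set) \<Rightarrow> ('n, 'b, real) form \<Rightarrow>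
   ('m \<Rightarrow> 'n) \<Rightarrow> ('m, 'a, real) form \<Rightarrow> bool" where
  "dirac_morphism M E \<eta> N E' \<eta>' \<Phi> \<omega> \<longleftrightarrow>
     dirac_manifold M E \<eta> \<and> dirac_manifold N E' \<eta>' \<and>
     smooth_map M N \<Phi> \<and> smooth_form M \<omega> \<and> has_degree \<omega> 2 \<and>
     (\<forall>m vs. \<eta> m vs + ext_deriv M \<omega> m vs = pullback M N \<Phi> \<eta>' m vs) \<and>
     (\<forall>m. E' (\<Phi> m) = {w'. \<exists>w\<in>E m. dirac_related M N \<Phi> \<omega> m w w'})"

text \<open>
  The restriction of a Dirac morphism to an open subset \<open>U\<close> of its source is again a Dirac morphism;
  it is strong if the condition on kernels holds at the points of \<open>U\<close>.
\<close>

definition strong_dirac_morphism_over ::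
  "'m set \<Rightarrow> ('m::{t2_space, second_countable_topology}, 'a::euclidean_space, 'y) charts_scheme \<Rightarrow>
   ('m \<Rightarrow> 'a gtangent set) \<Rightarrow> ('m, 'a, real) form \<Rightarrow>
   ('n::{t2_space, second_countable_topology}, 'b::euclidean_space, 'z) charts_scheme \<Rightarrow>
   ('n \<Rightarrow> 'b gtangent set) \<Rightarrow> ('n, 'b, real) form \<Rightarrow>
   ('m \<Rightarrow> 'n) \<Rightarrow> ('m, 'a, real) form \<Rightarrow> bool" where
  "strong_dirac_morphism_over U M E \<eta> N E' \<eta>' \<Phi> \<omega> \<longleftrightarrow>
     open U \<and> dirac_morphism M E \<eta> N E' \<eta>' \<Phi> \<omega> \<and>
     (\<forall>m\<in>U. \<forall>w\<in>E m. dirac_related M N \<Phi> \<omega> m w 0 \<longrightarrow> w = 0)"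


section \<open>Lie groups\<close>

text \<open>
  The Lie algebra of \<open>G\<close> is the tangent space at \<open>gone G\<close>, so its underlying vector space is \<open>'a\<close>. The
  Euclidean inner product of \<open>'a\<close> plays no role.
\<close>

record ('g, 'a) lie_group_data = "('g, 'a) charts" +
  gmult :: "'g \<Rightarrow> 'g \<Rightarrow> 'g"
  gone :: 'g
  ginv :: "'g \<Rightarrow> 'g"

definition lie_group ::
  "('g::{t2_space, second_countable_topology}, 'a::euclidean_space) lie_group_data \<Rightarrow> bool" where
  "lie_group G \<longleftrightarrow> smooth_manifold G \<and> group (gmult G) (gone G) (ginv G) \<and>
     smooth_map (prod_charts G G) G (\<lambda>(g, h). gmult G g h) \<and> smooth_map G G (ginv G)"

context
  fixes G :: "('g::{t2_space, second_countable_topology}, 'a::euclidean_space) lie_group_data"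
begin

definition left_inv_vf :: "'a \<Rightarrow> 'g \<Rightarrow> 'a" where
  "left_inv_vf \<xi> g = tangent_map G G (\<lambda>h. gmult G g h) (gone G) \<xi>"

definition right_inv_vf :: "'a \<Rightarrow> 'g \<Rightarrow> 'a" where
  "right_inv_vf \<xi> g = tangent_map G G (\<lambda>h. gmult G h g) (gone G) \<xi>"

definition left_mc :: "'g \<Rightarrow> 'a \<Rightarrow> 'a" where
  "left_mc g = tangent_map G G (\<lambda>h. gmult G (ginv G g) h) g"

definition right_mc :: "'g \<Rightarrow> 'a \<Rightarrow> 'a" where
  "right_mc g = tangent_map G G (\<lambda>h. gmult G h (ginv G g)) g"

definition lie_bracket :: "'a \<Rightarrow> 'a \<Rightarrow> 'a" where
  "lie_bracket \<xi> \<zeta> = lie_bracket_vf G (left_inv_vf \<xi>) (left_inv_vf \<zeta>) (gone G)"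

definition Ad :: "'g \<Rightarrow> 'a \<Rightarrow> 'a" where
  "Ad g = tangent_map G G (\<lambda>h. gmult G (gmult G g h) (ginv G g)) (gone G)"

definition one_parameter_subgroup :: "'a \<Rightarrow> (real \<Rightarrow> 'g) \<Rightarrow> bool" where
  "one_parameter_subgroup \<xi> c \<longleftrightarrow>
     smooth_map euclidean_charts G c \<and> (\<forall>s t. c (s + t) = gmult G (c s) (c t)) \<and>
     tangent_map euclidean_charts G c 0 1 = \<xi>"

definition lie_exp :: "'a \<Rightarrow> 'g" where
  "lie_exp \<xi> = (THE c. one_parameter_subgroup \<xi> c) 1"

text \<open>As usual in this context, an inner product need not be positive definite.\<close>

definition invariant_inner_product :: "('a \<Rightarrow> 'a \<Rightarrow> real) \<Rightarrow> bool" where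
  "invariant_inner_product B \<longleftrightarrow> bilinear B \<and> (\<forall>\<xi> \<zeta>. B \<xi> \<zeta> = B \<zeta> \<xi>) \<and>
     (\<forall>\<xi>. (\<forall>\<zeta>. B \<xi> \<zeta> = 0) \<longrightarrow> \<xi> = 0) \<and> (\<forall>g \<xi> \<zeta>. B (Ad g \<xi>) (Ad g \<zeta>) = B \<xi> \<zeta>)"

definition cartan_form :: "('a \<Rightarrow> 'a \<Rightarrow> real) \<Rightarrow> ('g, 'a, real) form" where
  "cartan_form B g vs =
     1 / 12 * wedge_via B (one_form left_mc)
                (wedge_via lie_bracket (one_form left_mc) (one_form left_mc)) g vs"

definition cartan_dirac_gen :: "('a \<Rightarrow> 'a \<Rightarrow> real) \<Rightarrow> 'a \<Rightarrow> 'g \<Rightarrow> 'a gtangent" where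
  "cartan_dirac_gen B \<xi> g =
     (left_inv_vf \<xi> g - right_inv_vf \<xi> g,
      Blinfun (\<lambda>v. B ((1 / 2) *\<^sub>R (left_mc g v + right_mc g v)) \<xi>))"

definition cartan_dirac :: "('a \<Rightarrow> 'a \<Rightarrow> real) \<Rightarrow> 'g \<Rightarrow> 'a gtangent set" where
  "cartan_dirac B g = span (range (\<lambda>\<xi>. cartan_dirac_gen B \<xi> g))"

definition lie_alg_dirac_gen :: "('a \<Rightarrow> 'a \<Rightarrow> real) \<Rightarrow> 'a \<Rightarrow> 'a \<Rightarrow> 'a gtangent" where
  "lie_alg_dirac_gen B \<xi> \<nu> = (- lie_bracket \<xi> \<nu>, Blinfun (\<lambda>v. B v \<xi>))"

definition lie_alg_dirac :: "('a \<Rightarrow> 'a \<Rightarrow> real) \<Rightarrow> 'a \<Rightarrow> 'a gtangent set" where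
  "lie_alg_dirac B \<nu> = span (range (\<lambda>\<xi>. lie_alg_dirac_gen B \<xi> \<nu>))"

definition exp_regular :: "'a set" where
  "exp_regular = {\<nu>. bij (tangent_map euclidean_charts G lie_exp \<nu>)}"

end

text \<open>
  The de Rham homotopy operator of \<open>h (t, \<nu>) = t \<nu>\<close>: contract \<open>h\<^sup>*\<phi>\<close> with \<open>\<partial>/\<partial>t\<close> and integrate over
  \<open>t \<in> [0, 1]\<close>.
\<close>

definition radial_homotopy_op :: "('a, 'a::euclidean_space, real) form \<Rightarrow> ('a, 'a, real) form" where
  "radial_homotopy_op \<phi> \<nu> vs =
     integral {0..1} (\<lambda>t::real.
       pullback euclidean_charts euclidean_charts (\<lambda>(s, x). s *\<^sub>R x) \<phi> (t, \<nu>)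
         ((1, 0) # map (\<lambda>v. (0, v)) vs))"

definition varpi ::
  "('g::{t2_space, second_countable_topology}, 'a::euclidean_space) lie_group_data \<Rightarrow>
   ('a \<Rightarrow> 'a \<Rightarrow> real) \<Rightarrow> ('a, 'a, real) form" where
  "varpi G B = radial_homotopy_op (pullback euclidean_charts G (lie_exp G) (cartan_form G B))"

end

theory Submission
  imports Defs
begin

text \<open>
  Everything on \<open>G\<close> is expressed in the left trivialisation. With \<open>A = Ad g\<^sup>-\<^sup>1\<close>, the structure \<open>E\<^sub>G\<close>
  consists of the pairs \<open>(\<xi> - A \<xi>, (\<xi> + A \<xi>) / 2)\<close>, from which \<open>\<xi>\<close> is recovered linearly; so
  isotropy, maximality and integrability become identities in the Lie algebra, which rest on the
  Maurer--Cartan equation and on the fact that the bracket is the derivative of \<open>Ad\<close>.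

  The exponential map is obtained from one-parameter subgroups, which exist by Picard--Lindelof in a
  single chart. The quotient \<open>exp (t (\<nu> + v)) exp (t \<nu>)\<^sup>-\<^sup>1\<close> has the small logarithmic derivative
  \<open>Ad (exp (t \<nu>)) v\<close>; this shows that \<open>exp\<close> is differentiable, with left-trivialised differential
  \<open>v \<mapsto> \<integral> Ad (exp (-s \<nu>)) v ds\<close> over \<open>[0, 1]\<close>. Since this formula expresses the differential through
  \<open>exp\<close> itself, smoothness follows by bootstrapping.

  The Poincare lemma gives \<open>d \<varpi> = exp\<^sup>* \<eta>\<close>. Differentiating \<open>B((\<xi> + Ad (exp (-t \<nu>)) \<xi>) / 2, S\<^sub>t w)\<close>
  in \<open>t\<close>, where \<open>S\<^sub>t\<close> is the differential of \<open>\<nu> \<mapsto> exp (t \<nu>)\<close>, shows that the generators of \<open>E\<^sub>\<gg>\<close>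
  and \<open>E\<^sub>G\<close> with the same \<open>\<xi>\<close> are related. The forward image of \<open>E\<^sub>\<gg>\<close> is isotropic and contains the
  Lagrangian \<open>E\<^sub>G\<close>, so the two agree.
\<close>

section \<open>Calculus of finitely differentiable maps\<close>

text \<open>A tangent vector at \<open>p\<close> is written in the preferred chart at
  \<open>p\<close>, which jumps as \<open>p\<close> varies, so vector fields and forms cannot be
  differentiated as they stand. The Maurer-Cartan form turns them into functions with values in one
  fixed vector space, and these have honest derivatives in any chart. For the same reason
  group-valued maps are differentiated through \<open>has_lderiv\<close>, after translating the
  value at the point to the identity. Differentiability of \<open>exp\<close> is not read off from
  smooth dependence of a flow on parameters: integral curves are produced one at a time, and the
  dependence on the exponent comes from an estimate on a short curve near the identity. This also
  reaches points whose exponential lies far outside the chart at the identity. The Courant bracket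
  is given only as a relation tested on all forms. Two kinds of test form determine it: the constant
  function 1 detects the covector part, and the components of the frame form detect the vector
  part.\<close>

lemma isCont_eventually_nhds:
  fixes f :: "'a::t2_space \<Rightarrow> 'b::topological_space"
  assumes "isCont f x" "eventually P (nhds (f x))" shows "\<forall>\<^sub>F y in nhds x. P (f y)"
proof -
  obtain S where S: "open S" "f x \<in> S" "\<And>y. y \<in> S \<Longrightarrow> P y"
    using assms(2) unfolding eventually_nhds by blast
  then obtain T where "open T" "x \<in> T" "\<And>y. y \<in> T \<Longrightarrow> f y \<in> S"
    using assms(1) unfolding continuous_at_open by metis
  then show ?thesis unfolding eventually_nhds using S by blast
qed

lemma has_derivative_cong_ev:
  assumes "\<forall>\<^sub>F y in nhds x. f y = g y" "(f has_derivative D) (at x)"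
  shows "(g has_derivative D) (at x)"
proof (rule has_derivative_transform_eventually[OF assms(2)])
  show "f x = g x" using assms(1) by (rule eventually_nhds_x_imp_x)
  show "\<forall>\<^sub>F y in at x. f y = g y"
    using assms(1) unfolding eventually_at_filter by (rule eventually_mono) simp
qed simp

lemma frechet_derivative_cong_ev:
  assumes "\<forall>\<^sub>F y in nhds x. f y = g y"
  shows "frechet_derivative f (at x) = frechet_derivative g (at x)"
proof -
  have "\<forall>\<^sub>F y in nhds x. g y = f y" using assms by (rule eventually_mono) simp
  then have "(f has_derivative D) (at x) = (g has_derivative D) (at x)" for D
    using assms has_derivative_cong_ev by blast
  then show ?thesis unfolding frechet_derivative_def by presburger
qed

lemma Ck_on_subset: "Ck_on k S f \<Longrightarrow> T \<subseteq> S \<Longrightarrow> Ck_on k T f"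
  by (induction k arbitrary: f) (auto intro: continuous_on_subset)

lemma Ck_on_cong:
  "open S \<Longrightarrow> (\<And>x. x \<in> S \<Longrightarrow> f x = g x) \<Longrightarrow> Ck_on k S f \<Longrightarrow> Ck_on k S g"
proof (induction k arbitrary: f g)
  case 0 then show ?case by (metis Ck_on.simps(1) continuous_on_cong)
next
  case (Suc k)
  have ev: "\<forall>\<^sub>F y in nhds x. f y = g y" if "x \<in> S" for x
    using Suc.prems that by (auto simp: eventually_nhds)
  have d: "frechet_derivative f (at x) = frechet_derivative g (at x)" if "x \<in> S" for x
    using frechet_derivative_cong_ev[OF ev[OF that]] .
  have "g differentiable (at x)" if "x \<in> S" for x
    using Suc.prems(3) has_derivative_cong_ev[OF ev[OF that]] that
    unfolding differentiable_def Ck_on.simps by blast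
  moreover have "Ck_on k S (\<lambda>x. frechet_derivative g (at x) v)" for v
    using Suc.IH[OF Suc.prems(1), of "\<lambda>x. frechet_derivative f (at x) v"] d Suc.prems(3) by simp
  ultimately show ?case by simp
qed

lemma Ck_on_SucD: "Ck_on (Suc k) S f \<Longrightarrow> Ck_on k S f"
proof (induction k arbitrary: f)
  case 0 then show ?case
    by (metis Ck_on.simps continuous_at_imp_continuous_on differentiable_imp_continuous_within)
next
  case (Suc k) then show ?case by (metis Ck_on.simps(2))
qed

lemma Ck_on_locally:
  "(\<And>x. x \<in> S \<Longrightarrow> \<exists>U. open U \<and> x \<in> U \<and> Ck_on k U f) \<Longrightarrow> Ck_on k S f"
proof (induction k arbitrary: f)
  case 0 then show ?case
    by (metis Ck_on.simps(1) continuous_at_imp_continuous_on continuous_on_eq_continuous_at)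
next
  case (Suc k) show ?case
    unfolding Ck_on.simps using Suc.prems by (fastforce intro: Suc.IH)
qed

lemma Ck_on_const: "Ck_on k S (\<lambda>x. c)"
  by (induction k arbitrary: c) auto

lemma Ck_on_add: "open S \<Longrightarrow> Ck_on k S f \<Longrightarrow> Ck_on k S g \<Longrightarrow> Ck_on k S (\<lambda>x. f x + g x)"
proof (induction k arbitrary: f g)
  case 0 then show ?case by (simp add: continuous_on_add)
next
  case (Suc k)
  have d: "((\<lambda>x. f x + g x) has_derivative
     (\<lambda>v. frechet_derivative f (at x) v + frechet_derivative g (at x) v)) (at x)"
    if "x \<in> S" for x
    by (rule has_derivative_add) (use Suc.prems that in \<open>auto simp: frechet_derivative_works[symmetric]\<close>)
  have "Ck_on k S (\<lambda>x. frechet_derivative (\<lambda>x. f x + g x) (at x) v)" for v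
    by (rule Ck_on_cong[OF Suc.prems(1) _ Suc.IH[OF Suc.prems(1), of "\<lambda>x. frechet_derivative f (at x) v" "\<lambda>x. frechet_derivative g (at x) v"]])
      (use Suc.prems frechet_derivative_at[OF d] in \<open>auto dest: fun_cong\<close>)
  then show ?case using d by (auto simp: differentiable_def)
qed

lemma Ck_on_bilinear:
  assumes "bounded_bilinear h"
  shows "open S \<Longrightarrow> Ck_on k S f \<Longrightarrow> Ck_on k S g \<Longrightarrow> Ck_on k S (\<lambda>x. h (f x) (g x))"
proof (induction k arbitrary: f g)
  case 0 then show ?case using bounded_bilinear.continuous_on[OF assms] by auto
next
  case (Suc k)
  have d: "((\<lambda>x. h (f x) (g x)) has_derivative
     (\<lambda>v. h (f x) (frechet_derivative g (at x) v) + h (frechet_derivative f (at x) v) (g x))) (at x)"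
    if "x \<in> S" for x
    by (rule bounded_bilinear.FDERIV[OF assms])
      (use Suc.prems that in \<open>auto simp: frechet_derivative_works[symmetric]\<close>)
  have "Ck_on k S (\<lambda>x. frechet_derivative (\<lambda>x. h (f x) (g x)) (at x) v)" for v
  proof (rule Ck_on_cong[OF Suc.prems(1)])
    \<comment> \<open>The product rule pairs an undifferentiated factor of order
      \<open>k + 1\<close> with a derivative of order \<open>k\<close>; the former is lowered by one
      order so that the induction hypothesis fits both summands.\<close>
    show "Ck_on k S (\<lambda>x. h (f x) (frechet_derivative g (at x) v) + h (frechet_derivative f (at x) v) (g x))"
      using Suc.prems(2,3)[THEN Ck_on_SucD] Suc.prems by (intro Ck_on_add Suc.IH) auto
  qed (use frechet_derivative_at[OF d] in \<open>auto dest: fun_cong\<close>)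
  then show ?case using d by (auto simp: differentiable_def)
qed

text \<open>Local expressions in charts make sense only near a point. Stating regularity for germs
  keeps the shrinking domains out of the closure rules.\<close>

definition Ck_near :: "nat \<Rightarrow> ('a::real_normed_vector \<Rightarrow> 'b::real_normed_vector) \<Rightarrow> 'a \<Rightarrow> bool" where
  "Ck_near k f x \<longleftrightarrow> (\<exists>U. open U \<and> x \<in> U \<and> Ck_on k U f)"

lemma Ck_on_iff_near: "open S \<Longrightarrow> Ck_on k S f \<longleftrightarrow> (\<forall>x\<in>S. Ck_near k f x)"
  unfolding Ck_near_def using Ck_on_locally[of S k f] by blast

lemma Ck_near_eventually: "Ck_near k f x \<Longrightarrow> \<forall>\<^sub>F y in nhds x. Ck_near k f y"
  unfolding Ck_near_def eventually_nhds by blast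

lemma Ck_near_cong:
  assumes "Ck_near k f x" "\<forall>\<^sub>F y in nhds x. f y = g y"
  shows "Ck_near k g x"
proof -
  obtain U where U: "open U" "x \<in> U" "Ck_on k U f" using assms(1) unfolding Ck_near_def by blast
  obtain V where V: "open V" "x \<in> V" "\<And>y. y \<in> V \<Longrightarrow> f y = g y"
    using assms(2) unfolding eventually_nhds by blast
  have "Ck_on k (U \<inter> V) g"
    by (rule Ck_on_cong[of "U \<inter> V" f]) (use U V in \<open>auto intro: Ck_on_subset\<close>)
  then show ?thesis unfolding Ck_near_def using U V by blast
qed

lemma Ck_near_SucD: "Ck_near (Suc k) f x \<Longrightarrow> Ck_near k f x"
  unfolding Ck_near_def using Ck_on_SucD by blast

lemma Ck_near_le: "Ck_near k f x \<Longrightarrow> j \<le> k \<Longrightarrow> Ck_near j f x"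
  by (induction k) (auto simp: le_Suc_eq dest: Ck_near_SucD)

lemma Ck_near_imp_isCont: "Ck_near k f x \<Longrightarrow> isCont f x"
  using Ck_near_le[of k f x 0] unfolding Ck_near_def
  by (auto simp: continuous_on_eq_continuous_at)

lemma Ck_near_0: "Ck_near 0 f x \<longleftrightarrow> (\<forall>\<^sub>F y in nhds x. isCont f y)"
  unfolding Ck_near_def eventually_nhds Ck_on.simps
  by (rule ex_cong) (auto simp: continuous_on_eq_continuous_at)

lemma Ck_near_differentiable: "Ck_near (Suc k) f x \<Longrightarrow> f differentiable (at x)"
  unfolding Ck_near_def by auto

lemma Ck_near_has_derivative:
  "Ck_near (Suc k) f x \<Longrightarrow> (f has_derivative frechet_derivative f (at x)) (at x)"
  using Ck_near_differentiable frechet_derivative_works by blast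

lemma Ck_near_frechet:
  "Ck_near (Suc k) f x \<Longrightarrow> Ck_near k (\<lambda>y. frechet_derivative f (at y) v) x"
  unfolding Ck_near_def by auto

lemma Ck_near_const: "Ck_near k (\<lambda>x. c) x"
  unfolding Ck_near_def using Ck_on_const by blast

lemma Ck_near_bilinear:
  assumes "bounded_bilinear h" "Ck_near k f x" "Ck_near k g x"
  shows "Ck_near k (\<lambda>x. h (f x) (g x)) x"
proof -
  obtain U V where "open U" "x \<in> U" "Ck_on k U f" "open V" "x \<in> V" "Ck_on k V g"
    using assms unfolding Ck_near_def by blast
  then have "open (U \<inter> V)" "x \<in> U \<inter> V" "Ck_on k (U \<inter> V) (\<lambda>x. h (f x) (g x))"
    by (auto intro!: Ck_on_bilinear[OF assms(1)] intro: Ck_on_subset)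
  then show ?thesis unfolding Ck_near_def by blast
qed

lemma Ck_near_add:
  assumes "Ck_near k f x" "Ck_near k g x"
  shows "Ck_near k (\<lambda>x. f x + g x) x"
proof -
  obtain U V where "open U" "x \<in> U" "Ck_on k U f" "open V" "x \<in> V" "Ck_on k V g"
    using assms unfolding Ck_near_def by blast
  then have "open (U \<inter> V)" "x \<in> U \<inter> V" "Ck_on k (U \<inter> V) (\<lambda>x. f x + g x)"
    by (auto intro!: Ck_on_add intro: Ck_on_subset)
  then show ?thesis unfolding Ck_near_def by blast
qed

lemma Ck_near_scaleR: "Ck_near k f x \<Longrightarrow> Ck_near k g x \<Longrightarrow> Ck_near k (\<lambda>x. f x *\<^sub>R g x) x"
  by (rule Ck_near_bilinear[OF bounded_bilinear_scaleR])

lemma Ck_near_sum: "(\<And>i. i \<in> A \<Longrightarrow> Ck_near k (f i) x) \<Longrightarrow> Ck_near k (\<lambda>x. \<Sum>i\<in>A. f i x) x"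
  by (induction A rule: infinite_finite_induct) (auto intro: Ck_near_const Ck_near_add)

lemma linear_expand:
  fixes f :: "'a::euclidean_space \<Rightarrow> 'b::real_vector"
  assumes "linear f" shows "f v = (\<Sum>b\<in>Basis. (v \<bullet> b) *\<^sub>R f b)"
proof -
  have "f v = f (\<Sum>b\<in>Basis. (v \<bullet> b) *\<^sub>R b)" by (simp add: euclidean_representation)
  also have "\<dots> = (\<Sum>b\<in>Basis. (v \<bullet> b) *\<^sub>R f b)"
    by (simp add: linear_sum[OF assms] linear_scale[OF assms])
  finally show ?thesis .
qed

text \<open>A derivative is linear, so the basis directions control all others. As there are
  finitely many, one neighbourhood serves them all.\<close>

lemma Ck_near_SucI_directional:
  fixes f :: "'a::euclidean_space \<Rightarrow> 'b::real_normed_vector"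
  assumes d: "\<forall>\<^sub>F y in nhds x. f differentiable (at y)"
    and k: "\<And>v. v \<in> Basis \<Longrightarrow> Ck_near k (\<lambda>y. frechet_derivative f (at y) v) x"
  shows "Ck_near (Suc k) f x"
proof -
  obtain U where U: "open U" "x \<in> U" "\<And>y. y \<in> U \<Longrightarrow> f differentiable (at y)"
    using d unfolding eventually_nhds by blast
  have "\<forall>\<^sub>F y in nhds x. \<forall>b\<in>Basis. Ck_near k (\<lambda>y. frechet_derivative f (at y) b) y"
    using k by (intro eventually_ball_finite) (auto intro: Ck_near_eventually)
  then obtain V where V: "open V" "x \<in> V"
      "\<And>b y. b \<in> Basis \<Longrightarrow> y \<in> V \<Longrightarrow> Ck_near k (\<lambda>y. frechet_derivative f (at y) b) y"
    unfolding eventually_nhds by blast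
  have "Ck_on k (U \<inter> V) (\<lambda>y. frechet_derivative f (at y) v)" for v
  proof (rule Ck_on_cong)
    show "open (U \<inter> V)" using U V by blast
    show "Ck_on k (U \<inter> V) (\<lambda>y. \<Sum>b\<in>Basis. (v \<bullet> b) *\<^sub>R frechet_derivative f (at y) b)"
      unfolding Ck_on_iff_near[OF open_Int[OF U(1) V(1)]]
      by (intro ballI Ck_near_sum Ck_near_scaleR Ck_near_const V(3)) auto
    fix y assume "y \<in> U \<inter> V"
    then show "(\<Sum>b\<in>Basis. (v \<bullet> b) *\<^sub>R frechet_derivative f (at y) b) = frechet_derivative f (at y) v"
      using linear_expand[OF linear_frechet_derivative[OF U(3)], of y v] by simp
  qed
  then have "Ck_on (Suc k) (U \<inter> V) f" using U by auto
  then show ?thesis unfolding Ck_near_def using U V by blast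
qed

lemma Ck_near_SucI:
  fixes f :: "'a::euclidean_space \<Rightarrow> 'b::real_normed_vector"
  assumes d: "\<forall>\<^sub>F y in nhds x. (f has_derivative f' y) (at y)"
    and k: "\<And>v. v \<in> Basis \<Longrightarrow> Ck_near k (\<lambda>y. f' y v) x"
  shows "Ck_near (Suc k) f x"
proof (rule Ck_near_SucI_directional)
  show "\<forall>\<^sub>F y in nhds x. f differentiable (at y)"
    using d by (rule eventually_mono) (auto simp: differentiable_def)
  show "Ck_near k (\<lambda>y. frechet_derivative f (at y) v) x" if "v \<in> Basis" for v
    by (rule Ck_near_cong[OF k[OF that]], rule eventually_mono[OF d]) (metis frechet_derivative_at)
qed

lemma Ck_near_linear:
  fixes f :: "'a::euclidean_space \<Rightarrow> 'b::real_normed_vector"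
  assumes "linear f" shows "Ck_near k f x"
proof -
  have b: "bounded_linear f" using assms by (simp add: linear_conv_bounded_linear)
  show ?thesis
  proof (cases k)
    case 0 then show ?thesis using b by (simp add: Ck_near_0 linear_continuous_at)
  next
    case (Suc j)
    show ?thesis unfolding Suc
      by (rule Ck_near_SucI[where f'="\<lambda>_. f"])
        (use b in \<open>simp_all add: Ck_near_const bounded_linear_imp_has_derivative\<close>)
  qed
qed

lemma Ck_near_inner_const: "Ck_near k f x \<Longrightarrow> Ck_near k (\<lambda>x. f x \<bullet> b) x"
  by (rule Ck_near_bilinear[OF bounded_bilinear_inner]) (auto intro: Ck_near_const)

text \<open>The chain rule feeds the derivative of \<open>g\<close> a direction that moves with the
  point, while \<open>Ck_near\<close> speaks of fixed directions. Expanding that direction in the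
  basis leaves products of scalars with fixed-direction derivatives of \<open>g\<close>, and to
  these the induction hypothesis applies.\<close>

lemma Ck_near_compose:
  fixes g :: "'b::euclidean_space \<Rightarrow> 'c::real_normed_vector" and f :: "'a::euclidean_space \<Rightarrow> 'b"
  shows "Ck_near k g (f x) \<Longrightarrow> Ck_near k f x \<Longrightarrow> Ck_near k (\<lambda>x. g (f x)) x"
proof (induction k arbitrary: g)
  case 0
  have "isCont f x" using 0 Ck_near_imp_isCont by blast
  then have "\<forall>\<^sub>F y in nhds x. isCont g (f y)"
    using 0(1) isCont_eventually_nhds[of x f "isCont g"] unfolding Ck_near_0 by blast
  then show ?case using 0(2) unfolding Ck_near_0
    by eventually_elim (auto intro: continuous_at_compose[unfolded o_def])
next
  case (Suc k)
  have "isCont f x" using Suc Ck_near_imp_isCont by blast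
  then have evg: "\<forall>\<^sub>F y in nhds x. Ck_near (Suc k) g (f y)"
    using Ck_near_eventually[OF Suc.prems(1)] isCont_eventually_nhds[of x f] by blast
  have evf: "\<forall>\<^sub>F y in nhds x. Ck_near (Suc k) f y" using Ck_near_eventually Suc.prems(2) .
  have d: "\<forall>\<^sub>F y in nhds x. ((\<lambda>x. g (f x)) has_derivative
      (\<lambda>v. frechet_derivative g (at (f y)) (frechet_derivative f (at y) v))) (at y)"
    using evg evf
  proof eventually_elim
    case (elim y)
    show ?case
      by (rule has_derivative_compose[OF Ck_near_has_derivative[OF elim(2)] Ck_near_has_derivative[OF elim(1)]])
  qed
  have lin: "\<forall>\<^sub>F y in nhds x. linear (frechet_derivative g (at (f y)))"
    using evg by eventually_elim (meson Ck_near_differentiable linear_frechet_derivative)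
  show ?case
  proof (rule Ck_near_SucI[OF d])
    fix v :: 'a
    have "Ck_near k (\<lambda>y. \<Sum>b\<in>Basis. (frechet_derivative f (at y) v \<bullet> b) *\<^sub>R frechet_derivative g (at (f y)) b) x"
      by (intro Ck_near_sum Ck_near_scaleR Ck_near_inner_const Ck_near_frechet Suc
          Suc.IH[of "\<lambda>z. frechet_derivative g (at z) b" for b] Ck_near_SucD)
    then show "Ck_near k (\<lambda>y. frechet_derivative g (at (f y)) (frechet_derivative f (at y) v)) x"
      by (rule Ck_near_cong) (use lin in \<open>eventually_elim, metis linear_expand\<close>)
  qed
qed

lemma Ck_near_Pair:
  fixes f :: "'a::euclidean_space \<Rightarrow> 'b::euclidean_space" and g :: "'a \<Rightarrow> 'c::euclidean_space"
  assumes "Ck_near k f x" "Ck_near k g x"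
  shows "Ck_near k (\<lambda>x. (f x, g x)) x"
proof -
  have "Ck_near k (\<lambda>x. (f x, 0) + (0, g x)) x"
    by (intro Ck_near_add Ck_near_compose[OF _ assms(1), of "\<lambda>a. (a, 0)"]
        Ck_near_compose[OF _ assms(2), of "\<lambda>a. (0, a)"] Ck_near_linear)
      (auto intro!: linearI)
  then show ?thesis by simp
qed

lemma Ck_near_fst: "Ck_near k fst (x::'a::euclidean_space \<times> 'b::euclidean_space)"
  and Ck_near_snd: "Ck_near k snd (x::'a::euclidean_space \<times> 'b::euclidean_space)"
  by (auto intro!: Ck_near_linear linearI)

lemma Ck_near_id: "Ck_near k (\<lambda>x. x) (x::'a::euclidean_space)"
  by (auto intro!: Ck_near_linear linearI)

text \<open>Base point and direction of the partial derivative may both depend on the parameter.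
  This is the tool behind the regularity of \<open>Ad\<close>, of left trivialisations and of
  left-invariant fields, all of which are partial derivatives of the multiplication or of a quotient
  \<open>f(y)\<close> inverse times \<open>f(z)\<close>.\<close>

lemma Ck_near_frechet_along:
  fixes F :: "'a::euclidean_space \<Rightarrow> 'b::euclidean_space \<Rightarrow> 'c::real_normed_vector"
  assumes F: "Ck_near (Suc k) (\<lambda>p. F (fst p) (snd p)) (x, g x)"
    and g: "Ck_near k g x" and w: "Ck_near k w x"
  shows "Ck_near k (\<lambda>x. frechet_derivative (F x) (at (g x)) (w x)) x"
proof -
  let ?F = "\<lambda>p. F (fst p) (snd p)"
  have p: "Ck_near k (\<lambda>x. (x, g x)) x" by (intro Ck_near_Pair Ck_near_id g)
  have "isCont (\<lambda>x. (x, g x)) x" using p Ck_near_imp_isCont by blast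
  then have ev: "\<forall>\<^sub>F y in nhds x. Ck_near (Suc k) ?F (y, g y)"
    using isCont_eventually_nhds[of x "\<lambda>x. (x, g x)", OF _ Ck_near_eventually[OF F]] by blast
  have d: "frechet_derivative (F y) (at (g y)) v = frechet_derivative ?F (at (y, g y)) (0, v)"
    if "Ck_near (Suc k) ?F (y, g y)" for y v
  proof -
    have "((\<lambda>z. ?F (y, z)) has_derivative (\<lambda>v. frechet_derivative ?F (at (y, g y)) (0, v))) (at (g y))"
      by (rule has_derivative_compose[where f="\<lambda>z. (y, z)" and g="?F"])
        (auto intro!: derivative_eq_intros Ck_near_has_derivative[OF that])
    from frechet_derivative_at[OF this, symmetric] show ?thesis by simp
  qed
  have l: "linear (frechet_derivative ?F (at (y, g y)))" if "Ck_near (Suc k) ?F (y, g y)" for y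
    using that by (meson Ck_near_differentiable linear_frechet_derivative)
  have "Ck_near k (\<lambda>y. \<Sum>b\<in>Basis. (w y \<bullet> b) *\<^sub>R frechet_derivative ?F (at (y, g y)) (0, b)) x"
    by (intro Ck_near_sum Ck_near_scaleR Ck_near_inner_const w
       Ck_near_compose[OF _ p, of "\<lambda>q. frechet_derivative ?F (at q) (0,b)" for b] Ck_near_frechet[OF F])
  then show ?thesis
  proof (rule Ck_near_cong, use ev in eventually_elim)
    fix y assume y: "Ck_near (Suc k) ?F (y, g y)"
    have "linear (\<lambda>v. frechet_derivative ?F (at (y, g y)) (0, v))"
      using linear_compose[OF _ l[OF y], of "\<lambda>v. (0, v)"] by (simp add: o_def linearI)
    then show "(\<Sum>b\<in>Basis. (w y \<bullet> b) *\<^sub>R frechet_derivative ?F (at (y, g y)) (0, b)) =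
         frechet_derivative (F y) (at (g y)) (w y)"
      unfolding d[OF y] by (metis (no_types, lifting) linear_expand sum.cong)
  qed
qed

section \<open>Parameter integrals and the symmetry of second derivatives\<close>

lemma Ck_near_imp_continuous_on: "(\<And>x. Ck_near k f x) \<Longrightarrow> continuous_on S f"
  using Ck_near_imp_isCont by (auto intro!: continuous_at_imp_continuous_on)

text \<open>\<open>leibniz_rule\<close> expects a derivative that is continuous as an operator.
  Continuity in each fixed direction gives this in finite dimension, and evaluation at
  \<open>v\<close>, being bounded linear, commutes with the operator-valued integral.\<close>

lemma has_derivative_integral_param:
  fixes f :: "'a::euclidean_space \<Rightarrow> real \<Rightarrow> 'b::euclidean_space"
  assumes C1: "\<And>p. Ck_near (Suc 0) (\<lambda>p. f (fst p) (snd p)) p"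
    and d: "\<And>x t. ((\<lambda>x. f x t) has_derivative D x t) (at x)"
  shows "((\<lambda>x. integral {0..1} (f x)) has_derivative (\<lambda>v. integral {0..1} (\<lambda>t. D x t v))) (at x)"
proof -
  let ?F = "\<lambda>p. f (fst p) (snd p)"
  have dF: "(?F has_derivative frechet_derivative ?F (at p)) (at p)" for p
    using Ck_near_has_derivative[OF C1] .
  have "((\<lambda>x. f x t) has_derivative (\<lambda>v. frechet_derivative ?F (at (x, t)) (v, 0))) (at x)" for x t
    by (rule has_derivative_compose[where f="\<lambda>x. (x, t)" and g="?F", simplified fst_conv snd_conv])
      (auto intro!: derivative_eq_intros dF)
  then have D: "D x t = (\<lambda>v. frechet_derivative ?F (at (x, t)) (v, 0))" for x t
    using d has_derivative_unique by blast
  have bl: "bounded_linear (D x t)" for x t using d has_derivative_bounded_linear by blast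
  have DC: "Ck_near 0 (\<lambda>p. D (fst p) (snd p) v) p" for v p
    unfolding D by (simp add: Ck_near_frechet[OF C1])
  have cD: "continuous_on UNIV (\<lambda>p. Blinfun (D (fst p) (snd p)))"
    using Ck_near_imp_continuous_on[OF DC] by (intro continuous_on_blinfun_componentwise)
      (simp add: bounded_linear_Blinfun_apply bl)
  have cf: "continuous_on UNIV ?F" by (rule Ck_near_imp_continuous_on[OF C1])
  have "((\<lambda>x. integral (cbox 0 1) (f x)) has_derivative integral (cbox 0 1) (\<lambda>t. Blinfun (D x t))) (at x)"
  proof (rule leibniz_rule[where U=UNIV])
    show "((\<lambda>x. f x t) has_derivative blinfun_apply (Blinfun (D x t))) (at x)" for x t
      using d by (simp add: bounded_linear_Blinfun_apply bl)
    show "f x integrable_on cbox 0 1" for x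
      by (intro integrable_continuous continuous_on_compose2[OF cf, of _ "\<lambda>t. (x, t)", simplified fst_conv snd_conv] continuous_intros) auto
    show "continuous_on (UNIV \<times> cbox 0 1) (\<lambda>(x, t). Blinfun (D x t))"
      using cD by (auto simp: split_beta intro: continuous_on_subset)
  qed auto
  moreover have "blinfun_apply (integral (cbox 0 1) (\<lambda>t. Blinfun (D x t))) = (\<lambda>v. integral {0..1} (\<lambda>t. D x t v))"
  proof
    fix v
    have "(\<lambda>t. Blinfun (D x t)) integrable_on cbox 0 1"
      by (intro integrable_continuous continuous_on_compose2[OF cD, of _ "\<lambda>t. (x, t)", simplified fst_conv snd_conv] continuous_intros) auto
    from integral_linear[OF this, of "\<lambda>B. blinfun_apply B v"]
    show "blinfun_apply (integral (cbox 0 1) (\<lambda>t. Blinfun (D x t))) v = integral {0..1} (\<lambda>t. D x t v)"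
      by (simp add: o_def bounded_linear_Blinfun_apply bl blinfun.bounded_linear_left)
  qed
  ultimately show ?thesis by simp
qed

text \<open>Regularity is required jointly in the parameter and \<open>t\<close>, since in this form
  it passes to the directional derivatives \<open>D\<close> of the integrand, and the induction
  closes.\<close>

lemma Ck_near_integral_param:
  fixes f :: "'a::euclidean_space \<Rightarrow> real \<Rightarrow> 'b::euclidean_space"
  assumes "\<And>p. Ck_near k (\<lambda>p. f (fst p) (snd p)) p"
  shows "Ck_near k (\<lambda>x. integral {0..1} (f x)) x"
  using assms
proof (induction k arbitrary: f x)
  case 0
  have "continuous_on (UNIV \<times> cbox 0 1) (\<lambda>(x, t). f x t)"
    using Ck_near_imp_continuous_on[OF 0] by (auto simp: split_beta intro: continuous_on_subset)
  then have "continuous_on UNIV (\<lambda>x. integral (cbox 0 1) (f x))"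
    by (rule integral_continuous_on_param)
  then show ?case by (simp add: Ck_near_0 continuous_on_eq_continuous_at)
next
  case (Suc k)
  let ?F = "\<lambda>p. f (fst p) (snd p)"
  define D where "D x t v = frechet_derivative ?F (at (x, t)) (v, 0)" for x t v
  have d: "((\<lambda>x. f x t) has_derivative D x t) (at x)" for x t
    unfolding D_def by (rule has_derivative_compose[where f="\<lambda>x. (x, t)" and g="?F", simplified fst_conv snd_conv])
      (auto intro!: derivative_eq_intros Ck_near_has_derivative[OF Suc.prems])
  have "Ck_near (Suc 0) ?F p" for p by (rule Ck_near_le[OF Suc.prems]) simp
  note hd = has_derivative_integral_param[of f D, OF this d]
  have "Ck_near k (\<lambda>p. D (fst p) (snd p) v) p" for v p
    unfolding D_def by (simp add: Ck_near_frechet[OF Suc.prems])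
  then show ?case
    by (intro Ck_near_SucI[where f'="\<lambda>x v. integral {0..1} (\<lambda>t. D x t v)"]) (simp_all add: Suc.IH hd)
qed

text \<open>The derivative at \<open>s = 0\<close> of \<open>f (x + s v + t w) - f (x + s v)\<close>
  is computed twice: directly, and after writing the difference as an integral of the
  \<open>w\<close>-derivative over the segment of length \<open>t\<close>. Comparing the two and
  then differentiating in \<open>t\<close> at 0 exchanges the directions.\<close>

lemma second_derivative_symmetric:
  fixes f :: "'a::euclidean_space \<Rightarrow> 'b::euclidean_space"
  assumes f: "Ck_near (Suc (Suc 0)) f x"
  shows "frechet_derivative (\<lambda>y. frechet_derivative f (at y) w) (at x) v =
         frechet_derivative (\<lambda>y. frechet_derivative f (at y) v) (at x) w"
proof -
  let ?D = "\<lambda>u y. frechet_derivative f (at y) u"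
  let ?DD = "\<lambda>y. frechet_derivative (?D w) (at y) v"
  obtain U where "open U" "x \<in> U" "\<And>y. y \<in> U \<Longrightarrow> Ck_near (Suc (Suc 0)) f y"
    using Ck_near_eventually[OF f] unfolding eventually_nhds by blast
  then obtain r where r: "r > 0" and C2: "\<And>y. y \<in> ball x r \<Longrightarrow> Ck_near (Suc (Suc 0)) f y"
    by (metis open_contains_ball subsetD)
  \<comment> \<open>For parameters up to \<open>e\<close> the parallelogram spanned by
    \<open>v\<close> and \<open>w\<close> stays within distance \<open>r / 2\<close> of
    \<open>x\<close>; the summand 1 covers the case that both vectors vanish.\<close>
  define e where "e = r / (2 * (norm v + norm w + 1))"
  have pos: "0 < norm v + norm w + 1" using norm_ge_zero[of v] norm_ge_zero[of w] by linarith
  have e: "e > 0" unfolding e_def using r pos by simp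
  have inb: "x + s *\<^sub>R v + t *\<^sub>R w \<in> ball x r" if "\<bar>s\<bar> \<le> e" "\<bar>t\<bar> \<le> e" for s t
  proof -
    have "norm (s *\<^sub>R v + t *\<^sub>R w) \<le> \<bar>s\<bar> * norm v + \<bar>t\<bar> * norm w"
      by (metis norm_scaleR norm_triangle_ineq)
    also have "\<dots> \<le> e * norm v + e * norm w"
      using that by (intro add_mono mult_right_mono) auto
    also have "\<dots> < e * (norm v + norm w + 1)" using e by (simp add: algebra_simps)
    also have "\<dots> = r / 2" unfolding e_def using pos by (simp add: field_simps)
    finally have "norm (s *\<^sub>R v + t *\<^sub>R w) < r" using r by simp
    then show ?thesis by (metis add.assoc add_diff_cancel_left' dist_norm mem_ball norm_minus_commute)
  qed
  have df: "(f has_derivative frechet_derivative f (at y)) (at y)" if "y \<in> ball x r" for y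
    using C2[OF that] Ck_near_has_derivative by blast
  have dD: "(?D u has_derivative frechet_derivative (?D u) (at y)) (at y)" if "y \<in> ball x r" for y u
    using Ck_near_has_derivative[OF Ck_near_frechet[OF C2[OF that]]] by blast
  have line: "((\<lambda>s. g (p + s *\<^sub>R u)) has_vector_derivative g' u) (at s within S)"
    if "(g has_derivative g') (at (p + s *\<^sub>R u))" for g g' u p s S
  proof -
    have "((\<lambda>s. g (p + s *\<^sub>R u)) has_derivative (\<lambda>h. g' (h *\<^sub>R u))) (at s within S)"
      by (rule has_derivative_compose[where f="\<lambda>s. p + s *\<^sub>R u", OF _ that])
        (auto intro!: derivative_eq_intros)
    then show ?thesis
      using linear_scale[OF has_derivative_linear[OF that]] by (simp add: has_vector_derivative_def)
  qed
  have DDc: "isCont ?DD y" if "y \<in> ball x r" for y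
    using Ck_near_imp_isCont[OF Ck_near_frechet[OF Ck_near_frechet[OF C2[OF that]]]] .
  \<comment> \<open>The two computations of the \<open>s\<close>-derivative: fact 1 below goes
    through the integral, fact 2 is direct.\<close>
  have eq: "?D v (x + t *\<^sub>R w) - ?D v x = integral {0..t} (\<lambda>\<tau>. ?DD (x + \<tau> *\<^sub>R w))"
    if t: "t \<in> {0..e}" for t
  proof -
    have ftc: "((\<lambda>\<tau>. ?D w (x + s *\<^sub>R v + \<tau> *\<^sub>R w)) has_integral
        f (x + s *\<^sub>R v + t *\<^sub>R w) - f (x + s *\<^sub>R v + 0 *\<^sub>R w)) {0..t}" if "s \<in> {-e<..<e}" for s
      by (rule fundamental_theorem_of_calculus) (use t that in \<open>auto intro!: line[OF df] inb simp del: mem_ball\<close>)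
    have "((\<lambda>s. integral (cbox 0 t) (\<lambda>\<tau>. ?D w (x + s *\<^sub>R v + \<tau> *\<^sub>R w))) has_vector_derivative
        integral (cbox 0 t) (\<lambda>\<tau>. ?DD (x + 0 *\<^sub>R v + \<tau> *\<^sub>R w))) (at 0 within {-e<..<e})"
    proof (rule leibniz_rule_vector_derivative[where fx="\<lambda>s \<tau>. ?DD (x + s *\<^sub>R v + \<tau> *\<^sub>R w)"])
      show "((\<lambda>s. ?D w (x + s *\<^sub>R v + \<tau> *\<^sub>R w)) has_vector_derivative ?DD (x + s *\<^sub>R v + \<tau> *\<^sub>R w)) (at s within {-e<..<e})"
        if "s \<in> {-e<..<e}" "\<tau> \<in> cbox 0 t" for s \<tau>
      proof -
        have sw: "x + s *\<^sub>R v + \<tau> *\<^sub>R w = x + \<tau> *\<^sub>R w + s *\<^sub>R v" for s by (simp add: algebra_simps)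
        show ?thesis unfolding sw using inb[of s \<tau>] that t by (intro line dD) (auto simp: sw simp del: mem_ball)
      qed
      show "(\<lambda>\<tau>. ?D w (x + s *\<^sub>R v + \<tau> *\<^sub>R w)) integrable_on cbox 0 t" if "s \<in> {-e<..<e}" for s
        using ftc[OF that] by (auto simp: integrable_on_def)
      have "continuous_on (ball x r) ?DD" using DDc by (simp add: continuous_at_imp_continuous_on)
      then show "continuous_on ({-e<..<e} \<times> cbox 0 t) (\<lambda>(s, \<tau>). ?DD (x + s *\<^sub>R v + \<tau> *\<^sub>R w))"
        unfolding split_beta
        by (rule continuous_on_compose2) (use t in \<open>auto intro!: continuous_intros inb simp del: mem_ball\<close>)
    qed (use e in auto)
    then have 1: "((\<lambda>s. f (x + s *\<^sub>R v + t *\<^sub>R w) - f (x + s *\<^sub>R v)) has_vector_derivative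
        integral {0..t} (\<lambda>\<tau>. ?DD (x + \<tau> *\<^sub>R w))) (at 0 within {-e<..<e})"
      unfolding scaleR_zero_left add_0_right box_real
      by (rule has_vector_derivative_transform[of 0 "{-e<..<e}", rotated 2])
        (use e ftc[THEN integral_unique, symmetric] in auto)
    have 2: "((\<lambda>s. f ((x + t *\<^sub>R w) + s *\<^sub>R v) - f (x + s *\<^sub>R v)) has_vector_derivative
        ?D v (x + t *\<^sub>R w) - ?D v x) (at 0 within {-e<..<e})"
      using line[OF df, of "x + t *\<^sub>R w" 0 v] line[OF df, of x 0 v] inb[of 0 t] inb[of 0 0] t e
      by (intro has_vector_derivative_diff) auto
    show ?thesis
      using vector_derivative_unique_at[of "\<lambda>s. f (x + s *\<^sub>R v + t *\<^sub>R w) - f (x + s *\<^sub>R v)" _ 0] 1 2 e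
      by (simp add: at_within_open[of 0 "{-e<..<e}"] add.assoc add.commute add.left_commute)
  qed
  have c: "continuous_on {0..e} (\<lambda>\<tau>. ?DD (x + \<tau> *\<^sub>R w))"
  proof (rule continuous_on_compose2[where f="\<lambda>\<tau>. x + \<tau> *\<^sub>R w" and g="?DD"])
    show "continuous_on (ball x r) ?DD" using DDc by (simp add: continuous_at_imp_continuous_on)
    show "(\<lambda>\<tau>. x + \<tau> *\<^sub>R w) ` {0..e} \<subseteq> ball x r" using inb[of 0] e by (auto simp del: mem_ball)
  qed (auto intro!: continuous_intros)
  \<comment> \<open>The identity \<open>eq\<close> holds for nonnegative \<open>t\<close> only, so
    the derivatives at 0 are one-sided.\<close>
  have "((\<lambda>t. integral {0..t} (\<lambda>\<tau>. ?DD (x + \<tau> *\<^sub>R w))) has_vector_derivative ?DD (x + 0 *\<^sub>R w)) (at 0 within {0..e})"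
    using integral_has_vector_derivative[OF c, of 0] e by auto
  then have 3: "((\<lambda>t. ?D v (x + t *\<^sub>R w) - ?D v x) has_vector_derivative ?DD x) (at 0 within {0..e})"
    unfolding scaleR_zero_left add_0_right
    by (rule has_vector_derivative_transform[of 0 "{0..e}", rotated 2]) (use e eq in auto)
  have 4: "((\<lambda>t. ?D v (x + t *\<^sub>R w) - ?D v x) has_vector_derivative frechet_derivative (?D v) (at x) w) (at 0 within {0..e})"
    using line[OF dD, of x 0 w v] inb[of 0 0] e has_vector_derivative_diff_const by force
  show ?thesis
    using vector_derivative_unique_within_closed_interval[of 0 e 0] 3 4 e by (metis atLeastAtMost_iff box_real(2) less_eq_real_def)
qed

section \<open>Maps between manifolds\<close>

text \<open>The topological part of \<open>smooth_manifold\<close>. Derivatives are composed through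
  the preferred chart at the intermediate point, where no change of charts occurs, so this part
  suffices for the composition rules; it passes directly to products.\<close>

definition chart_system :: "('m::t2_space, 'a::euclidean_space, 'z) charts_scheme \<Rightarrow> bool" where
  "chart_system M \<longleftrightarrow> (\<forall>p. p \<in> chart_dom M p \<and> open (chart_dom M p) \<and> open (chart_img M p) \<and>
      homeomorphism (chart_dom M p) (chart_img M p) (coord M p) (chart_inv M p))"

lemma smooth_manifold_chart_system: "smooth_manifold M \<Longrightarrow> chart_system M"
  unfolding smooth_manifold_def chart_system_def by blast

lemma chart_systemD:
  assumes "chart_system M"
  shows "p \<in> chart_dom M p" "open (chart_dom M p)" "open (chart_img M p)"
    "continuous_on (chart_dom M p) (coord M p)" "continuous_on (chart_img M p) (chart_inv M p)"
  using assms by (auto simp: chart_system_def homeomorphism_def)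

lemma chart_inv_coord:
  assumes "chart_system M" "x \<in> chart_dom M p"
  shows "chart_inv M p (coord M p x) = x" "coord M p x \<in> chart_img M p"
  using assms by (auto simp: chart_system_def homeomorphism_def chart_img_def)

lemma coord_chart_inv:
  assumes "chart_system M" "y \<in> chart_img M p"
  shows "coord M p (chart_inv M p y) = y" "chart_inv M p y \<in> chart_dom M p"
  using assms by (auto simp: chart_system_def homeomorphism_def)

lemma coord_self:
  assumes "chart_system M"
  shows "chart_inv M p (coord M p p) = p" "coord M p p \<in> chart_img M p"
  using chart_inv_coord[OF assms chart_systemD(1)[OF assms]] by auto

lemma isCont_coord: "chart_system M \<Longrightarrow> x \<in> chart_dom M p \<Longrightarrow> isCont (coord M p) x"
  using chart_systemD(2,4) continuous_on_eq_continuous_at by blast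

lemma isCont_chart_inv: "chart_system M \<Longrightarrow> y \<in> chart_img M p \<Longrightarrow> isCont (chart_inv M p) y"
  using chart_systemD(3,5) continuous_on_eq_continuous_at by blast

lemma eventually_chart:
  assumes "chart_system M" "x \<in> chart_dom M q" "eventually P (nhds x)"
  shows "\<forall>\<^sub>F y in nhds (coord M q x). P (chart_inv M q y)"
  by (rule isCont_eventually_nhds[OF isCont_chart_inv])
    (use assms chart_inv_coord[OF assms(1,2)] in auto)

lemma eventually_chart_img:
  "chart_system M \<Longrightarrow> x \<in> chart_dom M q \<Longrightarrow> \<forall>\<^sub>F y in nhds (coord M q x). y \<in> chart_img M q"
  using chart_systemD(3) chart_inv_coord(2) eventually_nhds_in_open by blast

lemma eventually_in_chart:
  "chart_system M \<Longrightarrow> isCont f x \<Longrightarrow> f x \<in> chart_dom M q \<Longrightarrow> \<forall>\<^sub>F y in nhds x. f y \<in> chart_dom M q"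
  by (rule isCont_eventually_nhds[where P="\<lambda>y. y \<in> chart_dom M q"])
    (auto intro: eventually_nhds_in_open chart_systemD(2))

lemma euclidean_charts_simps [simp]:
  "chart_dom euclidean_charts p = UNIV" "coord euclidean_charts p x = x"
  "chart_inv euclidean_charts p y = y" "chart_img euclidean_charts p = UNIV"
  by (auto simp: euclidean_charts_def chart_inv_def chart_img_def inv_into_def)

lemma smooth_manifold_euclidean: "smooth_manifold (euclidean_charts :: ('a::euclidean_space, 'a) charts)"
proof -
  have "coord euclidean_charts q \<circ> chart_inv euclidean_charts p = (\<lambda>x. x::'a)" for p q by auto
  moreover have "smooth_on UNIV (\<lambda>x. x::'a)"
    unfolding smooth_on_def by (simp add: Ck_on_iff_near Ck_near_id)
  ultimately show ?thesis unfolding smooth_manifold_def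
    by (auto simp: homeomorphism_def)
qed

lemmas chart_system_euclidean = smooth_manifold_chart_system[OF smooth_manifold_euclidean]

lemma prod_charts_simps [simp]:
  "chart_dom (prod_charts M N) p = chart_dom M (fst p) \<times> chart_dom N (snd p)"
  "coord (prod_charts M N) p x = (coord M (fst p) (fst x), coord N (snd p) (snd x))"
  by (auto simp: prod_charts_def split_beta)

lemma chart_img_prod:
  "chart_img (prod_charts M N) p = chart_img M (fst p) \<times> chart_img N (snd p)"
  by (force simp: chart_img_def)

lemma chart_inv_prod:
  assumes "chart_system M" "chart_system N" "y \<in> chart_img (prod_charts M N) p"
  shows "chart_inv (prod_charts M N) p y = (chart_inv M (fst p) (fst y), chart_inv N (snd p) (snd y))"
proof -
  have y: "fst y \<in> chart_img M (fst p)" "snd y \<in> chart_img N (snd p)"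
    using assms(3) by (auto simp: chart_img_prod)
  have inj: "inj_on (coord (prod_charts M N) p) (chart_dom (prod_charts M N) p)"
    using chart_inv_coord(1)[OF assms(1)] chart_inv_coord(1)[OF assms(2)]
    by (auto intro!: inj_onI simp: prod_eq_iff) metis+
  show ?thesis unfolding chart_inv_def[of "prod_charts M N"]
    by (rule inv_into_f_eq[OF inj])
      (use coord_chart_inv[OF assms(1) y(1)] coord_chart_inv[OF assms(2) y(2)] in auto)
qed

lemma chart_system_prod:
  assumes "chart_system M" "chart_system N"
  shows "chart_system (prod_charts M N)"
proof -
  have "homeomorphism (chart_dom M (fst p) \<times> chart_dom N (snd p)) (chart_img (prod_charts M N) p)
      (coord (prod_charts M N) p) (chart_inv (prod_charts M N) p)" for p
  proof -
    have "continuous_on (chart_img M (fst p) \<times> chart_img N (snd p))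
        (\<lambda>y. (chart_inv M (fst p) (fst y), chart_inv N (snd p) (snd y)))"
      by (intro continuous_on_Pair continuous_on_compose2[OF chart_systemD(5)[OF assms(1)]]
         continuous_on_compose2[OF chart_systemD(5)[OF assms(2)]] continuous_intros) auto
    then have "continuous_on (chart_img (prod_charts M N) p) (chart_inv (prod_charts M N) p)"
      by (simp add: chart_inv_prod[OF assms] chart_img_prod[symmetric] cong: continuous_on_cong)
    moreover have "continuous_on (chart_dom M (fst p) \<times> chart_dom N (snd p))
       (\<lambda>x. (coord M (fst p) (fst x), coord N (snd p) (snd x)))"
      by (intro continuous_on_Pair continuous_on_compose2[OF chart_systemD(4)[OF assms(1)]]
         continuous_on_compose2[OF chart_systemD(4)[OF assms(2)]] continuous_intros) auto
    then have "continuous_on (chart_dom M (fst p) \<times> chart_dom N (snd p)) (coord (prod_charts M N) p)"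
      by (simp cong: continuous_on_cong)
    moreover have "chart_inv (prod_charts M N) p (coord (prod_charts M N) p x) = x \<and>
        coord (prod_charts M N) p x \<in> chart_img (prod_charts M N) p"
      if "x \<in> chart_dom M (fst p) \<times> chart_dom N (snd p)" for x
    proof -
      have "coord (prod_charts M N) p x \<in> chart_img (prod_charts M N) p"
        unfolding chart_img_def by (rule imageI) (use that in auto)
      then show ?thesis using that chart_inv_prod[OF assms, of "coord (prod_charts M N) p x" p]
        chart_inv_coord(1)[OF assms(1)] chart_inv_coord(1)[OF assms(2)] by auto
    qed
    moreover have "coord (prod_charts M N) p (chart_inv (prod_charts M N) p y) = y \<and>
       chart_inv (prod_charts M N) p y \<in> chart_dom M (fst p) \<times> chart_dom N (snd p)"
      if "y \<in> chart_img (prod_charts M N) p" for y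
      using that chart_inv_prod[OF assms that] coord_chart_inv[OF assms(1), of "fst y"] coord_chart_inv[OF assms(2), of "snd y"]
      by (auto simp: chart_img_prod)
    ultimately show ?thesis by (intro homeomorphismI image_subsetI) blast+
  qed
  then show ?thesis using chart_systemD[OF assms(1)] chart_systemD[OF assms(2)]
    unfolding chart_system_def by (auto simp: chart_img_prod open_Times)
qed

text \<open>Continuity is a separate clause because \<open>coord\<close> is arbitrary outside its
  chart domain: a differentiable local expression alone would not keep \<open>f\<close> near
  \<open>f p\<close>.\<close>

definition has_mderiv ::
  "('m::t2_space, 'a::real_normed_vector, 'y) charts_scheme \<Rightarrow> ('n::t2_space, 'b::real_normed_vector, 'z) charts_scheme \<Rightarrow>
   ('m \<Rightarrow> 'n) \<Rightarrow> 'm \<Rightarrow> ('a \<Rightarrow> 'b) \<Rightarrow> bool" where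
  "has_mderiv M N f p F \<longleftrightarrow> isCont f p \<and>
     ((\<lambda>y. coord N (f p) (f (chart_inv M p y))) has_derivative F) (at (coord M p p))"

definition Ck_at ::
  "nat \<Rightarrow> ('m::t2_space, 'a::real_normed_vector, 'y) charts_scheme \<Rightarrow> ('n::t2_space, 'b::real_normed_vector, 'z) charts_scheme \<Rightarrow>
   ('m \<Rightarrow> 'n) \<Rightarrow> 'm \<Rightarrow> bool" where
  "Ck_at k M N f p \<longleftrightarrow> isCont f p \<and>
     Ck_near k (\<lambda>y. coord N (f p) (f (chart_inv M p y))) (coord M p p)"

lemma has_mderiv_tangent_map: "has_mderiv M N f p F \<Longrightarrow> tangent_map M N f p = F"
  unfolding has_mderiv_def tangent_map_def o_def using frechet_derivative_at by metis

lemma has_mderiv_linear: "has_mderiv M N f p F \<Longrightarrow> linear F"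
  unfolding has_mderiv_def using has_derivative_linear by blast

lemma Ck_at_has_mderiv:
  "Ck_at (Suc k) M N f p \<Longrightarrow> has_mderiv M N f p (tangent_map M N f p)"
  unfolding Ck_at_def has_mderiv_def tangent_map_def o_def using Ck_near_has_derivative by blast

lemma has_mderiv_compose:
  assumes "chart_system M" "chart_system N"
    and f: "has_mderiv M N f p F" and g: "has_mderiv N K g (f p) G"
  shows "has_mderiv M K (\<lambda>x. g (f x)) p (\<lambda>v. G (F v))"
proof -
  have c: "isCont f p" "isCont g (f p)" using f g by (auto simp: has_mderiv_def)
  let ?r = "\<lambda>y. coord N (f p) (f (chart_inv M p y))"
  have r: "?r (coord M p p) = coord N (f p) (f p)" using coord_self[OF assms(1)] by simp
  have "\<forall>\<^sub>F x in nhds p. f x \<in> chart_dom N (f p)"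
    using eventually_in_chart[OF assms(2) c(1)] chart_systemD(1)[OF assms(2)] by blast
  then have ev: "\<forall>\<^sub>F y in nhds (coord M p p). f (chart_inv M p y) \<in> chart_dom N (f p)"
    by (rule eventually_chart[OF assms(1) chart_systemD(1)[OF assms(1)]])
  have "((\<lambda>y. coord K (g (f p)) (g (chart_inv N (f p) (?r y)))) has_derivative (\<lambda>v. G (F v))) (at (coord M p p))"
    by (rule has_derivative_compose[where f="?r"]) (use f g r in \<open>auto simp: has_mderiv_def\<close>)
  then have "((\<lambda>y. coord K (g (f p)) (g (f (chart_inv M p y)))) has_derivative (\<lambda>v. G (F v))) (at (coord M p p))"
    by (rule has_derivative_cong_ev[rotated])
      (use ev in \<open>eventually_elim, simp add: chart_inv_coord[OF assms(2)]\<close>)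
  then show ?thesis using c by (auto simp: has_mderiv_def intro: continuous_at_compose[unfolded o_def])
qed

lemma Ck_at_compose:
  fixes K :: "('k::t2_space, 'c::real_normed_vector, 'z) charts_scheme"
  assumes "chart_system M" "chart_system N"
    and f: "Ck_at k M N f p" and g: "Ck_at k N K g (f p)"
  shows "Ck_at k M K (\<lambda>x. g (f x)) p"
proof -
  have c: "isCont f p" "isCont g (f p)" using f g by (auto simp: Ck_at_def)
  let ?r = "\<lambda>y. coord N (f p) (f (chart_inv M p y))"
  have r: "?r (coord M p p) = coord N (f p) (f p)" using coord_self[OF assms(1)] by simp
  have "\<forall>\<^sub>F x in nhds p. f x \<in> chart_dom N (f p)"
    using eventually_in_chart[OF assms(2) c(1)] chart_systemD(1)[OF assms(2)] by blast
  then have ev: "\<forall>\<^sub>F y in nhds (coord M p p). f (chart_inv M p y) \<in> chart_dom N (f p)"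
    by (rule eventually_chart[OF assms(1) chart_systemD(1)[OF assms(1)]])
  have "Ck_near k (\<lambda>y. coord K (g (f p)) (g (chart_inv N (f p) (?r y)))) (coord M p p)"
    by (rule Ck_near_compose[where f="?r"]) (use f g r in \<open>auto simp: Ck_at_def\<close>)
  then have "Ck_near k (\<lambda>y. coord K (g (f p)) (g (f (chart_inv M p y)))) (coord M p p)"
    by (rule Ck_near_cong)
      (use ev in \<open>eventually_elim, simp add: chart_inv_coord[OF assms(2)]\<close>)
  then show ?thesis using c by (auto simp: Ck_at_def intro: continuous_at_compose[unfolded o_def])
qed

lemma has_mderiv_cong:
  assumes "chart_system M" "has_mderiv M N f p F" "\<forall>\<^sub>F x in nhds p. f x = g x"
  shows "has_mderiv M N g p F"
proof -
  have "f p = g p" using eventually_nhds_x_imp_x[OF assms(3)] .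
  moreover have "\<forall>\<^sub>F y in nhds (coord M p p). f (chart_inv M p y) = g (chart_inv M p y)"
    by (rule eventually_chart[OF assms(1) chart_systemD(1)[OF assms(1)] assms(3)])
  then have "\<forall>\<^sub>F y in nhds (coord M p p). coord N (g p) (f (chart_inv M p y)) = coord N (g p) (g (chart_inv M p y))"
    by (rule eventually_mono) simp
  moreover have "isCont g p" using assms(2,3) isCont_cong[OF assms(3)] by (auto simp: has_mderiv_def)
  ultimately show ?thesis using assms(2) unfolding has_mderiv_def by (auto intro: has_derivative_cong_ev)
qed

lemma has_mderiv_euclidean [simp]:
  "has_mderiv euclidean_charts euclidean_charts f x F \<longleftrightarrow> (f has_derivative F) (at x)"
  unfolding has_mderiv_def using has_derivative_continuous by auto

lemma Ck_at_euclidean [simp]: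
  "Ck_at k euclidean_charts euclidean_charts f x \<longleftrightarrow> Ck_near k f x"
  unfolding Ck_at_def using Ck_near_imp_isCont by auto

lemma Ck_at_const: "Ck_at k M N (\<lambda>x. c) p"
  unfolding Ck_at_def by (simp add: Ck_near_const)

lemma has_mderiv_const: "has_mderiv M N (\<lambda>x. c) p (\<lambda>v. 0)"
  unfolding has_mderiv_def by simp

lemma has_mderiv_id:
  assumes "chart_system M" shows "has_mderiv M M (\<lambda>x. x) p (\<lambda>v. v)"
proof -
  have "((\<lambda>y. coord M p (chart_inv M p y)) has_derivative (\<lambda>v. v)) (at (coord M p p))"
    by (rule has_derivative_cong_ev[OF _ has_derivative_ident],
        rule eventually_mono[OF eventually_chart_img[OF assms chart_systemD(1)[OF assms]]])
      (simp add: coord_chart_inv[OF assms])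
  then show ?thesis by (simp add: has_mderiv_def)
qed

lemma Ck_at_id:
  assumes "chart_system M" shows "Ck_at k M M (\<lambda>x. x) p"
proof -
  have "Ck_near k (\<lambda>y. coord M p (chart_inv M p y)) (coord M p p)"
    by (rule Ck_near_cong[OF Ck_near_id],
        rule eventually_mono[OF eventually_chart_img[OF assms chart_systemD(1)[OF assms]]])
      (simp add: coord_chart_inv[OF assms])
  then show ?thesis by (simp add: Ck_at_def)
qed

lemma has_mderiv_Pair:
  "has_mderiv K M f p F \<Longrightarrow> has_mderiv K N g p G \<Longrightarrow>
   has_mderiv K (prod_charts M N) (\<lambda>x. (f x, g x)) p (\<lambda>v. (F v, G v))"
  unfolding has_mderiv_def by (auto intro!: has_derivative_Pair continuous_Pair simp: isCont_Pair)

lemma Ck_at_Pair: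
  fixes M :: "('m::t2_space, 'a::euclidean_space, 'y) charts_scheme"
    and N :: "('n::t2_space, 'b::euclidean_space, 'z) charts_scheme"
    and K :: "('k::t2_space, 'c::euclidean_space, 'x) charts_scheme"
  shows "Ck_at k K M f p \<Longrightarrow> Ck_at k K N g p \<Longrightarrow> Ck_at k K (prod_charts M N) (\<lambda>x. (f x, g x)) p"
  unfolding Ck_at_def by (auto intro!: Ck_near_Pair simp: isCont_Pair)

lemma open_coord_image:
  assumes "chart_system M" "open W"
  shows "open (coord M p ` (chart_dom M p \<inter> W))"
proof -
  have "coord M p ` (chart_dom M p \<inter> W) = chart_img M p \<inter> chart_inv M p -` W"
  proof (intro equalityI subsetI)
    fix y assume y: "y \<in> chart_img M p \<inter> chart_inv M p -` W"
    then have "y = coord M p (chart_inv M p y)" "chart_inv M p y \<in> chart_dom M p \<inter> W"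
      using coord_chart_inv[OF assms(1), of y p] by auto
    then show "y \<in> coord M p ` (chart_dom M p \<inter> W)" by blast
  qed (use chart_inv_coord[OF assms(1)] in auto)
  then show ?thesis
    using continuous_on_open_vimage[OF chart_systemD(3)[OF assms(1)]] chart_systemD(5)[OF assms(1)] assms(2)
    by (metis inf_commute)
qed

lemma Ck_near_transition:
  assumes M: "smooth_manifold M" and p: "p \<in> chart_dom M q" "p \<in> chart_dom M r"
  shows "Ck_near k (\<lambda>y. coord M r (chart_inv M q y)) (coord M q p)"
proof -
  note c = smooth_manifold_chart_system[OF M]
  have "Ck_on k (coord M q ` (chart_dom M q \<inter> chart_dom M r)) (coord M r \<circ> chart_inv M q)"
    using M unfolding smooth_manifold_def smooth_on_def by blast
  moreover have "open (coord M q ` (chart_dom M q \<inter> chart_dom M r))"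
    by (rule open_coord_image[OF c chart_systemD(2)[OF c]])
  ultimately show ?thesis using p unfolding Ck_near_def o_def by blast
qed

text \<open>Near the point the new local expression is the old one between two transition maps.
  Continuity of \<open>f\<close> keeps its values in the domain of the old chart, where this
  factorisation holds.\<close>

lemma Ck_near_change_charts:
  assumes M: "smooth_manifold M" and N: "smooth_manifold N" and f: "isCont f p"
    and q: "p \<in> chart_dom M q" "p \<in> chart_dom M q'" and r: "f p \<in> chart_dom N r" "f p \<in> chart_dom N r'"
    and k: "Ck_near k (\<lambda>y. coord N r (f (chart_inv M q y))) (coord M q p)"
  shows "Ck_near k (\<lambda>y. coord N r' (f (chart_inv M q' y))) (coord M q' p)"
proof -
  note cM = smooth_manifold_chart_system[OF M] and cN = smooth_manifold_chart_system[OF N]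
  let ?t = "\<lambda>y. coord M q (chart_inv M q' y)"
  have t: "?t (coord M q' p) = coord M q p" using chart_inv_coord[OF cM q(2)] by simp
  have 1: "Ck_near k (\<lambda>y. coord N r (f (chart_inv M q (?t y)))) (coord M q' p)"
    by (rule Ck_near_compose[where f="?t"]) (use k t Ck_near_transition[OF M q(2,1)] in auto)
  have 2: "Ck_near k (\<lambda>y. coord N r' (chart_inv N r (coord N r (f (chart_inv M q (?t y)))))) (coord M q' p)"
    by (rule Ck_near_compose[where g="\<lambda>z. coord N r' (chart_inv N r z)", OF _ 1])
      (use Ck_near_transition[OF N r] t chart_inv_coord[OF cM q(1)] in auto)
  have "\<forall>\<^sub>F x in nhds p. f x \<in> chart_dom N r \<and> x \<in> chart_dom M q"
    using eventually_in_chart[OF cN f r(1)] eventually_nhds_in_open[OF chart_systemD(2)[OF cM] q(1)]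
    by eventually_elim auto
  then have "\<forall>\<^sub>F y in nhds (coord M q' p). f (chart_inv M q' y) \<in> chart_dom N r \<and> chart_inv M q' y \<in> chart_dom M q"
    by (rule eventually_chart[OF cM q(2)])
  then show ?thesis
    by (intro Ck_near_cong[OF 2], eventually_elim)
      (simp add: chart_inv_coord[OF cM] chart_inv_coord[OF cN])
qed

lemma Ck_at_iff:
  assumes M: "smooth_manifold M" and N: "smooth_manifold N"
    and q: "p \<in> chart_dom M q" and r: "f p \<in> chart_dom N r"
  shows "Ck_at k M N f p \<longleftrightarrow> isCont f p \<and> Ck_near k (\<lambda>y. coord N r (f (chart_inv M q y))) (coord M q p)"
  using Ck_near_change_charts[OF M N, where f=f and p=p] q r
    chart_systemD(1)[OF smooth_manifold_chart_system[OF M]] chart_systemD(1)[OF smooth_manifold_chart_system[OF N]]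
  unfolding Ck_at_def by blast

lemma Ck_at_coord:
  assumes M: "smooth_manifold M" and p: "p \<in> chart_dom M q"
  shows "Ck_at k M euclidean_charts (coord M q) p"
proof -
  note c = smooth_manifold_chart_system[OF M]
  show ?thesis using Ck_near_transition[OF M chart_systemD(1)[OF c] p] isCont_coord[OF c p]
    by (simp add: Ck_at_def)
qed

lemma Ck_at_chart_inv:
  assumes M: "smooth_manifold M" and y: "y \<in> chart_img M q"
  shows "Ck_at k euclidean_charts M (chart_inv M q) y"
proof -
  note c = smooth_manifold_chart_system[OF M]
  show ?thesis using Ck_near_transition[OF M coord_chart_inv(2)[OF c y] chart_systemD(1)[OF c]]
      isCont_chart_inv[OF c y] coord_chart_inv(1)[OF c y]
    by (simp add: Ck_at_def)
qed

lemma smooth_map_imp_Ck_at: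
  assumes "chart_system M" "chart_system N" "smooth_map M N f"
  shows "Ck_at k M N f p"
proof -
  have c: "continuous_on UNIV f" using assms(3) by (simp add: smooth_map_def)
  have "Ck_on k (coord M p ` (chart_dom M p \<inter> f -` chart_dom N (f p))) (coord N (f p) \<circ> f \<circ> chart_inv M p)"
    using assms(3) unfolding smooth_map_def smooth_on_def by blast
  moreover have "open (f -` chart_dom N (f p))"
    using c chart_systemD(2)[OF assms(2)] continuous_on_open_vimage[of UNIV f] by auto
  then have "open (coord M p ` (chart_dom M p \<inter> f -` chart_dom N (f p)))"
    by (rule open_coord_image[OF assms(1)])
  moreover have "coord M p p \<in> coord M p ` (chart_dom M p \<inter> f -` chart_dom N (f p))"
    using chart_systemD(1)[OF assms(1), of p] chart_systemD(1)[OF assms(2), of "f p"] by auto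
  ultimately have "Ck_near k (coord N (f p) \<circ> f \<circ> chart_inv M p) (coord M p p)"
    unfolding Ck_near_def by blast
  then show ?thesis using c by (simp add: Ck_at_def o_def continuous_on_eq_continuous_at)
qed

lemma smooth_map_iff_Ck_at:
  assumes M: "smooth_manifold M" and N: "smooth_manifold N"
  shows "smooth_map M N f \<longleftrightarrow> (\<forall>k p. Ck_at k M N f p)"
proof
  note cM = smooth_manifold_chart_system[OF M] and cN = smooth_manifold_chart_system[OF N]
  show "smooth_map M N f \<Longrightarrow> \<forall>k p. Ck_at k M N f p" using smooth_map_imp_Ck_at[OF cM cN] by blast
  assume *: "\<forall>k p. Ck_at k M N f p"
  then have c: "isCont f p" for p by (simp add: Ck_at_def)
  have "open (f -` chart_dom N r)" for r
    using c chart_systemD(2)[OF cN] continuous_on_open_vimage[of UNIV f] by (auto simp: continuous_on_eq_continuous_at)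
  then have "Ck_on k (coord M q ` (chart_dom M q \<inter> f -` chart_dom N r)) (coord N r \<circ> f \<circ> chart_inv M q)" for q r k
    using * Ck_at_iff[OF M N, of _ q f r k] by (auto simp: Ck_on_iff_near open_coord_image[OF cM] o_def)
  then show "smooth_map M N f" using c by (auto simp: smooth_map_def smooth_on_def continuous_on_eq_continuous_at)
qed

section \<open>Lie groups\<close>

text \<open>The charts in \<open>Ck_at\<close> move with the point, so nearby points are first
  handled in the charts fixed at \<open>p\<close> and \<open>f p\<close>. Continuity of
  \<open>f\<close> is given at \<open>p\<close> only; at nearby points it is regained by writing
  \<open>f\<close> as the inverse chart after its local expression.\<close>

lemma Ck_at_eventually:
  assumes M: "smooth_manifold M" and N: "smooth_manifold N" and f: "Ck_at k M N f p"
  shows "\<forall>\<^sub>F x in nhds p. Ck_at k M N f x"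
proof -
  note cM = smooth_manifold_chart_system[OF M] and cN = smooth_manifold_chart_system[OF N]
  let ?r = "\<lambda>y. coord N (f p) (f (chart_inv M p y))"
  have c: "isCont f p" and r: "Ck_near k ?r (coord M p p)" using f by (auto simp: Ck_at_def)
  have evr: "\<forall>\<^sub>F x in nhds p. Ck_near k ?r (coord M p x)"
    by (rule isCont_eventually_nhds[OF isCont_coord[OF cM chart_systemD(1)[OF cM]] Ck_near_eventually[OF r]])
  have "\<forall>\<^sub>F x in nhds p. x \<in> chart_dom M p \<and> f x \<in> chart_dom N (f p) \<and> Ck_near k ?r (coord M p x)"
    using evr eventually_in_chart[OF cN c chart_systemD(1)[OF cN]]
      eventually_nhds_in_open[OF chart_systemD(2)[OF cM] chart_systemD(1)[OF cM], of p]
    by eventually_elim auto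
  then obtain U where U: "open U" "p \<in> U"
      "\<And>x. x \<in> U \<Longrightarrow> x \<in> chart_dom M p \<and> f x \<in> chart_dom N (f p) \<and> Ck_near k ?r (coord M p x)"
    unfolding eventually_nhds by blast
  have "Ck_at k M N f x" if x: "x \<in> U" for x
  proof -
    have eq: "chart_inv N (f p) (?r (coord M p y)) = f y" if "y \<in> U" for y
      using U(3)[OF that] chart_inv_coord[OF cM] chart_inv_coord[OF cN] by simp
    have "isCont (\<lambda>y. chart_inv N (f p) (?r (coord M p y))) x"
    proof -
      have "isCont ?r (coord M p x)" using U(3)[OF x] Ck_near_imp_isCont by blast
      moreover have "isCont (coord M p) x" using U(3)[OF x] isCont_coord[OF cM] by blast
      ultimately have "isCont (\<lambda>y. ?r (coord M p y)) x" by (rule isCont_o2[rotated])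
      moreover have "isCont (chart_inv N (f p)) (?r (coord M p x))"
        using U(3)[OF x] chart_inv_coord[OF cM] chart_inv_coord(2)[OF cN] by (intro isCont_chart_inv[OF cN]) auto
      ultimately show ?thesis by (rule isCont_o2)
    qed
    moreover have "\<forall>\<^sub>F y in nhds x. chart_inv N (f p) (?r (coord M p y)) = f y"
      unfolding eventually_nhds using U(1) x eq by blast
    note isCont_cong[OF this]
    ultimately have "isCont f x" by simp
    then show ?thesis using U(3)[OF x] by (subst Ck_at_iff[OF M N, of _ p _ "f p"]) auto
  qed
  then show ?thesis unfolding eventually_nhds using U by blast
qed

lemma Ck_at_euclidI:
  assumes M: "chart_system M" and k: "Ck_near k (\<lambda>y. f (chart_inv M p y)) (coord M p p)"
  shows "Ck_at k M euclidean_charts f p"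
proof -
  have "isCont (\<lambda>x. f (chart_inv M p (coord M p x))) p"
    by (rule continuous_at_compose[unfolded o_def, of p "coord M p", OF isCont_coord[OF M chart_systemD(1)[OF M]]
       Ck_near_imp_isCont[OF k]])
  moreover have "\<forall>\<^sub>F x in nhds p. f (chart_inv M p (coord M p x)) = f x"
    by (rule eventually_mono[OF eventually_nhds_in_open[OF chart_systemD(2,1)[OF M]]]) (simp add: chart_inv_coord[OF M])
  ultimately have "isCont f p" using isCont_cong[of "\<lambda>x. f (chart_inv M p (coord M p x))" f p] by simp
  then show ?thesis using k by (simp add: Ck_at_def)
qed

text \<open>A product rule for a family of linear maps applied to a moving vector. Only the values
  on fixed basis vectors are differentiated, so no topology on the space of operators
  enters.\<close>

lemma has_derivative_linear_apply:
  fixes R :: "'a::real_normed_vector \<Rightarrow> 'b::euclidean_space \<Rightarrow> 'c::real_normed_vector"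
  assumes lin: "\<forall>\<^sub>F x in nhds x0. linear (R x)"
    and R': "\<And>b. b \<in> Basis \<Longrightarrow> ((\<lambda>x. R x b) has_derivative R' b) (at x0)"
    and w: "(w has_derivative w') (at x0)"
  shows "((\<lambda>x. R x (w x)) has_derivative (\<lambda>v. R x0 (w' v) + (\<Sum>b\<in>Basis. (w x0 \<bullet> b) *\<^sub>R R' b v))) (at x0)"
proof -
  have l0: "linear (R x0)" using eventually_nhds_x_imp_x[OF lin] .
  have "((\<lambda>x. \<Sum>b\<in>Basis. (w x \<bullet> b) *\<^sub>R R x b) has_derivative
      (\<lambda>v. \<Sum>b\<in>Basis. (w x0 \<bullet> b) *\<^sub>R R' b v + (w' v \<bullet> b) *\<^sub>R R x0 b)) (at x0)"
    by (intro has_derivative_sum has_derivative_scaleR R' has_derivative_inner_left w)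
  then have "((\<lambda>x. R x (w x)) has_derivative
      (\<lambda>v. \<Sum>b\<in>Basis. (w x0 \<bullet> b) *\<^sub>R R' b v + (w' v \<bullet> b) *\<^sub>R R x0 b)) (at x0)"
    by (rule has_derivative_cong_ev[rotated]) (use lin in \<open>eventually_elim, metis linear_expand\<close>)
  moreover have "(\<Sum>b\<in>Basis. (w' v \<bullet> b) *\<^sub>R R x0 b) = R x0 (w' v)" for v
    using linear_expand[OF l0] by metis
  ultimately show ?thesis by (simp add: sum.distrib add.commute)
qed

lemma has_mderiv_unique: "has_mderiv M N f p F \<Longrightarrow> has_mderiv M N f p F' \<Longrightarrow> F = F'"
  using has_mderiv_tangent_map by metis

abbreviation "\<E> \<equiv> euclidean_charts"

lemma has_mderiv_chart_inv:
  assumes M: "smooth_manifold M" and y: "y \<in> chart_img M q"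
  shows "has_mderiv \<E> M (chart_inv M q) y (from_chart M q (chart_inv M q y))"
proof -
  note c = smooth_manifold_chart_system[OF M]
  have "tangent_map \<E> M (chart_inv M q) y = from_chart M q (chart_inv M q y)"
    unfolding tangent_map_def from_chart_def using coord_chart_inv(1)[OF c y] by (simp add: o_def)
  then show ?thesis using Ck_at_has_mderiv[OF Ck_at_chart_inv[OF M y]] by metis
qed

lemma has_mderiv_coord:
  assumes M: "smooth_manifold M" and p: "p \<in> chart_dom M q"
  shows "has_mderiv M \<E> (coord M q) p (to_chart M q p)"
proof -
  have "tangent_map M \<E> (coord M q) p = to_chart M q p"
    unfolding tangent_map_def to_chart_def by (simp add: o_def)
  then show ?thesis using Ck_at_has_mderiv[OF Ck_at_coord[OF M p]] by metis
qed

lemma to_chart_from_chart: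
  assumes M: "smooth_manifold M" and p: "p \<in> chart_dom M q"
  shows "from_chart M q p (to_chart M q p v) = v" "to_chart M q p (from_chart M q p v) = v"
proof -
  note c = smooth_manifold_chart_system[OF M]
  have y: "coord M q p \<in> chart_img M q" "chart_inv M q (coord M q p) = p" using chart_inv_coord[OF c p] by auto
  have "has_mderiv M M (\<lambda>x. chart_inv M q (coord M q x)) p (\<lambda>v. from_chart M q p (to_chart M q p v))"
    using has_mderiv_compose[OF c chart_system_euclidean has_mderiv_coord[OF M p] has_mderiv_chart_inv[OF M y(1)]] y(2) by simp
  moreover have "has_mderiv M M (\<lambda>x. chart_inv M q (coord M q x)) p (\<lambda>v. v)"
    by (rule has_mderiv_cong[OF c has_mderiv_id[OF c]],
        rule eventually_mono[OF eventually_nhds_in_open[OF chart_systemD(2)[OF c] p]]) (simp add: chart_inv_coord[OF c])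
  ultimately show "from_chart M q p (to_chart M q p v) = v" by (metis has_mderiv_tangent_map)
  have "has_mderiv \<E> \<E> (\<lambda>y. coord M q (chart_inv M q y)) (coord M q p) (\<lambda>v. to_chart M q p (from_chart M q p v))"
    using has_mderiv_compose[OF chart_system_euclidean c has_mderiv_chart_inv[OF M y(1)], of \<E> "coord M q" "to_chart M q p"]
      has_mderiv_coord[OF M p] y(2) by simp
  moreover have "has_mderiv \<E> \<E> (\<lambda>y. coord M q (chart_inv M q y)) (coord M q p) (\<lambda>v. v)"
    by (rule has_mderiv_cong[OF chart_system_euclidean has_mderiv_id[OF chart_system_euclidean]],
        rule eventually_mono[OF eventually_chart_img[OF c p]]) (simp add: coord_chart_inv[OF c])
  ultimately show "to_chart M q p (from_chart M q p v) = v" by (metis has_mderiv_tangent_map)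
qed

lemma has_mderiv_chart_inv_self:
  assumes M: "chart_system M"
  shows "has_mderiv \<E> M (chart_inv M p) (coord M p p) (\<lambda>v. v)"
proof -
  have "((\<lambda>y. coord M p (chart_inv M p y)) has_derivative (\<lambda>v. v)) (at (coord M p p))"
    using has_mderiv_id[OF M, of p] unfolding has_mderiv_def by simp
  then show ?thesis using coord_self[OF M, of p] isCont_chart_inv[OF M coord_self(2)[OF M]] by (simp add: has_mderiv_def)
qed

lemma has_mderiv_coord_self:
  assumes M: "chart_system M"
  shows "has_mderiv M \<E> (coord M p) p (\<lambda>v. v)"
  using has_mderiv_id[OF M, of p] isCont_coord[OF M chart_systemD(1)[OF M]] unfolding has_mderiv_def by simp

section \<open>Left trivialisation, the adjoint action and logarithmic derivatives\<close>

locale lie_grp =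
  fixes G :: "('g::{t2_space, second_countable_topology}, 'a::euclidean_space) lie_group_data"
  assumes lie: "lie_group G"
begin

abbreviation mul (infixl "\<odot>" 70) where "mul \<equiv> gmult G"
abbreviation gid ("\<one>") where "gid \<equiv> gone G"
abbreviation ivs where "ivs \<equiv> ginv G"
abbreviation "\<theta> \<equiv> left_mc G"
abbreviation "Adj \<equiv> Ad G"
abbreviation brk ("\<lbrakk>_,_\<rbrakk>") where "brk \<equiv> lie_bracket G"
abbreviation "lvf \<equiv> left_inv_vf G"

lemma sm: "smooth_manifold G" using lie by (simp add: lie_group_def)
lemmas cs = smooth_manifold_chart_system[OF sm]
lemmas csE = chart_system_euclidean
lemmas smE = smooth_manifold_euclidean
lemmas cD = chart_systemD(1)[OF cs]

sublocale grp: group "gmult G" "gone G" "ginv G" using lie by (simp add: lie_group_def)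

lemma ivs_mul: "ivs (a \<odot> b) = ivs b \<odot> ivs a"
  by (rule grp.inverse_unique) (simp add: grp.assoc[symmetric], simp add: grp.assoc)

lemma mul_cancels [simp]:
  "ivs a \<odot> (a \<odot> b) = b" "a \<odot> (ivs a \<odot> b) = b" "a \<odot> b \<odot> ivs b = a" "a \<odot> ivs b \<odot> b = a"
  by (simp_all add: grp.assoc[symmetric]) (simp_all add: grp.assoc)

lemma Ck_at_mult:
  fixes M :: "('m::t2_space, 'c::euclidean_space, 'z) charts_scheme"
  assumes M: "chart_system M" and "Ck_at k M G f p" "Ck_at k M G g p"
  shows "Ck_at k M G (\<lambda>x. f x \<odot> g x) p"
proof -
  have "Ck_at k (prod_charts G G) G (\<lambda>(g, h). g \<odot> h) q" for q
    using smooth_map_imp_Ck_at[OF chart_system_prod[OF cs cs] cs] lie by (simp add: lie_group_def)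
  from Ck_at_compose[OF M chart_system_prod[OF cs cs] Ck_at_Pair[OF assms(2,3)] this]
  show ?thesis by simp
qed

lemma Ck_at_ivs:
  assumes M: "chart_system M" and "Ck_at k M G f p"
  shows "Ck_at k M G (\<lambda>x. ivs (f x)) p"
  using Ck_at_compose[OF M cs assms(2) smooth_map_imp_Ck_at[OF cs cs]] lie by (simp add: lie_group_def)

lemma Ck_at_lmul: "Ck_at k G G (\<lambda>x. a \<odot> x) p"
  by (intro Ck_at_mult Ck_at_const Ck_at_id cs)

lemma Ck_at_rmul: "Ck_at k G G (\<lambda>x. x \<odot> a) p"
  by (intro Ck_at_mult Ck_at_const Ck_at_id cs)

lemma Ck_at_conj: "Ck_at k G G (\<lambda>x. a \<odot> x \<odot> b) p"
  by (intro Ck_at_mult Ck_at_const Ck_at_id cs)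

lemma has_mderiv_left_mc: "has_mderiv G G (\<lambda>h. ivs g \<odot> h) g (\<theta> g)"
  unfolding left_mc_def by (rule Ck_at_has_mderiv[OF Ck_at_lmul])

lemma has_mderiv_lvf: "has_mderiv G G (\<lambda>h. g \<odot> h) \<one> (\<lambda>\<xi>. lvf \<xi> g)"
  unfolding left_inv_vf_def by (rule Ck_at_has_mderiv[OF Ck_at_lmul])

lemma has_mderiv_rvf: "has_mderiv G G (\<lambda>h. h \<odot> g) \<one> (\<lambda>\<xi>. right_inv_vf G \<xi> g)"
  unfolding right_inv_vf_def by (rule Ck_at_has_mderiv[OF Ck_at_rmul])

lemma has_mderiv_Ad: "has_mderiv G G (\<lambda>h. g \<odot> h \<odot> ivs g) \<one> (Adj g)"
  unfolding Ad_def by (rule Ck_at_has_mderiv[OF Ck_at_conj])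

lemmas comp = has_mderiv_compose[OF cs cs]

lemma left_mc_lvf [simp]: "\<theta> g (lvf \<xi> g) = \<xi>"
proof -
  have "has_mderiv G G (\<lambda>h. ivs g \<odot> (g \<odot> h)) \<one> (\<lambda>\<xi>. \<theta> g (lvf \<xi> g))"
    by (rule comp[OF has_mderiv_lvf]) (simp add: has_mderiv_left_mc)
  then have "(\<lambda>\<xi>. \<theta> g (lvf \<xi> g)) = (\<lambda>\<xi>. \<xi>)"
    using has_mderiv_unique[OF _ has_mderiv_id[OF cs, of \<one>]] by simp
  then show ?thesis by metis
qed

lemma lvf_left_mc [simp]: "lvf (\<theta> g v) g = v"
proof -
  have "has_mderiv G G (\<lambda>h. g \<odot> (ivs g \<odot> h)) g (\<lambda>v. lvf (\<theta> g v) g)"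
    by (rule comp[OF has_mderiv_left_mc]) (simp add: has_mderiv_lvf)
  then have "(\<lambda>v. lvf (\<theta> g v) g) = (\<lambda>v. v)"
    using has_mderiv_unique[OF _ has_mderiv_id[OF cs, of g]] by simp
  then show ?thesis by metis
qed

lemma linear_left_mc: "linear (\<theta> g)" using has_mderiv_left_mc has_mderiv_linear by blast
lemma linear_lvf: "linear (\<lambda>\<xi>. lvf \<xi> g)" using has_mderiv_lvf has_mderiv_linear by blast
lemma linear_Ad: "linear (Adj g)" using has_mderiv_Ad has_mderiv_linear by blast

lemma lvf_one: "lvf \<xi> \<one> = \<xi>"
proof -
  have "(\<lambda>\<xi>. lvf \<xi> \<one>) = (\<lambda>\<xi>. \<xi>)"
    using has_mderiv_unique[OF _ has_mderiv_id[OF cs, of \<one>]] has_mderiv_lvf[of \<one>] by simp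
  then show ?thesis by metis
qed

lemma left_mc_one: "\<theta> \<one> v = v"
  using left_mc_lvf[of \<one> v] by (simp add: lvf_one)

lemma Ad_mul: "Adj (g \<odot> h) \<xi> = Adj g (Adj h \<xi>)"
proof -
  have "has_mderiv G G (\<lambda>x. g \<odot> (h \<odot> x \<odot> ivs h) \<odot> ivs g) \<one> (\<lambda>\<xi>. Adj g (Adj h \<xi>))"
    by (rule comp[OF has_mderiv_Ad]) (simp add: has_mderiv_Ad)
  then have "Adj (g \<odot> h) = (\<lambda>\<xi>. Adj g (Adj h \<xi>))"
    using has_mderiv_unique[OF has_mderiv_Ad[of "g \<odot> h"]] by (simp add: ivs_mul grp.assoc)
  then show ?thesis by simp
qed

lemma Ad_one: "Adj \<one> \<xi> = \<xi>"
proof -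
  have "Adj \<one> = (\<lambda>\<xi>. \<xi>)"
    using has_mderiv_unique[OF _ has_mderiv_id[OF cs, of \<one>]] has_mderiv_Ad[of \<one>] by simp
  then show ?thesis by simp
qed

lemma Ad_ivs [simp]: "Adj (ivs g) (Adj g \<xi>) = \<xi>" "Adj g (Adj (ivs g) \<xi>) = \<xi>"
  using Ad_mul[of "ivs g" g \<xi>] Ad_mul[of g "ivs g" \<xi>] by (simp_all add: Ad_one)

text \<open>Right translation by the inverse of \<open>g\<close> is left translation by that inverse
  followed by conjugation with \<open>g\<close>.\<close>

lemma right_mc_eq: "right_mc G g v = Adj g (\<theta> g v)"
proof -
  have "has_mderiv G G (\<lambda>x. g \<odot> (ivs g \<odot> x) \<odot> ivs g) g (\<lambda>v. Adj g (\<theta> g v))"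
    by (rule comp[OF has_mderiv_left_mc]) (simp add: has_mderiv_Ad)
  then show ?thesis unfolding right_mc_def by (simp add: has_mderiv_tangent_map)
qed

lemma left_mc_right_inv_vf: "\<theta> g (right_inv_vf G \<xi> g) = Adj (ivs g) \<xi>"
proof -
  have "has_mderiv G G (\<lambda>x. ivs g \<odot> (x \<odot> g)) \<one> (\<lambda>\<xi>. \<theta> g (right_inv_vf G \<xi> g))"
    by (rule comp[OF has_mderiv_rvf]) (simp add: has_mderiv_left_mc)
  then have "(\<lambda>\<xi>. \<theta> g (right_inv_vf G \<xi> g)) = Adj (ivs g)"
    using has_mderiv_unique[OF _ has_mderiv_Ad[of "ivs g"]] by (simp add: grp.assoc)
  then show ?thesis by metis
qed

lemma right_inv_vf_eq: "right_inv_vf G \<xi> g = lvf (Adj (ivs g) \<xi>) g"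
  using left_mc_right_inv_vf[of g \<xi>, symmetric] by simp

text \<open>The left logarithmic derivative. The translated map passes through the identity at
  \<open>p\<close>, so its differential takes values in the Lie algebra whatever \<open>f p\<close>
  is.\<close>

definition has_lderiv ::
  "('m::t2_space, 'b::real_normed_vector, 'z) charts_scheme \<Rightarrow> ('m \<Rightarrow> 'g) \<Rightarrow> 'm \<Rightarrow> ('b \<Rightarrow> 'a) \<Rightarrow> bool" where
  "has_lderiv M f p F \<longleftrightarrow> has_mderiv M G (\<lambda>x. ivs (f p) \<odot> f x) p F"

lemma has_lderivI:
  assumes "chart_system M" "has_mderiv M G f p D"
  shows "has_lderiv M f p (\<lambda>v. \<theta> (f p) (D v))"
  unfolding has_lderiv_def by (rule has_mderiv_compose[OF assms(1) cs assms(2) has_mderiv_left_mc])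

lemma has_lderivD:
  assumes "chart_system M" "has_lderiv M f p F"
  shows "has_mderiv M G f p (\<lambda>v. lvf (F v) (f p))"
  using has_mderiv_compose[OF assms(1) cs assms(2)[unfolded has_lderiv_def], of G "\<lambda>x. f p \<odot> x" "\<lambda>\<xi>. lvf \<xi> (f p)"]
    has_mderiv_lvf[of "f p"] by simp

lemma has_lderiv_left_mc:
  assumes "chart_system M" "has_lderiv M f p F"
  shows "\<theta> (f p) (tangent_map M G f p v) = F v"
  using has_mderiv_tangent_map[OF has_lderivD[OF assms]] by simp

text \<open>The differential is linear, and on each factor multiplication by the identity restricts
  to the identity map.\<close>

lemma has_mderiv_mult_one: "has_mderiv (prod_charts G G) G (\<lambda>(g, h). g \<odot> h) (\<one>, \<one>) (\<lambda>(v, w). v + w)"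
proof -
  note cp = chart_system_prod[OF cs cs]
  have "Ck_at (Suc 0) (prod_charts G G) G (\<lambda>(g, h). g \<odot> h) (\<one>, \<one>)"
    using smooth_map_imp_Ck_at[OF cp cs] lie by (simp add: lie_group_def)
  from Ck_at_has_mderiv[OF this] obtain D where
    D: "has_mderiv (prod_charts G G) G (\<lambda>(g, h). g \<odot> h) (\<one>, \<one>) D" by blast
  have a: "has_mderiv G G (\<lambda>x. (\<lambda>(g, h). g \<odot> h) (x, \<one>)) \<one> (\<lambda>v. D (v, 0))"
    by (rule has_mderiv_compose[OF cs cp has_mderiv_Pair[OF has_mderiv_id[OF cs] has_mderiv_const] D])
  have b: "has_mderiv G G (\<lambda>x. (\<lambda>(g, h). g \<odot> h) (\<one>, x)) \<one> (\<lambda>v. D (0, v))"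
    by (rule has_mderiv_compose[OF cs cp has_mderiv_Pair[OF has_mderiv_const has_mderiv_id[OF cs]] D])
  have "(\<lambda>v. D (v, 0)) = (\<lambda>v. v)" "(\<lambda>v. D (0, v)) = (\<lambda>v. v)"
    by (rule has_mderiv_unique[OF _ has_mderiv_id[OF cs, of \<one>]]; use a b in simp)+
  then have 1: "D (v, 0) = v" and 2: "D (0, v) = v" for v by metis+
  have "D (v, w) = v + w" for v w
    using linear_add[OF has_mderiv_linear[OF D], of "(v, 0)" "(0, w)"] 1 2 by simp
  then have "D = (\<lambda>(v, w). v + w)" by auto
  then show ?thesis using D by simp
qed

text \<open>After translation to the identity the product splits into the conjugate, by the inverse
  of \<open>g p\<close>, of the translated \<open>f\<close>, times the translated \<open>g\<close>.
  Both factors pass through the identity, where multiplication differentiates to addition.\<close>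

lemma has_lderiv_mult:
  assumes M: "chart_system M" and f: "has_lderiv M f p F" and g: "has_lderiv M g p H"
  shows "has_lderiv M (\<lambda>x. f x \<odot> g x) p (\<lambda>v. Adj (ivs (g p)) (F v) + H v)"
proof -
  have 1: "has_mderiv M G (\<lambda>x. ivs (g p) \<odot> (ivs (f p) \<odot> f x) \<odot> g p) p (\<lambda>v. Adj (ivs (g p)) (F v))"
    using has_mderiv_compose[OF M cs f[unfolded has_lderiv_def], of G "\<lambda>x. ivs (g p) \<odot> x \<odot> g p" "Adj (ivs (g p))"]
      has_mderiv_Ad[of "ivs (g p)"] by simp
  have "has_mderiv M G (\<lambda>x. (\<lambda>(g, h). g \<odot> h) (ivs (g p) \<odot> (ivs (f p) \<odot> f x) \<odot> g p, ivs (g p) \<odot> g x)) p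
     (\<lambda>v. (\<lambda>(v, w). v + w) (Adj (ivs (g p)) (F v), H v))"
    by (rule has_mderiv_compose[OF M chart_system_prod[OF cs cs] has_mderiv_Pair[OF 1 g[unfolded has_lderiv_def]]])
      (simp add: has_mderiv_mult_one)
  then show ?thesis unfolding has_lderiv_def by (simp add: ivs_mul grp.assoc)
qed

text \<open>Smoothness of inversion provides some derivative \<open>H\<close>; the product rule for
  the constant \<open>f x \<odot> ivs (f x)\<close> then determines it.\<close>

lemma has_lderiv_ivs:
  assumes M: "chart_system M" and f: "has_lderiv M f p F"
  shows "has_lderiv M (\<lambda>x. ivs (f x)) p (\<lambda>v. - Adj (f p) (F v))"
proof -
  have "Ck_at (Suc 0) G G ivs (f p)" using smooth_map_imp_Ck_at[OF cs cs] lie by (simp add: lie_group_def)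
  from has_mderiv_compose[OF M cs has_lderivD[OF M f] Ck_at_has_mderiv[OF this]]
  obtain H where H: "has_lderiv M (\<lambda>x. ivs (f x)) p H" using has_lderivI[OF M] by blast
  have "has_lderiv M (\<lambda>x. f x \<odot> ivs (f x)) p (\<lambda>v. Adj (ivs (ivs (f p))) (F v) + H v)"
    by (rule has_lderiv_mult[OF M f H])
  then have "has_mderiv M G (\<lambda>x. \<one>) p (\<lambda>v. Adj (f p) (F v) + H v)" by (simp add: has_lderiv_def)
  then have "(\<lambda>v. Adj (f p) (F v) + H v) = (\<lambda>v. 0)" by (metis has_mderiv_const has_mderiv_tangent_map)
  then have "H = (\<lambda>v. - Adj (f p) (F v))" by (metis add_eq_0_iff fun_eq_iff neg_eq_iff_add_eq_0)
  then show ?thesis using H by simp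
qed

lemma has_lderiv_const: "has_lderiv M (\<lambda>x. c) p (\<lambda>v. 0)"
  by (simp add: has_lderiv_def has_mderiv_const)

text \<open>\<open>Ad\<close> is the partial derivative, at the identity, of conjugation regarded as
  a function of both arguments; joint smoothness of conjugation therefore gives smoothness in the
  group element.\<close>

lemma Ck_at_Ad_self: "Ck_at k G \<E> (\<lambda>g. Adj g \<zeta>) p"
proof (rule Ck_at_euclidI[OF cs])
  let ?o = "coord G \<one> \<one>"
  let ?F = "\<lambda>y z. coord G \<one> (chart_inv G p y \<odot> chart_inv G \<one> z \<odot> ivs (chart_inv G p y))"
  have "Ck_near k (\<lambda>y. frechet_derivative (?F y) (at ?o) \<zeta>) (coord G p p)"
  proof (rule Ck_near_frechet_along)
    have 1: "Ck_at j \<E> G (\<lambda>q. chart_inv G p (fst q)) (coord G p p, ?o)" for j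
      by (rule Ck_at_compose[OF csE csE, where g="chart_inv G p"])
        (auto intro!: Ck_near_fst Ck_at_chart_inv[OF sm] coord_self(2)[OF cs])
    have 2: "Ck_at j \<E> G (\<lambda>q. chart_inv G \<one> (snd q)) (coord G p p, ?o)" for j
      by (rule Ck_at_compose[OF csE csE, where g="chart_inv G \<one>"])
        (auto intro!: Ck_near_snd Ck_at_chart_inv[OF sm] coord_self(2)[OF cs])
    have "Ck_at (Suc k) \<E> \<E> (\<lambda>q. coord G \<one> (chart_inv G p (fst q) \<odot> chart_inv G \<one> (snd q) \<odot> ivs (chart_inv G p (fst q)))) (coord G p p, ?o)"
      by (rule Ck_at_compose[OF csE cs Ck_at_mult[OF csE Ck_at_mult[OF csE 1 2] Ck_at_ivs[OF csE 1]] Ck_at_coord[OF sm]])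
        (simp add: coord_self[OF cs] cD)
    then show "Ck_near (Suc k) (\<lambda>q. ?F (fst q) (snd q)) (coord G p p, ?o)" by simp
  qed (rule Ck_near_const)+
  then show "Ck_near k (\<lambda>y. Adj (chart_inv G p y) \<zeta>) (coord G p p)"
    by (simp add: Ad_def tangent_map_def o_def)
qed

lemma Ck_at_Ad:
  "chart_system M \<Longrightarrow> Ck_at k M G f p \<Longrightarrow> Ck_at k M \<E> (\<lambda>x. Adj (f x) \<zeta>) p"
  using Ck_at_compose[OF _ cs _ Ck_at_Ad_self] by blast

text \<open>The trivialised differential at \<open>x\<close> is the derivative in \<open>z\<close>
  at \<open>z = x\<close> of the inverse of \<open>f x\<close> times \<open>f z\<close>. The point
  enters both as parameter and as base point, and one order is spent on the differentiation.\<close>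

lemma Ck_near_ltriv:
  fixes f :: "'x::euclidean_space \<Rightarrow> 'g"
  assumes f: "Ck_at (Suc k) \<E> G f x0" and w: "Ck_near k w x0"
  shows "Ck_near k (\<lambda>x. \<theta> (f x) (tangent_map \<E> G f x (w x))) x0"
proof -
  let ?F = "\<lambda>y z. coord G \<one> (ivs (f y) \<odot> f z)"
  have 1: "Ck_at (Suc k) \<E> G (\<lambda>q. f (fst q)) (x0, x0)"
    by (rule Ck_at_compose[OF csE csE, where f=fst]) (auto intro: f Ck_near_fst)
  have 2: "Ck_at (Suc k) \<E> G (\<lambda>q. f (snd q)) (x0, x0)"
    by (rule Ck_at_compose[OF csE csE, where f=snd]) (auto intro: f Ck_near_snd)
  have "Ck_at (Suc k) \<E> \<E> (\<lambda>q. coord G \<one> (ivs (f (fst q)) \<odot> f (snd q))) (x0, x0)"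
    by (rule Ck_at_compose[OF csE cs Ck_at_mult[OF csE Ck_at_ivs[OF csE 1] 2] Ck_at_coord[OF sm]])
      (simp add: cD)
  then have "Ck_near k (\<lambda>x. frechet_derivative (?F x) (at x) (w x)) x0"
    by (intro Ck_near_frechet_along Ck_near_id w) simp
  moreover have "\<forall>\<^sub>F x in nhds x0. frechet_derivative (?F x) (at x) (w x) = \<theta> (f x) (tangent_map \<E> G f x (w x))"
    using Ck_at_eventually[OF smE sm f]
  proof eventually_elim
    case (elim x)
    have "has_mderiv \<E> G (\<lambda>z. ivs (f x) \<odot> f z) x (\<lambda>v. \<theta> (f x) (tangent_map \<E> G f x v))"
      using has_lderivI[OF csE Ck_at_has_mderiv[OF elim]] by (simp add: has_lderiv_def)
    then have "(?F x has_derivative (\<lambda>v. \<theta> (f x) (tangent_map \<E> G f x v))) (at x)"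
      by (simp add: has_mderiv_def)
    then show ?case by (metis frechet_derivative_at)
  qed
  ultimately show ?thesis by (rule Ck_near_cong)
qed

text \<open>No order is lost here: the map that is differentiated is the smooth multiplication, and
  \<open>f\<close> enters only through its value.\<close>

lemma Ck_near_lvf:
  assumes f: "Ck_at k \<E> G f x0" and q: "f x0 \<in> chart_dom G q" and w: "Ck_near k w x0"
  shows "Ck_near k (\<lambda>x. to_chart G q (f x) (lvf (w x) (f x))) (x0::'x::euclidean_space)"
proof -
  let ?o = "coord G \<one> \<one>"
  let ?F = "\<lambda>y z. coord G q (chart_inv G q y \<odot> chart_inv G \<one> z)"
  let ?y = "\<lambda>x. coord G q (f x)"
  have fc: "isCont f x0" using f by (simp add: Ck_at_def)
  have yk: "Ck_near k ?y x0"
    using Ck_at_compose[OF csE cs f Ck_at_coord[OF sm q]] by simp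
  have "Ck_near k (\<lambda>y. frechet_derivative (?F y) (at ?o) b) (coord G q (f x0))" for b
  proof (rule Ck_near_frechet_along)
    have 1: "Ck_at j \<E> G (\<lambda>p. chart_inv G q (fst p)) (coord G q (f x0), ?o)" for j
      by (rule Ck_at_compose[OF csE csE, where g="chart_inv G q"])
        (auto intro!: Ck_near_fst Ck_at_chart_inv[OF sm] chart_inv_coord(2)[OF cs] q)
    have 2: "Ck_at j \<E> G (\<lambda>p. chart_inv G \<one> (snd p)) (coord G q (f x0), ?o)" for j
      by (rule Ck_at_compose[OF csE csE, where g="chart_inv G \<one>"])
        (auto intro!: Ck_near_snd Ck_at_chart_inv[OF sm] coord_self(2)[OF cs])
    have "Ck_at (Suc k) \<E> \<E> (\<lambda>p. coord G q (chart_inv G q (fst p) \<odot> chart_inv G \<one> (snd p))) (coord G q (f x0), ?o)"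
      by (rule Ck_at_compose[OF csE cs Ck_at_mult[OF csE 1 2] Ck_at_coord[OF sm]])
        (simp add: coord_self[OF cs] chart_inv_coord[OF cs] q)
    then show "Ck_near (Suc k) (\<lambda>p. ?F (fst p) (snd p)) (coord G q (f x0), ?o)" by simp
  qed (rule Ck_near_const)+
  then have "Ck_near k (\<lambda>x. \<Sum>b\<in>Basis. (w x \<bullet> b) *\<^sub>R frechet_derivative (?F (?y x)) (at ?o) b) x0"
    by (intro Ck_near_sum Ck_near_scaleR Ck_near_inner_const w
        Ck_near_compose[OF _ yk, where g="\<lambda>y. frechet_derivative (?F y) (at ?o) b" for b])
  then show ?thesis
  proof (rule Ck_near_cong, use eventually_in_chart[OF cs fc q] in eventually_elim)
    fix x assume x: "f x \<in> chart_dom G q"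
    have "has_mderiv \<E> \<E> (?F (?y x)) ?o (\<lambda>\<xi>. to_chart G q (f x) (lvf \<xi> (f x)))"
    proof (rule has_mderiv_compose[OF csE cs, where g="coord G q" and G="to_chart G q (f x)"
            and f="\<lambda>z. chart_inv G q (?y x) \<odot> chart_inv G \<one> z" and F="\<lambda>\<xi>. lvf \<xi> (f x)"])
      show "has_mderiv \<E> G (\<lambda>z. chart_inv G q (?y x) \<odot> chart_inv G \<one> z) ?o (\<lambda>\<xi>. lvf \<xi> (f x))"
        using has_mderiv_compose[OF csE cs has_mderiv_chart_inv_self[OF cs, of \<one>], where K=G and g="\<lambda>h. f x \<odot> h" and G="\<lambda>\<xi>. lvf \<xi> (f x)"]
          has_mderiv_lvf[of "f x"] chart_inv_coord[OF cs x] coord_self[OF cs] by simp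
      show "has_mderiv G \<E> (coord G q) (chart_inv G q (?y x) \<odot> chart_inv G \<one> ?o) (to_chart G q (f x))"
        using has_mderiv_coord[OF sm x] chart_inv_coord[OF cs x] coord_self[OF cs] by simp
    qed
    then have d: "(?F (?y x) has_derivative (\<lambda>\<xi>. to_chart G q (f x) (lvf \<xi> (f x)))) (at ?o)" by simp
    then have "frechet_derivative (?F (?y x)) (at ?o) = (\<lambda>\<xi>. to_chart G q (f x) (lvf \<xi> (f x)))"
      by (metis frechet_derivative_at)
    moreover have "linear (\<lambda>\<xi>. to_chart G q (f x) (lvf \<xi> (f x)))" using d has_derivative_linear by blast
    ultimately show "(\<Sum>b\<in>Basis. (w x \<bullet> b) *\<^sub>R frechet_derivative (?F (?y x)) (at ?o) b) = to_chart G q (f x) (lvf (w x) (f x))"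
      using linear_expand[of "\<lambda>\<xi>. to_chart G q (f x) (lvf \<xi> (f x))" "w x"] by simp
  qed
qed

text \<open>The gain of one order that drives every bootstrapping below: in a chart the derivative
  of \<open>f\<close> is the left-invariant field of \<open>\<tau>\<close> along \<open>f\<close>,
  which has order \<open>k\<close> as soon as \<open>f\<close> and \<open>\<tau>\<close> do.\<close>

lemma Ck_at_Suc_of_ltriv:
  fixes f :: "'x::euclidean_space \<Rightarrow> 'g"
  assumes d: "\<forall>\<^sub>F x in nhds x0. has_lderiv \<E> f x (\<lambda>v. \<tau> x v)"
    and f: "Ck_at k \<E> G f x0" and \<tau>: "\<And>v. Ck_near k (\<lambda>x. \<tau> x v) x0"
  shows "Ck_at (Suc k) \<E> G f x0"
proof -
  let ?q = "f x0"
  have fc: "isCont f x0" using f by (simp add: Ck_at_def)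
  have "\<forall>\<^sub>F x in nhds x0. ((\<lambda>x. coord G ?q (f x)) has_derivative (\<lambda>v. to_chart G ?q (f x) (lvf (\<tau> x v) (f x)))) (at x)"
    using d eventually_in_chart[OF cs fc cD]
  proof eventually_elim
    case (elim x)
    show ?case
      using has_mderiv_compose[OF csE cs has_lderivD[OF csE elim(1)] has_mderiv_coord[OF sm elim(2)]] by simp
  qed
  then have "Ck_near (Suc k) (\<lambda>x. coord G ?q (f x)) x0"
    by (rule Ck_near_SucI) (intro Ck_near_lvf f cD \<tau>)
  then show ?thesis using fc by (simp add: Ck_at_def)
qed

end

lemma has_mderiv_bilinear:
  assumes M: "chart_system M" and h: "bounded_bilinear h"
    and f: "has_mderiv M \<E> f p F" and g: "has_mderiv M \<E> g p H"
  shows "has_mderiv M \<E> (\<lambda>x. h (f x) (g x)) p (\<lambda>v. h (f p) (H v) + h (F v) (g p))"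
proof -
  have "((\<lambda>y. h (f (chart_inv M p y)) (g (chart_inv M p y))) has_derivative
      (\<lambda>v. h (f (chart_inv M p (coord M p p))) (H v) + h (F v) (g (chart_inv M p (coord M p p))))) (at (coord M p p))"
    using f g by (intro bounded_bilinear.FDERIV[OF h]) (auto simp: has_mderiv_def)
  moreover have "isCont (\<lambda>x. h (f x) (g x)) p"
    using f g bounded_bilinear.continuous[OF h] by (auto simp: has_mderiv_def)
  ultimately show ?thesis by (simp add: has_mderiv_def coord_self[OF M])
qed

lemma has_mderiv_bounded_linear:
  fixes L :: "'a::euclidean_space \<Rightarrow> 'b::euclidean_space"
  assumes M: "chart_system M" and L: "linear L" and f: "has_mderiv M \<E> f p F"
  shows "has_mderiv M \<E> (\<lambda>x. L (f x)) p (\<lambda>v. L (F v))"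
  using has_mderiv_compose[OF M chart_system_euclidean f, of \<E> L L] L
  by (simp add: linear_conv_bounded_linear bounded_linear_imp_has_derivative)

section \<open>The bracket as the derivative of \<open>Ad\<close>, and the Maurer-Cartan
  equation\<close>

context lie_grp begin

lemma lie_bracket_eq:
  "\<lbrakk>\<xi>, \<zeta>\<rbrakk> = frechet_derivative (vf_rep G (lvf \<zeta>) \<one>) (at (coord G \<one> \<one>)) \<xi> -
            frechet_derivative (vf_rep G (lvf \<xi>) \<one>) (at (coord G \<one> \<one>)) \<zeta>"
  unfolding lie_bracket_def lie_bracket_vf_def by (simp add: lvf_one)

lemma lie_bracket_antisym: "\<lbrakk>\<xi>, \<zeta>\<rbrakk> = - \<lbrakk>\<zeta>, \<xi>\<rbrakk>"
  unfolding lie_bracket_eq by simp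

text \<open>Let \<open>Ms\<close> be the multiplication in the chart at the identity. Its derivative
  in the second slot at \<open>(x, o1)\<close> is the left-invariant field, and by \<open>R\<close>
  it equals the derivative in the first slot at \<open>(o1, x)\<close> applied to \<open>Ad\<close>.
  Differentiating this equality at the identity gives the derivative of \<open>Ad\<close> as a
  difference of mixed second derivatives of \<open>Ms\<close>, and that difference is the commutator
  of the left-invariant fields.\<close>

lemma has_mderiv_Ad_one: "has_mderiv G \<E> (\<lambda>g. Adj g \<zeta>) \<one> (\<lambda>\<xi>. \<lbrakk>\<xi>, \<zeta>\<rbrakk>)"
proof -
  define o1 where "o1 = coord G \<one> \<one>"
  define c where "c = chart_inv G \<one>"
  define Ms where "Ms p = coord G \<one> (c (fst p) \<odot> c (snd p))" for p
  have co: "c o1 = \<one>" and oi: "o1 \<in> chart_img G \<one>"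
    unfolding c_def o1_def by (auto simp: coord_self[OF cs])
  have c1: "Ck_at k \<E> G (\<lambda>p. c (fst p)) (o1, o1)" for k
    unfolding c_def by (rule Ck_at_compose[OF csE csE, where g="chart_inv G \<one>"])
      (auto intro!: Ck_near_fst Ck_at_chart_inv[OF sm] oi)
  have c2: "Ck_at k \<E> G (\<lambda>p. c (snd p)) (o1, o1)" for k
    unfolding c_def by (rule Ck_at_compose[OF csE csE, where g="chart_inv G \<one>"])
      (auto intro!: Ck_near_snd Ck_at_chart_inv[OF sm] oi)
  have "Ck_at k \<E> \<E> Ms (o1, o1)" for k
    unfolding Ms_def by (rule Ck_at_compose[OF csE cs Ck_at_mult[OF csE c1 c2] Ck_at_coord[OF sm]])
      (simp add: co cD)
  then have Mk: "Ck_near k Ms (o1, o1)" for k by simp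
  define DD where "DD u v = frechet_derivative (\<lambda>q. frechet_derivative Ms (at q) u) (at (o1, o1)) v" for u v
  have dDD: "((\<lambda>q. frechet_derivative Ms (at q) u) has_derivative DD u) (at (o1, o1))" for u
    unfolding DD_def by (rule Ck_near_has_derivative[OF Ck_near_frechet[OF Mk]])
  have sym: "DD u v = DD v u" for u v unfolding DD_def by (rule second_derivative_symmetric[OF Mk])
  have "\<forall>\<^sub>F x in nhds o1. Ck_near 1 Ms (x, o1)"
    by (rule isCont_eventually_nhds[where f="\<lambda>x. (x, o1)"]) (auto intro!: continuous_intros Ck_near_eventually Mk)
  moreover have "\<forall>\<^sub>F x in nhds o1. Ck_near 1 Ms (o1, x)"
    by (rule isCont_eventually_nhds[where f="\<lambda>x. (o1, x)"]) (auto intro!: continuous_intros Ck_near_eventually Mk)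
  ultimately have ev: "\<forall>\<^sub>F x in nhds o1. x \<in> chart_img G \<one> \<and> Ck_near (Suc 0) Ms (x, o1) \<and> Ck_near (Suc 0) Ms (o1, x)"
    using eventually_chart_img[OF cs cD, of \<one>] unfolding o1_def by eventually_elim auto
  have part1: "((\<lambda>z. Ms (z, x)) has_derivative (\<lambda>v. frechet_derivative Ms (at (o1, x)) (v, 0))) (at o1)"
    if "Ck_near (Suc 0) Ms (o1, x)" for x
    by (rule has_derivative_compose[where f="\<lambda>z. (z, x)"])
      (auto intro!: derivative_eq_intros Ck_near_has_derivative that)
  have part2: "((\<lambda>z. Ms (x, z)) has_derivative (\<lambda>v. frechet_derivative Ms (at (x, o1)) (0, v))) (at o1)"
    if "Ck_near (Suc 0) Ms (x, o1)" for x
    by (rule has_derivative_compose[where f="\<lambda>z. (x, z)"])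
      (auto intro!: derivative_eq_intros Ck_near_has_derivative that)
  have cid: "has_mderiv \<E> G c o1 (\<lambda>v. v)" unfolding c_def o1_def by (rule has_mderiv_chart_inv_self[OF cs])
  have L: "vf_rep G (lvf \<zeta>) \<one> x = frechet_derivative Ms (at (x, o1)) (0, \<zeta>)"
    if x: "x \<in> chart_img G \<one>" "Ck_near (Suc 0) Ms (x, o1)" for x \<zeta>
  proof -
    have 1: "has_mderiv \<E> G (\<lambda>z. c x \<odot> c z) o1 (\<lambda>\<xi>. lvf \<xi> (c x))"
      by (rule has_mderiv_compose[OF csE cs cid, where g="\<lambda>h. c x \<odot> h"]) (simp add: co has_mderiv_lvf)
    have "has_mderiv \<E> \<E> (\<lambda>z. Ms (x, z)) o1 (\<lambda>\<xi>. to_chart G \<one> (c x) (lvf \<xi> (c x)))"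
      unfolding Ms_def fst_conv snd_conv
      by (rule has_mderiv_compose[OF csE cs 1])
       (use has_mderiv_coord[OF sm coord_chart_inv(2)[OF cs x(1)]] in \<open>simp add: co[unfolded c_def] c_def\<close>)
    then have "(\<lambda>v. frechet_derivative Ms (at (x, o1)) (0, v)) = (\<lambda>\<xi>. to_chart G \<one> (c x) (lvf \<xi> (c x)))"
      using part2[OF x(2)] has_derivative_unique by auto
    then have "frechet_derivative Ms (at (x, o1)) (0, \<zeta>) = to_chart G \<one> (c x) (lvf \<zeta> (c x))" by (rule fun_cong)
    then show ?thesis by (simp add: vf_rep_def Let_def c_def)
  qed
  \<comment> \<open>Both sides are the derivative in \<open>z\<close> of
    \<open>c x \<odot> c z\<close>: on the left this product is read as the conjugate of
    \<open>c z\<close> by \<open>c x\<close>, followed by \<open>c x\<close>.\<close>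
  have R: "frechet_derivative Ms (at (o1, x)) (Adj (c x) \<zeta>, 0) = frechet_derivative Ms (at (x, o1)) (0, \<zeta>)"
    if x: "x \<in> chart_img G \<one>" "Ck_near (Suc 0) Ms (x, o1)" "Ck_near (Suc 0) Ms (o1, x)" for x
  proof -
    have "c x \<in> chart_dom G \<one>" unfolding c_def using coord_chart_inv(2)[OF cs x(1)] .
    then have "Ck_at (Suc 0) G \<E> (\<lambda>h. coord G \<one> (h \<odot> c x)) \<one>"
      by (intro Ck_at_compose[OF cs cs Ck_at_rmul Ck_at_coord[OF sm]]) simp
    from Ck_at_has_mderiv[OF this] obtain D where D: "has_mderiv G \<E> (\<lambda>h. coord G \<one> (h \<odot> c x)) \<one> D" by blast
    have "has_mderiv \<E> \<E> (\<lambda>z. coord G \<one> (c z \<odot> c x)) o1 D"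
      by (rule has_mderiv_compose[OF csE cs cid, where g="\<lambda>h. coord G \<one> (h \<odot> c x)"]) (simp add: co D)
    then have De: "D = (\<lambda>v. frechet_derivative Ms (at (o1, x)) (v, 0))"
      using part1[OF x(3)] has_derivative_unique by (auto simp: Ms_def)
    have 1: "has_mderiv \<E> G (\<lambda>z. c x \<odot> c z \<odot> ivs (c x)) o1 (Adj (c x))"
      by (rule has_mderiv_compose[OF csE cs cid, where g="\<lambda>h. c x \<odot> h \<odot> ivs (c x)"]) (simp add: co has_mderiv_Ad)
    have "has_mderiv \<E> \<E> (\<lambda>z. coord G \<one> (c x \<odot> c z \<odot> ivs (c x) \<odot> c x)) o1 (\<lambda>v. D (Adj (c x) v))"
      by (rule has_mderiv_compose[OF csE cs 1]) (simp add: co D)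
    then have "((\<lambda>z. Ms (x, z)) has_derivative (\<lambda>v. D (Adj (c x) v))) (at o1)" by (simp add: Ms_def)
    then have "(\<lambda>v. D (Adj (c x) v)) = (\<lambda>v. frechet_derivative Ms (at (x, o1)) (0, v))"
      using part2[OF x(2)] has_derivative_unique by blast
    then show ?thesis unfolding De by (rule fun_cong)
  qed
  have dL: "((\<lambda>x. frechet_derivative Ms (at (x, o1)) (0, \<zeta>)) has_derivative (\<lambda>v. DD (0, \<zeta>) (v, 0))) (at o1)" for \<zeta>
    by (rule has_derivative_compose[where f="\<lambda>x. (x, o1)"]) (auto intro!: derivative_eq_intros dDD)
  have dR: "((\<lambda>x. frechet_derivative Ms (at (o1, x)) (b, 0)) has_derivative (\<lambda>v. DD (b, 0) (0, v))) (at o1)" for b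
    by (rule has_derivative_compose[where f="\<lambda>x. (o1, x)"]) (auto intro!: derivative_eq_intros dDD)
  have "(vf_rep G (lvf \<zeta>) \<one> has_derivative (\<lambda>v. DD (0, \<zeta>) (v, 0))) (at o1)" for \<zeta>
    by (rule has_derivative_cong_ev[OF _ dL]) (use ev in \<open>eventually_elim, simp add: L\<close>)
  then have fv: "frechet_derivative (vf_rep G (lvf \<zeta>) \<one>) (at o1) = (\<lambda>v. DD (0, \<zeta>) (v, 0))" for \<zeta>
    by (metis frechet_derivative_at)
  then have br: "\<lbrakk>\<xi>, \<zeta>\<rbrakk> = DD (0, \<zeta>) (\<xi>, 0) - DD (0, \<xi>) (\<zeta>, 0)" for \<xi> \<zeta>
    unfolding lie_bracket_eq o1_def[symmetric] by simp
  define A where "A x = Adj (c x) \<zeta>" for x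
  have "has_mderiv G \<E> (\<lambda>g. Adj g \<zeta>) \<one> (tangent_map G \<E> (\<lambda>g. Adj g \<zeta>) \<one>)"
    by (rule Ck_at_has_mderiv[OF Ck_at_Ad_self])
  then obtain A' where A0: "has_mderiv G \<E> (\<lambda>g. Adj g \<zeta>) \<one> A'" by blast
  then have A': "(A has_derivative A') (at o1)" unfolding has_mderiv_def A_def c_def o1_def by simp
  have lin: "\<forall>\<^sub>F x in nhds o1. linear (\<lambda>w. frechet_derivative Ms (at (o1, x)) (w, 0))"
    using ev by eventually_elim (use part1 has_derivative_linear in blast)
  have "((\<lambda>x. frechet_derivative Ms (at (o1, x)) (A x, 0)) has_derivative
      (\<lambda>v. frechet_derivative Ms (at (o1, o1)) (A' v, 0) + (\<Sum>b\<in>Basis. (A o1 \<bullet> b) *\<^sub>R DD (b, 0) (0, v)))) (at o1)"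
    by (rule has_derivative_linear_apply[OF lin dR A'])
  moreover have "((\<lambda>x. frechet_derivative Ms (at (o1, x)) (A x, 0)) has_derivative (\<lambda>v. DD (0, \<zeta>) (v, 0))) (at o1)"
    by (rule has_derivative_cong_ev[OF _ dL[of \<zeta>]]) (use ev in \<open>eventually_elim, simp add: R A_def\<close>)
  ultimately have eq: "(\<lambda>v. frechet_derivative Ms (at (o1, o1)) (A' v, 0) + (\<Sum>b\<in>Basis. (A o1 \<bullet> b) *\<^sub>R DD (b, 0) (0, v)))
     = (\<lambda>v. DD (0, \<zeta>) (v, 0))" by (rule has_derivative_unique)
  have "((\<lambda>z. Ms (z, o1)) has_derivative (\<lambda>v. v)) (at o1)"
    using has_mderiv_compose[OF csE cs cid[unfolded o1_def], of \<E> "coord G \<one>" "\<lambda>v. v"] has_mderiv_coord_self[OF cs, of \<one>] co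
    by (simp add: Ms_def o1_def)
  then have "(\<lambda>v. frechet_derivative Ms (at (o1, o1)) (v, 0)) = (\<lambda>v. v)"
    using part1[OF Mk] has_derivative_unique by blast
  then have id: "frechet_derivative Ms (at (o1, o1)) (w, 0) = w" for w by metis
  have Ao: "A o1 = \<zeta>" by (simp add: A_def co Ad_one)
  \<comment> \<open>Linearity of \<open>DD\<close> is at hand in the second argument. Symmetry moves
    the basis vector there, and the sum collapses.\<close>
  have "(\<Sum>b\<in>Basis. (\<zeta> \<bullet> b) *\<^sub>R DD (b, 0) (0, v)) = DD (0, v) (\<zeta>, 0)" for v
  proof -
    have "linear (DD (0, v))" using dDD has_derivative_linear by blast
    then have "linear (\<lambda>w. DD (0, v) (w, 0))"
      using linear_compose[of "\<lambda>w. (w, 0)" "DD (0, v)"] by (simp add: o_def linearI)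
    from linear_expand[OF this, of \<zeta>] show ?thesis by (simp add: sym[of "(_, 0)"])
  qed
  then have "A' v = \<lbrakk>v, \<zeta>\<rbrakk>" for v using fun_cong[OF eq, of v] by (simp add: id Ao br algebra_simps)
  then have "A' = (\<lambda>v. \<lbrakk>v, \<zeta>\<rbrakk>)" by auto
  then show ?thesis using A0 by simp
qed

lemma linear_lie_bracket_left: "linear (\<lambda>\<xi>. \<lbrakk>\<xi>, \<zeta>\<rbrakk>)"
  using has_mderiv_Ad_one has_mderiv_linear by blast

lemma linear_lie_bracket_right: "linear (\<lambda>\<zeta>. \<lbrakk>\<xi>, \<zeta>\<rbrakk>)"
  unfolding lie_bracket_antisym[of \<xi>] by (rule linear_compose_neg[OF linear_lie_bracket_left])

lemma bounded_bilinear_lie_bracket: "bounded_bilinear (lie_bracket G)"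
  unfolding bilinear_conv_bounded_bilinear[symmetric] bilinear_def
  using linear_lie_bracket_left linear_lie_bracket_right by blast

lemmas brk_simps = bounded_bilinear.add_left[OF bounded_bilinear_lie_bracket]
  bounded_bilinear.add_right[OF bounded_bilinear_lie_bracket]
  bounded_bilinear.diff_left[OF bounded_bilinear_lie_bracket]
  bounded_bilinear.diff_right[OF bounded_bilinear_lie_bracket]
  bounded_bilinear.minus_left[OF bounded_bilinear_lie_bracket]
  bounded_bilinear.minus_right[OF bounded_bilinear_lie_bracket]
  bounded_bilinear.scaleR_left[OF bounded_bilinear_lie_bracket]
  bounded_bilinear.scaleR_right[OF bounded_bilinear_lie_bracket]
  bounded_bilinear.zero_left[OF bounded_bilinear_lie_bracket]
  bounded_bilinear.zero_right[OF bounded_bilinear_lie_bracket]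

lemma lie_bracket_self [simp]: "\<lbrakk>\<xi>, \<xi>\<rbrakk> = 0"
proof -
  have "\<lbrakk>\<xi>, \<xi>\<rbrakk> + \<lbrakk>\<xi>, \<xi>\<rbrakk> = 0" by (subst (2) lie_bracket_antisym) simp
  then show ?thesis by (simp add: scaleR_2[symmetric])
qed

lemma has_mderiv_Ad_of:
  assumes M: "chart_system M" and f: "has_lderiv M f p F"
  shows "has_mderiv M \<E> (\<lambda>x. Adj (f x) \<zeta>) p (\<lambda>v. Adj (f p) \<lbrakk>F v, \<zeta>\<rbrakk>)"
proof -
  have "has_mderiv M \<E> (\<lambda>x. Adj (ivs (f p) \<odot> f x) \<zeta>) p (\<lambda>v. \<lbrakk>F v, \<zeta>\<rbrakk>)"
    by (rule has_mderiv_compose[OF M cs f[unfolded has_lderiv_def], where g="\<lambda>g. Adj g \<zeta>"]) (simp add: has_mderiv_Ad_one)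
  from has_mderiv_bounded_linear[OF M linear_Ad this, of "f p"] show ?thesis by (simp add: Ad_mul)
qed

text \<open>Derivative at \<open>x = \<one>\<close> of the equation
  \<open>Ad (g x g^-1) Ad g = Ad g Ad x\<close>.\<close>

lemma Ad_lie_bracket: "Adj g \<lbrakk>\<xi>, \<zeta>\<rbrakk> = \<lbrakk>Adj g \<xi>, Adj g \<zeta>\<rbrakk>"
proof -
  have "has_mderiv G \<E> (\<lambda>x. Adj (g \<odot> x \<odot> ivs g) (Adj g \<zeta>)) \<one> (\<lambda>\<xi>. \<lbrakk>Adj g \<xi>, Adj g \<zeta>\<rbrakk>)"
    by (rule has_mderiv_compose[OF cs cs has_mderiv_Ad, where g="\<lambda>x. Adj x (Adj g \<zeta>)"]) (simp add: has_mderiv_Ad_one)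
  moreover have "has_mderiv G \<E> (\<lambda>x. Adj g (Adj x \<zeta>)) \<one> (\<lambda>\<xi>. Adj g \<lbrakk>\<xi>, \<zeta>\<rbrakk>)"
    by (rule has_mderiv_bounded_linear[OF cs linear_Ad has_mderiv_Ad_one])
  ultimately have "(\<lambda>\<xi>. \<lbrakk>Adj g \<xi>, Adj g \<zeta>\<rbrakk>) = (\<lambda>\<xi>. Adj g \<lbrakk>\<xi>, \<zeta>\<rbrakk>)"
    by (intro has_mderiv_unique[of G \<E>]) (auto simp: Ad_mul)
  then show ?thesis by metis
qed

lemma has_mderiv_Ad_ivs_of:
  assumes M: "chart_system M" and f: "has_lderiv M f p F"
  shows "has_mderiv M \<E> (\<lambda>x. Adj (ivs (f x)) \<zeta>) p (\<lambda>v. - \<lbrakk>F v, Adj (ivs (f p)) \<zeta>\<rbrakk>)"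
  using has_mderiv_Ad_of[OF M has_lderiv_ivs[OF M f]] linear_neg[OF linear_Ad]
  by (simp add: Ad_lie_bracket brk_simps)

text \<open>Derivative at the identity of the compatibility of \<open>Ad\<close> with the
  bracket.\<close>

lemma jacobi: "\<lbrakk>\<xi>, \<lbrakk>\<zeta>, \<omega>\<rbrakk>\<rbrakk> = \<lbrakk>\<lbrakk>\<xi>, \<zeta>\<rbrakk>, \<omega>\<rbrakk> + \<lbrakk>\<zeta>, \<lbrakk>\<xi>, \<omega>\<rbrakk>\<rbrakk>"
proof -
  have "has_mderiv G \<E> (\<lambda>x. \<lbrakk>Adj x \<zeta>, Adj x \<omega>\<rbrakk>) \<one> (\<lambda>\<xi>. \<lbrakk>Adj \<one> \<zeta>, \<lbrakk>\<xi>, \<omega>\<rbrakk>\<rbrakk> + \<lbrakk>\<lbrakk>\<xi>, \<zeta>\<rbrakk>, Adj \<one> \<omega>\<rbrakk>)"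
    by (rule has_mderiv_bilinear[OF cs bounded_bilinear_lie_bracket has_mderiv_Ad_one has_mderiv_Ad_one])
  then have "has_mderiv G \<E> (\<lambda>x. Adj x \<lbrakk>\<zeta>, \<omega>\<rbrakk>) \<one> (\<lambda>\<xi>. \<lbrakk>\<zeta>, \<lbrakk>\<xi>, \<omega>\<rbrakk>\<rbrakk> + \<lbrakk>\<lbrakk>\<xi>, \<zeta>\<rbrakk>, \<omega>\<rbrakk>)"
    by (simp add: Ad_lie_bracket Ad_one)
  from has_mderiv_unique[OF has_mderiv_Ad_one this] show ?thesis by (metis add.commute)
qed

text \<open>The bracket is defined at the identity, so \<open>f\<close> is written near
  \<open>x0\<close> as a constant times \<open>c\<close> after its local expression
  \<open>k\<close>; the constant disappears from \<open>\<tau>\<close>. Then \<open>\<tau> w\<close>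
  is \<open>\<phi> (k x)\<close> applied to the derivative of \<open>k\<close>. The second
  derivatives of \<open>k\<close> cancel by symmetry, and the derivative of \<open>\<phi>\<close> is
  minus that of the left-invariant field, because \<open>\<phi>\<close> inverts that field.\<close>

lemma maurer_cartan:
  fixes f :: "'x::euclidean_space \<Rightarrow> 'g"
  assumes f: "Ck_at (Suc (Suc 0)) \<E> G f x0"
  defines "\<tau> \<equiv> \<lambda>w x. \<theta> (f x) (tangent_map \<E> G f x w)"
  shows "frechet_derivative (\<tau> w) (at x0) v - frechet_derivative (\<tau> v) (at x0) w = - \<lbrakk>\<tau> v x0, \<tau> w x0\<rbrakk>"
proof -
  define o1 where "o1 = coord G \<one> \<one>"
  define c where "c = chart_inv G \<one>"
  define k where "k x = coord G \<one> (ivs (f x0) \<odot> f x)" for x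
  define \<phi> where "\<phi> z w = \<theta> (c z) (tangent_map \<E> G c z w)" for z w
  let ?Dk = "\<lambda>x. frechet_derivative k (at x)"
  have co: "c o1 = \<one>" and oi: "o1 \<in> chart_img G \<one>"
    unfolding c_def o1_def by (auto simp: coord_self[OF cs])
  have Ck_c: "Ck_at j \<E> G c z" if "z \<in> chart_img G \<one>" for j z
    unfolding c_def by (rule Ck_at_chart_inv[OF sm that])
  have \<phi>k: "Ck_near j (\<lambda>z. \<phi> z w) o1" for j w
    unfolding \<phi>_def by (rule Ck_near_ltriv[OF Ck_c[OF oi] Ck_near_const])
  have lf: "Ck_at (Suc (Suc 0)) \<E> G (\<lambda>x. ivs (f x0) \<odot> f x) x0"
    by (intro Ck_at_mult csE Ck_at_const f)
  have "Ck_at (Suc (Suc 0)) \<E> \<E> k x0"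
    unfolding k_def by (rule Ck_at_compose[OF csE cs lf Ck_at_coord[OF sm]]) (simp add: cD)
  then have kk: "Ck_near (Suc (Suc 0)) k x0" by simp
  have k0: "k x0 = o1" by (simp add: k_def o1_def)
  have lin\<phi>: "linear (\<phi> z)" if "z \<in> chart_img G \<one>" for z
    using linear_compose[OF has_mderiv_linear[OF Ck_at_has_mderiv[OF Ck_c[OF that, of "Suc 0"]]] linear_left_mc[of "c z"]]
    unfolding \<phi>_def by (simp add: o_def)
  have evimg: "\<forall>\<^sub>F x in nhds x0. k x \<in> chart_img G \<one>"
    by (rule isCont_eventually_nhds[OF Ck_near_imp_isCont[OF kk]])
      (simp add: k0 eventually_nhds_in_open[OF chart_systemD(3)[OF cs] oi])
  have evdom: "\<forall>\<^sub>F x in nhds x0. ivs (f x0) \<odot> f x \<in> chart_dom G \<one>"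
    by (rule eventually_in_chart[OF cs]) (use lf in \<open>auto simp: Ck_at_def cD\<close>)
  then have "\<forall>\<^sub>F x in nhds x0. f x = f x0 \<odot> c (k x)"
    by eventually_elim (simp add: k_def c_def chart_inv_coord[OF cs])
  \<comment> \<open>The derivative of \<open>f\<close> is wanted at every \<open>x\<close> near
    \<open>x0\<close>, which requires the factorisation on a neighbourhood of each such
    \<open>x\<close>.\<close>
  then have "\<forall>\<^sub>F x in nhds x0. \<forall>\<^sub>F y in nhds x. f y = f x0 \<odot> c (k y)" by (simp add: eventually_eventually)
  then have ev: "\<forall>\<^sub>F x in nhds x0. \<forall>w. \<tau> w x = \<phi> (k x) (?Dk x w)"
    using evimg Ck_near_eventually[OF kk] Ck_at_eventually[OF smE sm f]
  proof eventually_elim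
    case (elim x)
    have dk: "has_mderiv \<E> \<E> k x (?Dk x)" using Ck_near_has_derivative[OF elim(3)] by simp
    have "has_mderiv \<E> G (\<lambda>y. c (k y)) x (\<lambda>w. tangent_map \<E> G c (k x) (?Dk x w))"
      by (rule has_mderiv_compose[OF csE csE dk Ck_at_has_mderiv[OF Ck_c[OF elim(2)]]])
    from has_lderiv_mult[OF csE has_lderiv_const has_lderivI[OF csE this], of "f x0"]
    have "has_lderiv \<E> (\<lambda>y. f x0 \<odot> c (k y)) x (\<lambda>w. \<phi> (k x) (?Dk x w))"
      using linear_0[OF linear_Ad] by (simp add: \<phi>_def)
    from has_lderivD[OF csE this] have "has_mderiv \<E> G (\<lambda>y. f x0 \<odot> c (k y)) x (\<lambda>w. lvf (\<phi> (k x) (?Dk x w)) (f x))"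
      by (simp add: eventually_nhds_x_imp_x[OF elim(1), symmetric])
    moreover have "\<forall>\<^sub>F y in nhds x. f x0 \<odot> c (k y) = f y" using elim(1) by (rule eventually_mono) simp
    ultimately have "has_mderiv \<E> G f x (\<lambda>w. lvf (\<phi> (k x) (?Dk x w)) (f x))"
      by (rule has_mderiv_cong[OF csE])
    then show ?case unfolding \<tau>_def using has_mderiv_tangent_map by fastforce
  qed
  define P where "P b = frechet_derivative (\<lambda>z. \<phi> z b) (at o1)" for b
  have dP: "((\<lambda>z. \<phi> z b) has_derivative P b) (at o1)" for b
    unfolding P_def by (rule Ck_near_has_derivative[OF \<phi>k])
  have dk: "(k has_derivative ?Dk x0) (at x0)" by (rule Ck_near_has_derivative[OF kk])
  define K2 where "K2 w v = frechet_derivative (\<lambda>x. ?Dk x w) (at x0) v" for w v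
  have dK2: "((\<lambda>x. ?Dk x w) has_derivative K2 w) (at x0)" for w
    unfolding K2_def by (rule Ck_near_has_derivative[OF Ck_near_frechet[OF kk]])
  have K2s: "K2 w v = K2 v w" for v w unfolding K2_def by (rule second_derivative_symmetric[OF kk])
  have "tangent_map \<E> G c o1 = (\<lambda>v. v)"
    unfolding c_def o1_def by (rule has_mderiv_tangent_map[OF has_mderiv_chart_inv_self[OF cs]])
  then have \<phi>o: "\<phi> o1 w = w" for w unfolding \<phi>_def by (simp add: co left_mc_one)
  have "((\<lambda>x. \<phi> (k x) (?Dk x w)) has_derivative
      (\<lambda>v. \<phi> (k x0) (K2 w v) + (\<Sum>b\<in>Basis. (?Dk x0 w \<bullet> b) *\<^sub>R P b (?Dk x0 v)))) (at x0)" for w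
  proof (rule has_derivative_linear_apply[OF _ _ dK2])
    show "\<forall>\<^sub>F x in nhds x0. linear (\<phi> (k x))" using evimg by eventually_elim (rule lin\<phi>)
    show "((\<lambda>x. \<phi> (k x) b) has_derivative (\<lambda>v. P b (?Dk x0 v))) (at x0)" for b
      by (rule has_derivative_compose[OF dk]) (simp add: k0 dP)
  qed
  then have "(\<tau> w has_derivative
      (\<lambda>v. K2 w v + (\<Sum>b\<in>Basis. (?Dk x0 w \<bullet> b) *\<^sub>R P b (?Dk x0 v)))) (at x0)" for w
    unfolding k0 \<phi>o by (rule has_derivative_cong_ev[rotated]) (use ev in \<open>eventually_elim, simp\<close>)
  then have d\<tau>: "frechet_derivative (\<tau> w) (at x0) v = K2 w v + (\<Sum>b\<in>Basis. (?Dk x0 w \<bullet> b) *\<^sub>R P b (?Dk x0 v))" for w v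
    by (metis (no_types, lifting) frechet_derivative_at)
  have \<tau>0: "\<tau> w x0 = ?Dk x0 w" for w
    using eventually_nhds_x_imp_x[OF ev] by (simp add: k0 \<phi>o)
  let ?V = "\<lambda>\<zeta>. vf_rep G (lvf \<zeta>) \<one>"
  \<comment> \<open>The Maurer-Cartan form takes the constant value \<open>\<zeta>\<close> on its
    left-invariant field; the derivative of that constant at the identity is the sum of the two
    terms compared here.\<close>
  have "(\<Sum>b\<in>Basis. (\<zeta> \<bullet> b) *\<^sub>R P b \<xi>) = - frechet_derivative (?V \<zeta>) (at o1) \<xi>" for \<xi> \<zeta>
  proof -
    have "Ck_near (Suc 0) (?V \<zeta>) o1"
      using Ck_near_lvf[OF Ck_c[OF oi] _ Ck_near_const, of \<one> "Suc 0" \<zeta>] co cD[of \<one>]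
      by (simp add: vf_rep_def[abs_def] c_def Let_def)
    then have dV: "(?V \<zeta> has_derivative frechet_derivative (?V \<zeta>) (at o1)) (at o1)" by (rule Ck_near_has_derivative)
    have "((\<lambda>z. \<phi> z (?V \<zeta> z)) has_derivative
       (\<lambda>v. \<phi> o1 (frechet_derivative (?V \<zeta>) (at o1) v) + (\<Sum>b\<in>Basis. (?V \<zeta> o1 \<bullet> b) *\<^sub>R P b v))) (at o1)"
      by (rule has_derivative_linear_apply[OF eventually_mono[OF eventually_nhds_in_open[OF chart_systemD(3)[OF cs] oi] lin\<phi>] dP dV])
    moreover have "((\<lambda>z. \<phi> z (?V \<zeta> z)) has_derivative (\<lambda>v. 0)) (at o1)"
    proof (rule has_derivative_cong_ev[OF _ has_derivative_const[of \<zeta>]],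
        use eventually_nhds_in_open[OF chart_systemD(3)[OF cs] oi] in eventually_elim)
      fix z assume z: "z \<in> chart_img G \<one>"
      have "tangent_map \<E> G c z = from_chart G \<one> (c z)"
        unfolding c_def by (rule has_mderiv_tangent_map[OF has_mderiv_chart_inv[OF sm z]])
      then show "\<zeta> = \<phi> z (?V \<zeta> z)"
        using to_chart_from_chart(1)[OF sm coord_chart_inv(2)[OF cs z]]
        by (simp add: \<phi>_def vf_rep_def Let_def c_def)
    qed
    ultimately have "(\<lambda>v. \<phi> o1 (frechet_derivative (?V \<zeta>) (at o1) v) + (\<Sum>b\<in>Basis. (?V \<zeta> o1 \<bullet> b) *\<^sub>R P b v)) = (\<lambda>v. 0)"
      by (rule has_derivative_unique)
    from fun_cong[OF this, of \<xi>] have "frechet_derivative (?V \<zeta>) (at o1) \<xi> + (\<Sum>b\<in>Basis. (?V \<zeta> o1 \<bullet> b) *\<^sub>R P b \<xi>) = 0"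
      by (simp add: \<phi>o)
    moreover have "?V \<zeta> o1 = \<zeta>"
      using has_mderiv_tangent_map[OF has_mderiv_coord_self[OF cs, of \<one>]] has_mderiv_tangent_map[OF has_mderiv_coord[OF sm cD, of \<one>]]
      by (simp add: vf_rep_def Let_def o1_def coord_self[OF cs] lvf_one)
    ultimately show ?thesis by (simp add: eq_neg_iff_add_eq_0 add.commute)
  qed
  then show ?thesis unfolding d\<tau> \<tau>0 K2s[of v w] lie_bracket_eq o1_def[symmetric] by simp
qed

end

section \<open>Consequences of the invariance of \<open>B\<close>\<close>

locale lie_grp_form = lie_grp G
  for G :: "('g::{t2_space, second_countable_topology}, 'a::euclidean_space) lie_group_data" +
  fixes B :: "'a \<Rightarrow> 'a \<Rightarrow> real"
  assumes inv: "invariant_inner_product G B"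
begin

lemma bounded_bilinear_B: "bounded_bilinear B"
  using inv by (simp add: invariant_inner_product_def bilinear_conv_bounded_bilinear)

lemmas B_simps = bounded_bilinear.add_left[OF bounded_bilinear_B]
  bounded_bilinear.add_right[OF bounded_bilinear_B]
  bounded_bilinear.diff_left[OF bounded_bilinear_B]
  bounded_bilinear.diff_right[OF bounded_bilinear_B]
  bounded_bilinear.minus_left[OF bounded_bilinear_B]
  bounded_bilinear.minus_right[OF bounded_bilinear_B]
  bounded_bilinear.scaleR_left[OF bounded_bilinear_B]
  bounded_bilinear.scaleR_right[OF bounded_bilinear_B]
  bounded_bilinear.zero_left[OF bounded_bilinear_B]
  bounded_bilinear.zero_right[OF bounded_bilinear_B]

lemma B_sym: "B \<xi> \<zeta> = B \<zeta> \<xi>" using inv by (simp add: invariant_inner_product_def)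

lemma B_nondegenerate: "(\<And>\<zeta>. B \<xi> \<zeta> = 0) \<Longrightarrow> \<xi> = 0"
  using inv by (simp add: invariant_inner_product_def)

lemma B_Ad [simp]: "B (Adj g \<xi>) (Adj g \<zeta>) = B \<xi> \<zeta>"
  using inv by (simp add: invariant_inner_product_def)

text \<open>Derivative at the identity of the \<open>Ad\<close>-invariance of
  \<open>B\<close>.\<close>

lemma B_ad: "B \<lbrakk>\<xi>, \<zeta>\<rbrakk> \<omega> = - B \<zeta> \<lbrakk>\<xi>, \<omega>\<rbrakk>"
proof -
  have "has_mderiv G \<E> (\<lambda>x. B (Adj x \<zeta>) (Adj x \<omega>)) \<one> (\<lambda>\<xi>. B (Adj \<one> \<zeta>) \<lbrakk>\<xi>, \<omega>\<rbrakk> + B \<lbrakk>\<xi>, \<zeta>\<rbrakk> (Adj \<one> \<omega>))"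
    by (rule has_mderiv_bilinear[OF cs bounded_bilinear_B has_mderiv_Ad_one has_mderiv_Ad_one])
  then have "has_mderiv G \<E> (\<lambda>x. B \<zeta> \<omega>) \<one> (\<lambda>\<xi>. B \<zeta> \<lbrakk>\<xi>, \<omega>\<rbrakk> + B \<lbrakk>\<xi>, \<zeta>\<rbrakk> \<omega>)"
    by (simp add: Ad_one)
  from has_mderiv_unique[OF has_mderiv_const this] have "0 = B \<zeta> \<lbrakk>\<xi>, \<omega>\<rbrakk> + B \<lbrakk>\<xi>, \<zeta>\<rbrakk> \<omega>" by metis
  then show ?thesis by simp
qed

lemma B_cyclic: "B \<xi> \<lbrakk>\<zeta>, \<omega>\<rbrakk> = B \<zeta> \<lbrakk>\<omega>, \<xi>\<rbrakk>"
  by (metis B_ad B_sym lie_bracket_antisym bounded_bilinear.minus_right[OF bounded_bilinear_B])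

end

section \<open>One-parameter subgroups\<close>

text \<open>A Banach fixed point argument in the bounded continuous curves on the whole line. The
  solution is asserted on an open interval, where its derivative is two-sided, and without an
  initial value: in a group a translation can move any of its points to the identity.\<close>

lemma picard_lindelof_local:
  fixes X :: "'a::euclidean_space \<Rightarrow> 'a"
  assumes X: "Ck_near (Suc 0) X x0" and \<Omega>: "open \<Omega>" "x0 \<in> \<Omega>"
  shows "\<exists>h>0. \<exists>c. \<forall>t\<in>{0<..<h}. (c has_vector_derivative X (c t)) (at t) \<and> c t \<in> \<Omega>"
proof -
  obtain U where U: "open U" "x0 \<in> U" "Ck_on (Suc 0) U X" using X unfolding Ck_near_def by blast
  obtain r where r: "r > 0" "cball x0 r \<subseteq> U \<inter> \<Omega>"
    using U \<Omega> open_contains_cball[of "U \<inter> \<Omega>"] by (meson IntI open_Int)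
  let ?K = "cball x0 r"
  have d: "(X has_derivative frechet_derivative X (at y)) (at y)" if "y \<in> ?K" for y
    using U(3) r that by (auto simp: frechet_derivative_works[symmetric])
  define S where "S y = (\<Sum>b\<in>Basis. norm (frechet_derivative X (at y) b))" for y
  have "continuous_on ?K S" unfolding S_def
    using U(3) r by (intro continuous_on_sum continuous_on_norm) (auto intro: continuous_on_subset)
  then obtain L where L: "\<And>y. y \<in> ?K \<Longrightarrow> S y \<le> L"
    using compact_continuous_image[THEN compact_imp_bounded, of ?K S]
    by (auto simp: bounded_iff simp del: mem_cball) (metis abs_le_D1)
  have "onorm (frechet_derivative X (at y)) \<le> L" if y: "y \<in> ?K" for y
  proof (rule onorm_le)
    fix v
    have "norm (frechet_derivative X (at y) v) = norm (\<Sum>b\<in>Basis. (v \<bullet> b) *\<^sub>R frechet_derivative X (at y) b)"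
      using linear_expand[OF has_derivative_linear[OF d[OF y]]] by metis
    also have "\<dots> \<le> (\<Sum>b\<in>Basis. norm v * norm (frechet_derivative X (at y) b))"
      by (rule sum_norm_le) (simp add: Basis_le_norm mult_right_mono)
    also have "\<dots> = norm v * S y" by (simp add: S_def sum_distrib_left)
    also have "\<dots> \<le> L * norm v" using L[OF y] by (metis mult.commute mult_right_mono norm_ge_zero)
    finally show "norm (frechet_derivative X (at y) v) \<le> L * norm v" .
  qed
  then have Lip: "norm (X y - X z) \<le> L * norm (y - z)" if "y \<in> ?K" "z \<in> ?K" for y z
    using that d by (intro differentiable_bound[of ?K X]) (auto intro: has_derivative_at_withinI)
  have "S x0 \<ge> 0" by (simp add: S_def sum_nonneg)
  then have L0: "L \<ge> 0" using L[of x0] r by simp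
  \<comment> \<open>Composing \<open>X\<close> with the nearest-point projection onto the ball makes
    it bounded and Lipschitz on the whole space, so every curve is admissible in the iteration. The
    fixed point stays in the ball, where the projection does nothing.\<close>
  define P where "P = closest_point ?K"
  have P: "P y \<in> ?K" "y \<in> ?K \<Longrightarrow> P y = y" "dist (P y) (P z) \<le> dist y z" for y z
    using r closest_point_in_set[of ?K y] closest_point_lipschitz[of ?K y z] by (auto simp: P_def closest_point_self)
  define Y where "Y y = X (P y)" for y
  have YL: "norm (Y y - Y z) \<le> L * norm (y - z)" for y z
  proof -
    have "norm (Y y - Y z) \<le> L * norm (P y - P z)" unfolding Y_def by (rule Lip[OF P(1) P(1)])
    also have "\<dots> \<le> L * norm (y - z)" using P(3)[of y z] L0 by (simp add: dist_norm mult_left_mono)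
    finally show ?thesis .
  qed
  have Yc: "continuous_on UNIV Y"
    by (rule lipschitz_on_continuous_on[of L]) (use YL L0 in \<open>auto simp: dist_norm intro!: lipschitz_onI\<close>)
  have "continuous_on ?K X" using has_derivative_continuous[OF d] by (intro continuous_at_imp_continuous_on) auto
  then obtain M where M: "M > 0" "\<And>y. y \<in> ?K \<Longrightarrow> norm (X y) \<le> M"
    using compact_continuous_image[THEN compact_imp_bounded, of ?K X] by (auto simp: bounded_pos)
  have YM: "norm (Y y) \<le> M" for y unfolding Y_def by (rule M(2)[OF P(1)])
  \<comment> \<open>The first bound keeps the curve in the ball, the second makes the iteration
    contract by the factor 1/2; \<open>L + 1\<close> avoids a division by 0.\<close>
  define h where "h = min (r / M) (1 / (2 * (L + 1)))"
  have h: "h > 0" "M * h \<le> r" "L * h \<le> 1 / 2"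
  proof -
    show "h > 0" using r M L0 by (simp add: h_def)
    have "h \<le> r / M" by (simp add: h_def)
    then show "M * h \<le> r" using M by (simp add: field_simps)
    have "L * h \<le> (L + 1) * (1 / (2 * (L + 1)))" using L0 \<open>h > 0\<close> by (intro mult_mono) (auto simp: h_def)
    also have "\<dots> = 1 / 2" using L0 by simp
    finally show "L * h \<le> 1 / 2" .
  qed
  \<comment> \<open>Clamping time to \<open>{0..h}\<close> extends the integral operator to curves
    on the whole line.\<close>
  define cl where "cl t = max 0 (min h t)" for t
  have cl: "cl t \<in> {0..h}" "t \<in> {0..h} \<Longrightarrow> cl t = t" for t using h by (auto simp: cl_def)
  define T where "T f = (\<lambda>t. x0 + integral {0..cl t} (\<lambda>s. Y (apply_bcontfun f s)))" for f :: "real \<Rightarrow>\<^sub>C 'a"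
  have Yf: "continuous_on A (\<lambda>s. Y (apply_bcontfun f s))" for f :: "real \<Rightarrow>\<^sub>C 'a" and A
    by (rule continuous_on_compose2[OF Yc]) auto
  have int: "(\<lambda>s. Y (apply_bcontfun f s)) integrable_on {a..b}" for f :: "real \<Rightarrow>\<^sub>C 'a" and a b
    by (rule integrable_continuous_real[OF Yf])
  have T_norm: "norm (integral {0..cl t} (\<lambda>s. Y (apply_bcontfun f s))) \<le> M * h" for f t
  proof -
    have "norm (integral {0..cl t} (\<lambda>s. Y (apply_bcontfun f s))) \<le> M * (cl t - 0)"
      by (rule integral_bound) (use cl(1) Yf YM in auto)
    also have "\<dots> \<le> M * h" using cl(1)[of t] M by auto
    finally show ?thesis .
  qed
  have T_bc: "T f \<in> bcontfun" for f
  proof (rule bcontfun_normI)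
    have "continuous_on {0..h} (\<lambda>t. integral {0..t} (\<lambda>s. Y (apply_bcontfun f s)))"
      by (rule indefinite_integral_continuous_1[OF int])
    then have "continuous_on UNIV (\<lambda>t. integral {0..cl t} (\<lambda>s. Y (apply_bcontfun f s)))"
      by (rule continuous_on_compose2) (use cl(1) in \<open>auto simp: cl_def intro!: continuous_intros\<close>)
    then show "continuous_on UNIV (T f)" unfolding T_def by (intro continuous_intros)
    show "norm (T f t) \<le> norm x0 + M * h" for t
      unfolding T_def using T_norm[of t f] by (intro norm_triangle_le) simp
  qed
  have "dist (Bcontfun (T f)) (Bcontfun (T g)) \<le> 1 / 2 * dist f g" for f g
  proof (rule dist_bound)
    fix t
    have "T f t - T g t = integral {0..cl t} (\<lambda>s. Y (apply_bcontfun f s) - Y (apply_bcontfun g s))"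
      unfolding T_def by (simp add: integral_diff[OF int int])
    also have "norm \<dots> \<le> (L * dist f g) * (cl t - 0)"
    proof (rule integral_bound)
      show "continuous_on {0..cl t} (\<lambda>s. Y (apply_bcontfun f s) - Y (apply_bcontfun g s))"
        by (intro continuous_intros Yf)
      show "norm (Y (apply_bcontfun f s) - Y (apply_bcontfun g s)) \<le> L * dist f g" for s
        using YL[of "apply_bcontfun f s" "apply_bcontfun g s"] dist_bounded[of f s g] L0
        by (auto simp: dist_norm[symmetric] intro: order_trans mult_left_mono)
    qed (use cl in auto)
    also have "\<dots> \<le> (L * dist f g) * h" using cl(1)[of t] L0 by (intro mult_left_mono) auto
    also have "\<dots> \<le> 1 / 2 * dist f g" using mult_right_mono[OF h(3), of "dist f g"] by (simp add: mult_ac)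
    finally show "dist (apply_bcontfun (Bcontfun (T f)) t) (apply_bcontfun (Bcontfun (T g)) t) \<le> 1 / 2 * dist f g"
      by (simp add: Bcontfun_inverse T_bc dist_norm)
  qed
  then obtain f where f: "Bcontfun (T f) = f"
    using banach_fix_type[of "1 / 2" "\<lambda>f. Bcontfun (T f)"] by auto
  define c where "c = apply_bcontfun f"
  have cT: "c t = T f t" for t unfolding c_def using f Bcontfun_inverse[OF T_bc] by metis
  have cK: "c t \<in> ?K" for t
    unfolding cT T_def using T_norm[of t f] h(2) by (simp add: dist_norm)
  have ci: "c t = x0 + integral {0..t} (\<lambda>s. Y (c s))" if "t \<in> {0..h}" for t
    using cT[of t] cl(2)[OF that] by (simp add: T_def c_def)
  have Yc': "continuous_on {0..h} (\<lambda>s. Y (c s))" unfolding c_def by (rule Yf)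
  have "(c has_vector_derivative X (c t)) (at t)" if t: "t \<in> {0<..<h}" for t
  proof -
    have "((\<lambda>t. integral {0..t} (\<lambda>s. Y (c s))) has_vector_derivative Y (c t)) (at t within {0..h})"
      by (rule integral_has_vector_derivative[OF Yc']) (use t in auto)
    then have "((\<lambda>t. x0 + integral {0..t} (\<lambda>s. Y (c s))) has_vector_derivative Y (c t)) (at t)"
      using t by (auto intro!: derivative_eq_intros simp: at_within_interior[of t "{0..h}"])
    then have "(c has_vector_derivative Y (c t)) (at t)"
      by (rule has_vector_derivative_transform_within_open[where S="{0<..<h}"]) (use t ci in auto)
    then show ?thesis using P(2)[OF cK] by (simp add: Y_def)
  qed
  then show ?thesis using h(1) cK r(2) by blast
qed

context lie_grp begin

lemma has_lderiv_compose:
  assumes "chart_system M" "chart_system N" "has_mderiv M N h p H" "has_lderiv N f (h p) F"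
  shows "has_lderiv M (\<lambda>x. f (h x)) p (\<lambda>v. F (H v))"
  using has_mderiv_compose[OF assms(1,2,3) assms(4)[unfolded has_lderiv_def]] by (simp add: has_lderiv_def)

lemma has_lderiv_lmul: "has_lderiv M f p F \<Longrightarrow> has_lderiv M (\<lambda>x. a \<odot> f x) p F"
proof -
  have "ivs (a \<odot> f p) \<odot> (a \<odot> f x) = ivs (f p) \<odot> f x" for x by (simp add: ivs_mul grp.assoc)
  then show "has_lderiv M f p F \<Longrightarrow> has_lderiv M (\<lambda>x. a \<odot> f x) p F" by (simp add: has_lderiv_def)
qed

lemma has_lderiv_isCont: "chart_system M \<Longrightarrow> has_lderiv M f p F \<Longrightarrow> isCont f p"
  using has_lderivD by (auto simp: has_mderiv_def)

lemma has_lderiv_cong: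
  assumes "chart_system M" "has_lderiv M f p F" "\<forall>\<^sub>F x in nhds p. f x = g x"
  shows "has_lderiv M g p F"
proof -
  have "\<forall>\<^sub>F x in nhds p. ivs (f p) \<odot> f x = ivs (g p) \<odot> g x"
    using assms(3) eventually_nhds_x_imp_x[OF assms(3)] by (auto elim: eventually_mono)
  then show ?thesis using has_mderiv_cong[OF assms(1) assms(2)[unfolded has_lderiv_def]] by (simp add: has_lderiv_def)
qed

lemma has_lderiv_zero_imp_constant:
  fixes h :: "real \<Rightarrow> 'g"
  assumes I: "open I" "connected I" and h: "\<And>t. t \<in> I \<Longrightarrow> has_lderiv \<E> h t (\<lambda>s. 0)"
    and ab: "a \<in> I" "b \<in> I"
  shows "h a = h b"
proof -
  have "h constant_on I"
  proof (rule locally_constant_imp_constant[OF I(2)])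
    fix a assume a: "a \<in> I"
    let ?q = "h a"
    have "\<forall>\<^sub>F t in nhds a. t \<in> I \<and> h t \<in> chart_dom G ?q"
      using eventually_nhds_in_open[OF I(1) a] eventually_in_chart[OF cs has_lderiv_isCont[OF csE h[OF a]] cD]
      by eventually_elim auto
    then obtain U where U: "open U" "a \<in> U" "\<And>t. t \<in> U \<Longrightarrow> t \<in> I \<and> h t \<in> chart_dom G ?q"
      unfolding eventually_nhds by blast
    then obtain e where e: "e > 0" "ball a e \<subseteq> U" using open_contains_ball by blast
    have "((\<lambda>t. coord G ?q (h t)) has_derivative (\<lambda>s. 0)) (at t within ball a e)" if t: "t \<in> ball a e" for t
    proof -
      have tU: "t \<in> I" "h t \<in> chart_dom G ?q" using U(3)[of t] e t by auto
      have "has_mderiv \<E> G h t (\<lambda>s. 0)"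
        using has_lderivD[OF csE h[OF tU(1)]] linear_0[OF linear_lvf] by simp
      from has_mderiv_compose[OF csE cs this has_mderiv_coord[OF sm tU(2)]]
      have "((\<lambda>t. coord G ?q (h t)) has_derivative (\<lambda>s. 0)) (at t)"
        using linear_0[OF has_mderiv_linear[OF has_mderiv_coord[OF sm tU(2)]]] by simp
      then show ?thesis by (rule has_derivative_at_withinI)
    qed
    from has_derivative_zero_constant[OF convex_ball this]
    obtain k where k: "\<And>t. t \<in> ball a e \<Longrightarrow> coord G ?q (h t) = k" by blast
    have "h t = h a" if t: "t \<in> ball a e" for t
    proof -
      have "h t \<in> chart_dom G ?q" using U(3)[of t] e t by auto
      then have "h t = chart_inv G ?q k" using chart_inv_coord(1)[OF cs] k[OF t] by metis
      also have "\<dots> = h a" using k[of a] e(1) coord_self(1)[OF cs, of ?q] by simp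
      finally show ?thesis .
    qed
    moreover have "openin (top_of_set I) (ball a e)"
      using U e by (intro open_subset) auto
    moreover have "a \<in> ball a e" using e(1) by simp
    ultimately show "\<exists>T. openin (top_of_set I) T \<and> a \<in> T \<and> (\<forall>x\<in>T. h x = h a)" by blast
  qed
  then show ?thesis using ab unfolding constant_on_def by metis
qed

text \<open>Uniqueness is algebraic: the logarithmic derivatives of \<open>f\<close> and of the
  inverse of \<open>g\<close> cancel in the product of the two, which is therefore constant.\<close>

lemma integral_curve_unique:
  fixes f g :: "real \<Rightarrow> 'g"
  assumes I: "open I" "connected I"
    and f: "\<And>t. t \<in> I \<Longrightarrow> has_lderiv \<E> f t F" and g: "\<And>t. t \<in> I \<Longrightarrow> has_lderiv \<E> g t F"
    and ab: "a \<in> I" "f a = g a" "b \<in> I"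
  shows "f b = g b"
proof -
  have "has_lderiv \<E> (\<lambda>t. f t \<odot> ivs (g t)) t (\<lambda>s. 0)" if "t \<in> I" for t
    using has_lderiv_mult[OF csE f[OF that] has_lderiv_ivs[OF csE g[OF that]]] by simp
  from has_lderiv_zero_imp_constant[OF I this ab(3,1)] have "f b \<odot> ivs (g b) = \<one>" using ab(2) by simp
  then have "f b \<odot> ivs (g b) \<odot> g b = g b" by simp
  then show ?thesis by simp
qed

lemma local_one_parameter_subgroup:
  "\<exists>d>0. \<exists>f::real \<Rightarrow> 'g. f 0 = \<one> \<and> (\<forall>t\<in>{-d<..<d}. has_lderiv \<E> f t (\<lambda>s. s *\<^sub>R \<xi>))"
proof -
  define X where "X = vf_rep G (lvf \<xi>) \<one>"
  have "Ck_near (Suc 0) X (coord G \<one> \<one>)"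
    using Ck_near_lvf[OF Ck_at_chart_inv[OF sm coord_self(2)[OF cs]] _ Ck_near_const, of \<one> \<one> "Suc 0" \<xi>]
    by (simp add: coord_self[OF cs] cD X_def vf_rep_def[abs_def] Let_def)
  from picard_lindelof_local[OF this chart_systemD(3)[OF cs] coord_self(2)[OF cs]]
  obtain h c where h: "h > 0" and
    c: "\<And>t. t \<in> {0<..<h} \<Longrightarrow> (c has_vector_derivative X (c t)) (at t) \<and> c t \<in> chart_img G \<one>" by blast
  define \<gamma> where "\<gamma> t = chart_inv G \<one> (c t)" for t
  have \<gamma>: "has_lderiv \<E> \<gamma> t (\<lambda>s. s *\<^sub>R \<xi>)" if t: "t \<in> {0<..<h}" for t
  proof -
    have d: "has_mderiv \<E> \<E> c t (\<lambda>s. s *\<^sub>R X (c t))" using c[OF t] by (simp add: has_vector_derivative_def)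
    have img: "c t \<in> chart_img G \<one>" using c[OF t] by simp
    note ci = has_mderiv_chart_inv[OF sm img]
    have "from_chart G \<one> (\<gamma> t) (s *\<^sub>R X (c t)) = s *\<^sub>R lvf \<xi> (\<gamma> t)" for s
      using linear_scale[OF has_mderiv_linear[OF ci]] to_chart_from_chart(1)[OF sm coord_chart_inv(2)[OF cs img]]
      by (simp add: X_def vf_rep_def Let_def \<gamma>_def)
    then have "has_mderiv \<E> G \<gamma> t (\<lambda>s. s *\<^sub>R lvf \<xi> (\<gamma> t))"
      using has_mderiv_compose[OF csE csE d ci] by (simp add: \<gamma>_def[abs_def])
    from has_lderivI[OF csE this] show ?thesis using linear_scale[OF linear_left_mc] by simp
  qed
  \<comment> \<open>Restarting at the midpoint and translating its value to the identity gives a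
    curve defined on both sides of 0. Left translation preserves the logarithmic derivative.\<close>
  define f where "f t = ivs (\<gamma> (h / 2)) \<odot> \<gamma> (h / 2 + t)" for t
  have "has_lderiv \<E> f t (\<lambda>s. s *\<^sub>R \<xi>)" if "t \<in> {-(h/2)<..<h/2}" for t
    unfolding f_def
    by (rule has_lderiv_lmul, rule has_lderiv_compose[OF csE csE _ \<gamma>, where H="\<lambda>s. s"])
      (use that in \<open>auto intro!: derivative_eq_intros\<close>)
  moreover have "f 0 = \<one>" by (simp add: f_def)
  ultimately show ?thesis using h by (intro exI[of _ "h / 2"]) auto
qed

primrec pw :: "'g \<Rightarrow> nat \<Rightarrow> 'g" where
  "pw x 0 = \<one>" | "pw x (Suc n) = pw x n \<odot> x"

lemma pw_add: "pw x (m + n) = pw x m \<odot> pw x n"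
  by (induction n) (simp_all add: grp.assoc)

lemma pw_mult: "pw (pw x m) n = pw x (m * n)"
  by (induction n) (simp_all add: pw_add[symmetric] add.commute)

lemma pw_commute: "x \<odot> y = y \<odot> x \<Longrightarrow> pw x n \<odot> y = y \<odot> pw x n"
  by (induction n) (simp, metis grp.assoc pw.simps(2))

lemma pw_prod: "x \<odot> y = y \<odot> x \<Longrightarrow> pw (x \<odot> y) n = pw x n \<odot> pw y n"
proof (induction n)
  case (Suc n)
  have "pw (x \<odot> y) (Suc n) = pw x n \<odot> (pw y n \<odot> x) \<odot> y" using Suc by (simp add: grp.assoc)
  also have "pw y n \<odot> x = x \<odot> pw y n" using Suc.prems by (simp add: pw_commute)
  finally show ?case by (simp add: grp.assoc)
qed simp

text \<open>The local solution is a homomorphism as far as it is defined. It extends to the line as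
  the \<open>n\<close>-th power of \<open>f (t / n)\<close> for large \<open>n\<close>; passing to a
  common multiple shows that the choice of \<open>n\<close> does not matter.\<close>

lemma one_parameter_subgroup_exists:
  "\<exists>c::real \<Rightarrow> 'g. (\<forall>s t. c (s + t) = c s \<odot> c t) \<and> (\<forall>t. has_lderiv \<E> c t (\<lambda>s. s *\<^sub>R \<xi>))"
proof -
  obtain d f where d: "d > 0" and f0: "f 0 = \<one>" and
    f: "\<And>t::real. t \<in> {-d<..<d} \<Longrightarrow> has_lderiv \<E> f t (\<lambda>s. s *\<^sub>R \<xi>)"
    using local_one_parameter_subgroup[of \<xi>] by blast
  \<comment> \<open>As functions of \<open>t\<close> both sides are integral curves through
    \<open>f s\<close>. They are compared where \<open>t\<close> and \<open>s + t\<close> both stay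
    in the domain, an intersection of two intervals and hence connected.\<close>
  have hom: "f (s + t) = f s \<odot> f t" if st: "\<bar>s\<bar> < d" "\<bar>t\<bar> < d" "\<bar>s + t\<bar> < d" for s t
  proof (rule integral_curve_unique[where f="\<lambda>t. f (s + t)" and g="\<lambda>t. f s \<odot> f t" and a=0 and
        I="{-d<..<d} \<inter> {-d-s<..<d-s}" and F="\<lambda>h. h *\<^sub>R \<xi>"])
    show "connected ({-d<..<d} \<inter> {-d-s<..<d-s})"
      by (intro convex_connected convex_Int convex_real_interval)
    show "has_lderiv \<E> (\<lambda>t. f s \<odot> f t) t (\<lambda>h. h *\<^sub>R \<xi>)" if "t \<in> {-d<..<d} \<inter> {-d-s<..<d-s}" for t
      by (rule has_lderiv_lmul) (use that f in auto)
    show "has_lderiv \<E> (\<lambda>t. f (s + t)) t (\<lambda>h. h *\<^sub>R \<xi>)" if "t \<in> {-d<..<d} \<inter> {-d-s<..<d-s}" for t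
      by (rule has_lderiv_compose[OF csE csE _ f, where H="\<lambda>s. s"])
        (use that in \<open>auto intro!: derivative_eq_intros\<close>)
  qed (use st f0 in auto)
  have pwf: "pw (f s) n = f (real n * s)" if "real n * \<bar>s\<bar> < d" for s n
    using that
  proof (induction n)
    case (Suc n)
    have "real n * \<bar>s\<bar> \<le> real (Suc n) * \<bar>s\<bar>" "\<bar>s\<bar> \<le> real (Suc n) * \<bar>s\<bar>"
      by (auto intro: mult_right_mono simp: algebra_simps)
    then have *: "real n * \<bar>s\<bar> < d" "\<bar>s\<bar> < d" using Suc.prems by linarith+
    have "real n * s + s = real (Suc n) * s" by (simp add: algebra_simps)
    then have "\<bar>real n * s + s\<bar> < d" using Suc.prems by (simp add: abs_mult)
    then have "f (real n * s + s) = f (real n * s) \<odot> f s" using * by (intro hom) (auto simp: abs_mult)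
    then show ?case using Suc.IH[OF *(1)] by (simp add: algebra_simps)
  qed (simp add: f0)
  have indep: "pw (f (t / real N)) N = pw (f (t / real (N * M))) (N * M)"
    if "\<bar>t\<bar> < real N * d" "N > 0" "M > 0" for t N M
  proof -
    have "\<bar>t\<bar> / real N < d" using that by (simp add: field_simps)
    then have "real M * \<bar>t / real (N * M)\<bar> < d" using that by (simp add: field_simps abs_mult)
    from pwf[OF this] have "pw (f (t / real (N * M))) M = f (t / real N)" using that by (simp add: field_simps)
    then show ?thesis by (metis mult.commute pw_mult)
  qed
  \<comment> \<open>The successor makes the inequality \<open>N\<close> strict and the number
    positive, also for \<open>t = 0\<close>.\<close>
  define N where "N t = Suc (nat \<lceil>\<bar>t\<bar> / d\<rceil>)" for t
  have N: "\<bar>t\<bar> < real (N t) * d" for t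
  proof -
    have "\<bar>t\<bar> / d < real (N t)" unfolding N_def using d by simp linarith
    then show ?thesis using d by (simp add: field_simps)
  qed
  define C where "C t = pw (f (t / real (N t))) (N t)" for t
  have C: "C t = pw (f (t / real n)) n" if "\<bar>t\<bar> < real n * d" "n > 0" for t n
    using indep[OF that, of "N t"] indep[OF N[of t], of n] that by (simp add: C_def N_def mult.commute)
  have Chom: "C (s + t) = C s \<odot> C t" for s t
  proof -
    define n where "n = N (\<bar>s\<bar> + \<bar>t\<bar>)"
    have n: "n > 0" "\<bar>s\<bar> + \<bar>t\<bar> < real n * d" using N[of "\<bar>s\<bar> + \<bar>t\<bar>"] by (auto simp: n_def N_def)
    have lt: "\<bar>x / real n\<bar> < d" if "\<bar>x\<bar> \<le> \<bar>s\<bar> + \<bar>t\<bar>" for x using n that by (simp add: field_simps)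
    have 1: "f (s / real n + t / real n) = f (s / real n) \<odot> f (t / real n)"
      by (rule hom) (use lt[of s] lt[of t] lt[of "s + t"] in \<open>auto simp: add_divide_distrib\<close>)
    \<comment> \<open>The same sum in the other order: the two values commute, which the power of a
      product requires.\<close>
    have 2: "f (s / real n + t / real n) = f (t / real n) \<odot> f (s / real n)"
      by (subst add.commute, rule hom) (use lt[of s] lt[of t] lt[of "s + t"] in \<open>auto simp: add_divide_distrib add.commute\<close>)
    have "C (s + t) = pw (f (s / real n + t / real n)) n"
      using n by (subst C[of _ n]) (auto simp: add_divide_distrib)
    also have "\<dots> = pw (f (s / real n)) n \<odot> pw (f (t / real n)) n"
      using 1 2 pw_prod by metis
    also have "\<dots> = C s \<odot> C t" using n by (subst (1 2) C[of _ n]) auto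
    finally show ?thesis .
  qed
  have "\<forall>\<^sub>F t in nhds 0. f t = C t"
    using eventually_nhds_in_open[of "{-d<..<d}" 0] d
    by (auto elim!: eventually_mono simp: C[of _ 1])
  then have C0: "has_lderiv \<E> C 0 (\<lambda>s. s *\<^sub>R \<xi>)" using has_lderiv_cong[OF csE f[of 0]] d by simp
  \<comment> \<open>The homomorphism property carries the derivative from 0, where \<open>C\<close>
    agrees with \<open>f\<close>, to every \<open>t\<close>.\<close>
  have "has_lderiv \<E> C t (\<lambda>s. s *\<^sub>R \<xi>)" for t
  proof -
    have "has_lderiv \<E> (\<lambda>x. C t \<odot> C (x - t)) t (\<lambda>s. s *\<^sub>R \<xi>)"
      by (rule has_lderiv_lmul, rule has_lderiv_compose[OF csE csE, where H="\<lambda>s. s" and f=C])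
        (use C0 in \<open>auto intro!: derivative_eq_intros\<close>)
    moreover have "C t \<odot> C (x - t) = C x" for x using Chom[of t "x - t"] by simp
    ultimately show ?thesis by simp
  qed
  then show ?thesis using Chom by blast
qed

section \<open>The exponential map\<close>

lemma Ck_at_0:
  fixes f :: "'x::euclidean_space \<Rightarrow> 'g"
  assumes f: "\<And>x. isCont f x" shows "Ck_at 0 \<E> G f p"
proof -
  have "\<forall>\<^sub>F x in nhds p. isCont (\<lambda>x. coord G (f p) (f x)) x"
    using eventually_in_chart[OF cs f cD] by eventually_elim (auto intro: isCont_o2 f isCont_coord[OF cs])
  then show ?thesis using f by (simp add: Ck_at_def Ck_near_0)
qed

lemma smooth_integral_curve:
  fixes c :: "real \<Rightarrow> 'g"
  assumes c: "\<And>t. has_lderiv \<E> c t (\<lambda>s. s *\<^sub>R \<xi>)"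
  shows "Ck_at k \<E> G c t"
proof (induction k arbitrary: t)
  case 0 then show ?case using Ck_at_0 has_lderiv_isCont[OF csE c] by blast
next
  case (Suc k)
  show ?case
    by (rule Ck_at_Suc_of_ltriv[where \<tau>="\<lambda>_ s. s *\<^sub>R \<xi>"]) (simp_all add: c Suc Ck_near_const)
qed

lemma hom_zero:
  assumes "\<forall>s t. c (s + t) = c s \<odot> c t" shows "c (0::real) = \<one>"
proof -
  have "c 0 = ivs (c 0) \<odot> (c 0 \<odot> c 0)" by simp
  also have "c 0 \<odot> c 0 = c 0" using assms[rule_format, of 0 0] by simp
  finally show ?thesis by simp
qed

lemma one_parameter_subgroup_iff:
  "one_parameter_subgroup G \<xi> c \<longleftrightarrow>
     (\<forall>s t. c (s + t) = c s \<odot> c t) \<and> (\<forall>t. has_lderiv \<E> c t (\<lambda>s. s *\<^sub>R \<xi>))"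
  (is "_ \<longleftrightarrow> ?hom \<and> ?d")
proof (intro iffI conjI)
  assume *: "one_parameter_subgroup G \<xi> c"
  then show hom: ?hom by (simp add: one_parameter_subgroup_def)
  have c0: "c 0 = \<one>" by (rule hom_zero[OF hom])
  have "Ck_at (Suc 0) \<E> G c 0"
    using * by (intro smooth_map_imp_Ck_at[OF csE cs]) (simp add: one_parameter_subgroup_def)
  then have D: "has_mderiv \<E> G c 0 (tangent_map \<E> G c 0)" by (rule Ck_at_has_mderiv)
  have "tangent_map \<E> G c 0 = (\<lambda>s. s *\<^sub>R \<xi>)"
  proof
    fix s show "tangent_map \<E> G c 0 s = s *\<^sub>R \<xi>"
      using * linear_scale[OF has_mderiv_linear[OF D], of s 1] by (simp add: one_parameter_subgroup_def)
  qed
  then have "has_mderiv \<E> G c 0 (\<lambda>s. s *\<^sub>R \<xi>)" using D by simp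
  from has_lderivI[OF csE this] have 0: "has_lderiv \<E> c 0 (\<lambda>s. s *\<^sub>R \<xi>)" by (simp add: c0 left_mc_one)
  show ?d
  proof
    fix t
    have "has_lderiv \<E> (\<lambda>x. c t \<odot> c (x - t)) t (\<lambda>s. s *\<^sub>R \<xi>)"
      by (rule has_lderiv_lmul, rule has_lderiv_compose[OF csE csE, where H="\<lambda>s. s" and f=c])
        (use 0 in \<open>auto intro!: derivative_eq_intros\<close>)
    moreover have "c t \<odot> c (x - t) = c x" for x using hom[rule_format, of t "x - t"] by simp
    ultimately show "has_lderiv \<E> c t (\<lambda>s. s *\<^sub>R \<xi>)" by simp
  qed
next
  assume *: "?hom \<and> ?d"
  have c0: "c 0 = \<one>" using * hom_zero by blast
  have "smooth_map \<E> G c"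
    unfolding smooth_map_iff_Ck_at[OF smE sm] using smooth_integral_curve * by blast
  moreover have "tangent_map \<E> G c 0 1 = \<xi>"
    using has_mderiv_tangent_map[OF has_lderivD[OF csE, of c 0 "\<lambda>s. s *\<^sub>R \<xi>"]] * by (simp add: c0 lvf_one)
  ultimately show "one_parameter_subgroup G \<xi> c" using * by (simp add: one_parameter_subgroup_def)
qed

abbreviation "Exp \<equiv> lie_exp G"

lemma one_parameter_subgroup_The:
  "one_parameter_subgroup G \<xi> (THE c. one_parameter_subgroup G \<xi> c)"
proof (rule theI'[where P="one_parameter_subgroup G \<xi>"])
  obtain c where c: "one_parameter_subgroup G \<xi> c"
    using one_parameter_subgroup_exists[of \<xi>] one_parameter_subgroup_iff by blast
  have "d = c" if d: "one_parameter_subgroup G \<xi> d" for d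
  proof
    fix t
    show "d t = c t"
    proof (rule integral_curve_unique[of UNIV d "\<lambda>s. s *\<^sub>R \<xi>" c 0])
      have "d 0 = \<one>" "c 0 = \<one>" using c d by (auto intro!: hom_zero simp: one_parameter_subgroup_iff)
      then show "d 0 = c 0" by simp
    qed (use c d in \<open>simp_all add: one_parameter_subgroup_iff\<close>)
  qed
  then show "\<exists>!c. one_parameter_subgroup G \<xi> c" using c by blast
qed

lemmas one_parameter_subgroup_The' = one_parameter_subgroup_The[THEN one_parameter_subgroup_iff[THEN iffD1]]

text \<open>Rescaling time by \<open>t\<close> turns the one-parameter subgroup of
  \<open>\<xi>\<close> into that of \<open>t *\<^sub>R \<xi>\<close>; uniqueness identifies
  them.\<close>

lemma Exp_curve: "(THE c. one_parameter_subgroup G \<xi> c) t = Exp (t *\<^sub>R \<xi>)"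
proof -
  let ?c = "\<lambda>\<xi>. THE c. one_parameter_subgroup G \<xi> c"
  have c: "has_lderiv \<E> (?c \<xi>) t (\<lambda>s. s *\<^sub>R \<xi>)" "?c \<xi> 0 = \<one>" for \<xi> t
    using one_parameter_subgroup_The'[of \<xi>] hom_zero[of "?c \<xi>"] by blast+
  have "?c (t *\<^sub>R \<xi>) 1 = ?c \<xi> (1 * t)"
  proof (rule integral_curve_unique[of UNIV _ "\<lambda>s. s *\<^sub>R t *\<^sub>R \<xi>" "\<lambda>s. ?c \<xi> (s * t)" 0])
    fix s
    have "has_lderiv \<E> (\<lambda>s. ?c \<xi> (s * t)) s (\<lambda>s. (s * t) *\<^sub>R \<xi>)"
      by (rule has_lderiv_compose[OF csE csE, where H="\<lambda>s. s * t"]) (auto intro!: derivative_eq_intros c)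
    then show "has_lderiv \<E> (\<lambda>s. ?c \<xi> (s * t)) s (\<lambda>s. s *\<^sub>R t *\<^sub>R \<xi>)" by simp
    show "has_lderiv \<E> (?c (t *\<^sub>R \<xi>)) s (\<lambda>s. s *\<^sub>R t *\<^sub>R \<xi>)" by (rule c)
  qed (simp_all add: c)
  then show ?thesis by (simp add: lie_exp_def)
qed

lemma Exp_add: "Exp ((s + t) *\<^sub>R \<xi>) = Exp (s *\<^sub>R \<xi>) \<odot> Exp (t *\<^sub>R \<xi>)"
  using one_parameter_subgroup_The'[of \<xi>] unfolding Exp_curve by blast

lemma has_lderiv_Exp_line: "has_lderiv \<E> (\<lambda>t. Exp (t *\<^sub>R \<xi>)) t (\<lambda>s. s *\<^sub>R \<xi>)"
  using one_parameter_subgroup_The'[of \<xi>] unfolding Exp_curve by blast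

lemma Exp_0 [simp]: "Exp 0 = \<one>"
proof -
  have "(THE c. one_parameter_subgroup G 0 c) 0 = \<one>"
    using one_parameter_subgroup_The'[of 0] by (intro hom_zero) blast
  then show ?thesis unfolding Exp_curve by simp
qed

lemma ivs_Exp: "ivs (Exp \<xi>) = Exp (- \<xi>)"
proof -
  have "Exp (- \<xi>) \<odot> Exp \<xi> = \<one>" using Exp_add[of "-1" 1 \<xi>] by simp
  then have "Exp (- \<xi>) \<odot> Exp \<xi> \<odot> ivs (Exp \<xi>) = \<one> \<odot> ivs (Exp \<xi>)" by (rule arg_cong)
  then show ?thesis by simp
qed

text \<open>
  The curve cannot leave the ball: until a first exit time, the bound on its speed keeps it in a
  smaller closed ball.
\<close>

lemma small_curve_estimate:
  fixes \<gamma> :: "real \<Rightarrow> 'g" and A :: "real \<Rightarrow> 'a"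
  defines "o1 \<equiv> coord G \<one> \<one>" and "V \<equiv> \<lambda>x \<zeta>. vf_rep G (lvf \<zeta>) \<one> x"
  assumes \<gamma>: "\<And>t. has_lderiv \<E> \<gamma> t (\<lambda>s. s *\<^sub>R A t)" and \<gamma>0: "\<gamma> 0 = \<one>"
    and A: "continuous_on {0..1} A" "\<And>t. t \<in> {0..1} \<Longrightarrow> norm (A t) \<le> a"
    and r: "r > 0" "cball o1 r \<subseteq> chart_img G \<one>"
    and V: "\<And>x \<zeta>. x \<in> cball o1 r \<Longrightarrow> norm (V x \<zeta> - \<zeta>) \<le> \<epsilon> * norm \<zeta>"
    and small: "(1 + \<epsilon>) * a < r" and \<epsilon>: "\<epsilon> \<ge> 0"
  shows "\<gamma> 1 \<in> chart_dom G \<one>" "norm (coord G \<one> (\<gamma> 1) - o1) \<le> (1 + \<epsilon>) * a"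
    "norm (coord G \<one> (\<gamma> 1) - o1 - integral {0..1} A) \<le> \<epsilon> * a"
proof -
  define W where "W = chart_dom G \<one> \<inter> coord G \<one> -` ball o1 r"
  define x where "x t = coord G \<one> (\<gamma> t)" for t
  define \<rho> where "\<rho> = (1 + \<epsilon>) * a"
  have a0: "a \<ge> 0" using order_trans[OF norm_ge_zero A(2)[of 0]] by simp
  have \<rho>: "0 \<le> \<rho>" "\<rho> < r" using a0 \<epsilon> small by (auto simp: \<rho>_def)
  have oW: "open W" unfolding W_def
    using continuous_on_open_vimage[OF chart_systemD(2)[OF cs]] chart_systemD(4)[OF cs] open_ball
    by (metis inf_commute)
  have \<gamma>c: "isCont \<gamma> t" for t by (rule has_lderiv_isCont[OF csE \<gamma>])
  have x0: "x 0 = o1" by (simp add: x_def \<gamma>0 o1_def)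
  have dx: "(x has_vector_derivative V (x t) (A t)) (at t)" if W: "\<gamma> t \<in> W" for t
  proof -
    have dom: "\<gamma> t \<in> chart_dom G \<one>" using W by (simp add: W_def)
    have "has_mderiv \<E> \<E> x t (\<lambda>s. to_chart G \<one> (\<gamma> t) (lvf (s *\<^sub>R A t) (\<gamma> t)))"
      unfolding x_def by (rule has_mderiv_compose[OF csE cs has_lderivD[OF csE \<gamma>] has_mderiv_coord[OF sm dom]])
    then show ?thesis
      using linear_scale[OF has_mderiv_linear[OF has_mderiv_coord[OF sm dom]]] linear_scale[OF linear_lvf]
      by (simp add: has_vector_derivative_def V_def vf_rep_def Let_def x_def chart_inv_coord[OF cs dom])
  qed
  have nV: "norm (V (x t) (A t)) \<le> \<rho>" "norm (V (x t) (A t) - A t) \<le> \<epsilon> * a" if W: "\<gamma> t \<in> W" and t: "t \<in> {0..1}" for t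
  proof -
    have "x t \<in> cball o1 r" using W by (auto simp: W_def x_def)
    then have 1: "norm (V (x t) (A t) - A t) \<le> \<epsilon> * norm (A t)" by (rule V)
    also have "\<dots> \<le> \<epsilon> * a" using A(2)[OF t] \<epsilon> by (rule mult_left_mono)
    finally show 2: "norm (V (x t) (A t) - A t) \<le> \<epsilon> * a" .
    have "norm (V (x t) (A t)) \<le> norm (V (x t) (A t) - A t) + norm (A t)"
      using norm_triangle_ineq[of "V (x t) (A t) - A t" "A t"] by simp
    also have "\<dots> \<le> \<epsilon> * a + a" using 2 A(2)[OF t] by linarith
    finally show "norm (V (x t) (A t)) \<le> \<rho>" by (simp add: \<rho>_def algebra_simps)
  qed
  have bound: "norm (x t - o1) \<le> \<rho>" if t: "t \<in> {0..1}" and W: "\<And>s. s \<in> {0..t} \<Longrightarrow> \<gamma> s \<in> W" for t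
  proof -
    have "norm (x t - x 0) \<le> \<rho> * norm (t - 0)"
    proof (rule differentiable_bound[where S="{0..t}" and f'="\<lambda>s h. h *\<^sub>R V (x s) (A s)"])
      show "(x has_derivative (\<lambda>h. h *\<^sub>R V (x s) (A s))) (at s within {0..t})" if "s \<in> {0..t}" for s
        using dx[OF W[OF that]] by (auto simp: has_vector_derivative_def intro: has_derivative_at_withinI)
      show "onorm (\<lambda>h. h *\<^sub>R V (x s) (A s)) \<le> \<rho>" if "s \<in> {0..t}" for s
        using mult_left_mono[OF nV(1)[OF W[OF that]] abs_ge_zero] that t by (intro onorm_le) (auto simp: mult.commute[of \<rho>])
    qed (use t in auto)
    also have "\<dots> \<le> \<rho> * 1" using t \<rho> by (intro mult_left_mono) auto
    finally show ?thesis by (simp add: x0)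
  qed
  have inW: "\<gamma> t \<in> W" if t: "t \<in> {0..1}" for t
  proof (rule ccontr)
    assume "\<gamma> t \<notin> W"
    define C where "C = {0..1} \<inter> \<gamma> -` (- W)"
    have "closed C" unfolding C_def
      using \<gamma>c oW by (intro continuous_closed_preimage) (auto intro: continuous_at_imp_continuous_on)
    then have "compact C" using compact_Int_closed[of "{0..1::real}" C] by (simp add: C_def Int_absorb2 inf.assoc[symmetric])
    moreover have "C \<noteq> {}" using t \<open>\<gamma> t \<notin> W\<close> by (auto simp: C_def)
    ultimately have "\<exists>t1\<in>C. \<forall>s\<in>C. t1 \<le> s" by (rule compact_attains_inf)
    then obtain t1 where t1: "t1 \<in> C" "\<And>s. s \<in> C \<Longrightarrow> t1 \<le> s" by blast
    have t1': "t1 \<in> {0..1}" "\<gamma> t1 \<notin> W" using t1(1) by (auto simp: C_def)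
    have "\<gamma> 0 \<in> W" using r cD by (simp add: W_def \<gamma>0 o1_def)
    then have "t1 > 0" using t1' by (metis atLeastAtMost_iff less_eq_real_def)
    have before: "\<gamma> s \<in> W" if "s \<in> {0..<t1}" for s
      using t1(2)[of s] that t1' by (auto simp: C_def)
    \<comment> \<open>This image is compact, hence closed in the group, so the limit at
      \<open>t1\<close> still lies in it; as \<open>\<rho> < r\<close>, it is contained in
      \<open>W\<close>.\<close>
    let ?S = "chart_inv G \<one> ` cball o1 \<rho>"
    have sub: "cball o1 \<rho> \<subseteq> chart_img G \<one>" using r \<rho> by auto
    have "compact ?S"
      using chart_systemD(5)[OF cs] sub by (intro compact_continuous_image) (auto intro: continuous_on_subset)
    then have "closed ?S" by (rule compact_imp_closed)
    moreover have "(\<gamma> \<longlongrightarrow> \<gamma> t1) (at_left t1)"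
      using \<gamma>c[of t1] unfolding isCont_def by (rule tendsto_mono[rotated]) (simp add: at_le)
    moreover have "\<forall>\<^sub>F s in at_left t1. \<gamma> s \<in> ?S"
    proof -
      have "\<gamma> s \<in> ?S" if s: "s \<in> {0<..<t1}" for s
      proof -
        have "norm (x s - o1) \<le> \<rho>" by (rule bound) (use s t1' before in auto)
        then have "x s \<in> cball o1 \<rho>" by (simp add: dist_norm norm_minus_commute)
        moreover have "\<gamma> s = chart_inv G \<one> (x s)"
          using before[of s] s by (simp add: x_def chart_inv_coord[OF cs] W_def)
        ultimately show ?thesis by blast
      qed
      moreover have "\<forall>\<^sub>F s in at_left t1. s \<in> {0<..<t1}"
        using eventually_at_left_real[OF \<open>t1 > 0\<close>] .
      ultimately show ?thesis by (auto elim: eventually_mono)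
    qed
    ultimately have "\<gamma> t1 \<in> ?S" by (intro Lim_in_closed_set) auto
    then have "\<gamma> t1 \<in> W" unfolding W_def
      using sub coord_chart_inv[OF cs] \<rho> by auto
    then show False using t1' by blast
  qed
  show "\<gamma> 1 \<in> chart_dom G \<one>" using inW[of 1] by (simp add: W_def)
  show "norm (coord G \<one> (\<gamma> 1) - o1) \<le> (1 + \<epsilon>) * a"
    using bound[of 1] inW by (simp add: x_def \<rho>_def)
  \<comment> \<open>The mean value inequality is applied to \<open>x\<close> minus the running
    integral of \<open>A\<close>, whose speed is only \<open>\<epsilon> * a\<close>; this smallness
    later becomes the remainder of a derivative.\<close>
  have "norm ((x 1 - integral {0..1} A) - (x 0 - integral {0..0} A)) \<le> \<epsilon> * a * norm (1 - 0 :: real)"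
  proof (rule differentiable_bound[where S="{0..1}" and f'="\<lambda>s h. h *\<^sub>R (V (x s) (A s) - A s)" and f="\<lambda>t. x t - integral {0..t} A"])
    show "((\<lambda>t. x t - integral {0..t} A) has_derivative (\<lambda>h. h *\<^sub>R (V (x s) (A s) - A s))) (at s within {0..1})"
      if s: "s \<in> {0..1}" for s
      using has_vector_derivative_diff[OF has_vector_derivative_at_within[OF dx[OF inW[OF s]]]
          integral_has_vector_derivative[OF A(1) s]]
      by (simp add: has_vector_derivative_def)
    show "onorm (\<lambda>h. h *\<^sub>R (V (x s) (A s) - A s)) \<le> \<epsilon> * a" if "s \<in> {0..1}" for s
      using mult_left_mono[OF nV(2)[OF inW[OF that] that] abs_ge_zero] by (intro onorm_le) (auto simp: mult.commute[of "\<epsilon> * a"])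
  qed auto
  then show "norm (coord G \<one> (\<gamma> 1) - o1 - integral {0..1} A) \<le> \<epsilon> * a"
    by (simp add: x0) (simp add: x_def diff_diff_eq add.commute)
qed

text \<open>At the identity the map from \<open>\<zeta>\<close> to the chart expression of its field
  is the identity, and \<open>S\<close> controls the deviation nearby through finitely many
  continuous terms. This supplies the ball used by \<open>small_curve_estimate\<close>.\<close>

lemma vf_rep_lvf_near_one:
  assumes "\<epsilon> > 0"
  shows "\<exists>r>0. cball (coord G \<one> \<one>) r \<subseteq> chart_img G \<one> \<and>
    (\<forall>x\<in>cball (coord G \<one> \<one>) r. \<forall>\<zeta>. norm (vf_rep G (lvf \<zeta>) \<one> x - \<zeta>) \<le> \<epsilon> * norm \<zeta>)"
proof -
  let ?o = "coord G \<one> \<one>" and ?V = "\<lambda>x \<zeta>. vf_rep G (lvf \<zeta>) \<one> x"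
  have Vo: "?V ?o \<zeta> = \<zeta>" for \<zeta>
    using has_mderiv_tangent_map[OF has_mderiv_coord_self[OF cs, of \<one>]] has_mderiv_tangent_map[OF has_mderiv_coord[OF sm cD, of \<one>]]
    by (simp add: vf_rep_def Let_def coord_self[OF cs] lvf_one)
  have lin: "linear (?V x)" if x: "x \<in> chart_img G \<one>" for x
    using linear_compose[OF linear_lvf has_mderiv_linear[OF has_mderiv_coord[OF sm coord_chart_inv(2)[OF cs x]]]]
    by (simp add: vf_rep_def Let_def o_def)
  define S where "S x = (\<Sum>b\<in>Basis. norm (?V x b - b))" for x
  have "isCont (\<lambda>x. ?V x b) ?o" for b
    using Ck_near_imp_isCont[OF Ck_near_lvf[OF Ck_at_chart_inv[OF sm coord_self(2)[OF cs]] _ Ck_near_const, of \<one> \<one> 0 b]] coord_self[OF cs] cD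
    by (simp add: vf_rep_def Let_def)
  then have "isCont S ?o" unfolding S_def by (intro continuous_intros)
  moreover have "S ?o = 0" by (simp add: S_def Vo)
  ultimately have "\<forall>\<^sub>F x in nhds ?o. S x < \<epsilon>"
    by (intro isCont_eventually_nhds[of _ S "\<lambda>s. s < \<epsilon>"]) (use assms in \<open>auto intro: eventually_nhds_in_open[of "{..<\<epsilon>}", simplified]\<close>)
  then have "\<forall>\<^sub>F x in nhds ?o. x \<in> chart_img G \<one> \<and> S x < \<epsilon>"
    using eventually_chart_img[OF cs cD, of \<one>] by eventually_elim auto
  then obtain U where U: "open U" "?o \<in> U" "\<And>x. x \<in> U \<Longrightarrow> x \<in> chart_img G \<one> \<and> S x < \<epsilon>"
    unfolding eventually_nhds by blast
  then obtain r where r: "r > 0" "cball ?o r \<subseteq> U" using open_contains_cball by blast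
  have "norm (?V x \<zeta> - \<zeta>) \<le> \<epsilon> * norm \<zeta>" if x: "x \<in> cball ?o r" for x \<zeta>
  proof -
    have xU: "x \<in> U" using x r by blast
    have "linear (\<lambda>\<zeta>. ?V x \<zeta> - \<zeta>)" using lin U(3)[OF xU] by (intro linear_compose_sub) (auto simp: linear_id[unfolded id_def])
    then have "norm (?V x \<zeta> - \<zeta>) = norm (\<Sum>b\<in>Basis. (\<zeta> \<bullet> b) *\<^sub>R (?V x b - b))"
      using linear_expand by (metis (no_types, lifting) sum.cong)
    also have "\<dots> \<le> (\<Sum>b\<in>Basis. norm \<zeta> * norm (?V x b - b))"
      by (rule sum_norm_le) (simp add: Basis_le_norm mult_right_mono)
    also have "\<dots> = S x * norm \<zeta>" by (simp add: S_def sum_distrib_left mult.commute)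
    also have "\<dots> \<le> \<epsilon> * norm \<zeta>" using U(3)[OF xU] by (intro mult_right_mono) auto
    finally show ?thesis .
  qed
  then show ?thesis using r U(3) by blast
qed

lemma continuous_Ad_Exp_line: "continuous_on A (\<lambda>t. Adj (Exp (t *\<^sub>R \<nu>)) v)"
  using Ck_near_imp_isCont[OF Ck_at_Ad[OF csE smooth_integral_curve[OF has_lderiv_Exp_line], simplified]]
  by (intro continuous_at_imp_continuous_on) blast

text \<open>For small \<open>v\<close> the curve \<open>\<gamma> v\<close> remains in the chart at
  the identity for all times in \<open>{0..1}\<close>, wherever \<open>Exp \<nu>\<close> lies. Its
  endpoint differs from the integral of its logarithmic derivative by an arbitrarily small multiple
  of \<open>norm v\<close>, which is differentiability at 0.\<close>

lemma has_mderiv_Exp_quotient: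
  "has_mderiv \<E> G (\<lambda>v. Exp (\<nu> + v) \<odot> ivs (Exp \<nu>)) 0 (\<lambda>v. integral {0..1} (\<lambda>t. Adj (Exp (t *\<^sub>R \<nu>)) v))"
proof -
  let ?o = "coord G \<one> \<one>"
  let ?A = "\<lambda>v t. Adj (Exp (t *\<^sub>R \<nu>)) v"
  define \<gamma> where "\<gamma> v t = Exp (t *\<^sub>R (\<nu> + v)) \<odot> ivs (Exp (t *\<^sub>R \<nu>))" for v t
  have \<gamma>: "has_lderiv \<E> (\<gamma> v) t (\<lambda>s. s *\<^sub>R ?A v t)" for v t
    unfolding \<gamma>_def
    using has_lderiv_mult[OF csE has_lderiv_Exp_line[of "\<nu> + v" t] has_lderiv_ivs[OF csE has_lderiv_Exp_line[of \<nu> t]]]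
    by (simp add: linear_scale[OF linear_Ad] linear_add[OF linear_Ad] scaleR_add_right)
  have Ac: "continuous_on {0..1} (?A v)" for v by (rule continuous_Ad_Exp_line)
  have "\<exists>k. \<forall>t\<in>{0..1}. norm (?A b t) \<le> k" for b
    using compact_continuous_image[OF Ac compact_Icc, THEN compact_imp_bounded] by (auto simp: bounded_iff)
  then obtain k where k: "\<And>b t. t \<in> {0..1} \<Longrightarrow> norm (?A b t) \<le> k b" by metis
  \<comment> \<open>A bound for \<open>Ad\<close> along the whole ray, uniform in \<open>t\<close>;
    the summand 1 permits the division by \<open>K\<close> below.\<close>
  define K where "K = 1 + (\<Sum>b\<in>Basis. \<bar>k b\<bar>)"
  have K1: "K \<ge> 1" by (simp add: K_def sum_nonneg)
  have AK: "norm (?A v t) \<le> K * norm v" if t: "t \<in> {0..1}" for v t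
  proof -
    have "norm (?A v t) = norm (\<Sum>b\<in>Basis. (v \<bullet> b) *\<^sub>R ?A b t)" using linear_expand[OF linear_Ad] by metis
    also have "\<dots> \<le> (\<Sum>b\<in>Basis. norm v * \<bar>k b\<bar>)"
      by (rule sum_norm_le) (use k[OF t] in \<open>auto intro!: mult_mono Basis_le_norm intro: order_trans[OF _ abs_ge_self]\<close>)
    also have "\<dots> = (\<Sum>b\<in>Basis. \<bar>k b\<bar>) * norm v" by (simp add: sum_distrib_left mult.commute)
    also have "\<dots> \<le> K * norm v" by (intro mult_right_mono) (auto simp: K_def)
    finally show ?thesis .
  qed
  have \<gamma>0: "\<gamma> v 0 = \<one>" for v by (simp add: \<gamma>_def)
  have est: "\<exists>d>0. \<forall>v. norm v < d \<longrightarrow> \<gamma> v 1 \<in> chart_dom G \<one> \<and>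
      norm (coord G \<one> (\<gamma> v 1) - ?o - integral {0..1} (?A v)) \<le> e * norm v" if e: "e > 0" for e
  proof -
    define \<epsilon> where "\<epsilon> = e / K"
    have \<epsilon>: "\<epsilon> > 0" using e K1 by (simp add: \<epsilon>_def)
    from vf_rep_lvf_near_one[OF this] obtain r where r: "r > 0" "cball ?o r \<subseteq> chart_img G \<one>"
      "\<And>x \<zeta>. x \<in> cball ?o r \<Longrightarrow> norm (vf_rep G (lvf \<zeta>) \<one> x - \<zeta>) \<le> \<epsilon> * norm \<zeta>" by blast
    \<comment> \<open>Chosen so that the assumption \<open>small\<close> of
      \<open>small_curve_estimate\<close> holds with \<open>a = K * norm v\<close>.\<close>
    define d where "d = r / ((1 + \<epsilon>) * K)"
    have pos: "(1 + \<epsilon>) * K > 0" using \<epsilon> K1 by simp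
    have "d > 0" using r pos by (simp add: d_def)
    moreover have "\<gamma> v 1 \<in> chart_dom G \<one> \<and>
      norm (coord G \<one> (\<gamma> v 1) - ?o - integral {0..1} (?A v)) \<le> e * norm v" if v: "norm v < d" for v
    proof -
      have "(1 + \<epsilon>) * (K * norm v) < r" using v pos by (simp add: d_def pos_less_divide_eq mult_ac)
      note est = small_curve_estimate[OF \<gamma> \<gamma>0 Ac AK r this less_imp_le[OF \<epsilon>]]
      have "\<epsilon> * (K * norm v) = e * norm v" using K1 by (simp add: \<epsilon>_def)
      then show ?thesis using est(1,3) by metis
    qed
    ultimately show ?thesis by blast
  qed
  have intA: "?A v integrable_on {0..1}" for v by (rule integrable_continuous_real[OF Ac])
  have lin: "linear (\<lambda>v. integral {0..1} (?A v))"
    by (rule linearI) (simp_all add: linear_add[OF linear_Ad] linear_scale[OF linear_Ad] integral_add[OF intA intA])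
  have d: "((\<lambda>v. coord G \<one> (\<gamma> v 1)) has_derivative (\<lambda>v. integral {0..1} (?A v))) (at 0)"
    unfolding has_derivative_at_alt
  proof (intro conjI allI impI)
    show "bounded_linear (\<lambda>v. integral {0..1} (?A v))" using lin by (simp add: linear_conv_bounded_linear)
    fix e :: real assume "e > 0"
    from est[OF this] obtain d where "d > 0" and d: "\<And>v. norm v < d \<Longrightarrow>
      norm (coord G \<one> (\<gamma> v 1) - ?o - integral {0..1} (?A v)) \<le> e * norm v" by blast
    moreover have "\<gamma> 0 1 = \<one>" by (simp add: \<gamma>_def)
    ultimately show "\<exists>d>0. \<forall>y. norm (y - 0) < d \<longrightarrow>
        norm (coord G \<one> (\<gamma> y 1) - coord G \<one> (\<gamma> 0 1) - integral {0..1} (?A (y - 0))) \<le> e * norm (y - 0)"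
      by auto
  qed
  have \<gamma>01: "\<gamma> 0 1 = \<one>" by (simp add: \<gamma>_def)
  have "isCont (\<lambda>v. chart_inv G \<one> (coord G \<one> (\<gamma> v 1))) 0"
    by (rule isCont_o2[OF has_derivative_continuous[OF d]]) (simp add: \<gamma>01 isCont_chart_inv[OF cs] coord_self[OF cs])
  moreover have "\<forall>\<^sub>F v in nhds 0. chart_inv G \<one> (coord G \<one> (\<gamma> v 1)) = \<gamma> v 1"
  proof -
    obtain d where "d > 0" "\<And>v. norm v < d \<Longrightarrow> \<gamma> v 1 \<in> chart_dom G \<one>" using est[of 1] by auto
    then show ?thesis using eventually_nhds_in_open[of "ball 0 d" 0]
      by (auto elim!: eventually_mono simp: chart_inv_coord[OF cs])
  qed
  note isCont_cong[OF this]
  ultimately have "isCont (\<lambda>v. \<gamma> v 1) 0" by simp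
  then show ?thesis using d \<gamma>01 by (simp add: has_mderiv_def \<gamma>_def)
qed

text \<open>The operator known as \<open>(1 - exp (- ad \<nu>)) / ad \<nu>\<close>. The shift
  \<open>t - 1\<close> appears when the inverse of \<open>Exp \<nu>\<close> is moved under the
  integral of the quotient formula.\<close>

definition dexp :: "'a \<Rightarrow> 'a \<Rightarrow> 'a" where
  "dexp \<nu> v = integral {0..1} (\<lambda>t. Adj (Exp ((t - 1) *\<^sub>R \<nu>)) v)"

lemma has_lderiv_Exp: "has_lderiv \<E> Exp \<nu> (dexp \<nu>)"
proof -
  let ?h = "\<lambda>v. Exp (\<nu> + v) \<odot> ivs (Exp \<nu>)"
  have "has_lderiv \<E> ?h 0 (\<lambda>v. integral {0..1} (\<lambda>t. Adj (Exp (t *\<^sub>R \<nu>)) v))"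
    using has_mderiv_Exp_quotient[of \<nu>] by (simp add: has_lderiv_def)
  then have "has_lderiv \<E> (\<lambda>\<mu>. ?h (\<mu> - \<nu>)) \<nu> (\<lambda>v. integral {0..1} (\<lambda>t. Adj (Exp (t *\<^sub>R \<nu>)) v))"
    by (intro has_lderiv_compose[OF csE csE, where H="\<lambda>s. s" and f="?h" and h="\<lambda>\<mu>. \<mu> - \<nu>"])
      (simp_all only: has_mderiv_euclidean diff_self, auto intro!: derivative_eq_intros)
  from has_lderiv_mult[OF csE this has_lderiv_const[of _ "Exp \<nu>"]]
  have "has_lderiv \<E> Exp \<nu> (\<lambda>v. Adj (ivs (Exp \<nu>)) (integral {0..1} (\<lambda>t. Adj (Exp (t *\<^sub>R \<nu>)) v)))" by simp
  moreover have "Adj (ivs (Exp \<nu>)) (integral {0..1} (\<lambda>t. Adj (Exp (t *\<^sub>R \<nu>)) v)) = dexp \<nu> v" for v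
  proof -
    have "Adj (ivs (Exp \<nu>)) (integral {0..1} (\<lambda>t. Adj (Exp (t *\<^sub>R \<nu>)) v)) =
        integral {0..1} (\<lambda>t. Adj (ivs (Exp \<nu>)) (Adj (Exp (t *\<^sub>R \<nu>)) v))"
      using integral_linear[OF integrable_continuous_real[OF continuous_Ad_Exp_line], of "Adj (ivs (Exp \<nu>))" 0 1 \<nu> v] linear_Ad
      by (simp add: o_def linear_conv_bounded_linear)
    moreover have "ivs (Exp \<nu>) \<odot> Exp (t *\<^sub>R \<nu>) = Exp ((t - 1) *\<^sub>R \<nu>)" for t
      using Exp_add[of "-1" t \<nu>] by (simp add: ivs_Exp)
    ultimately show ?thesis by (simp add: dexp_def Ad_mul[symmetric])
  qed
  ultimately show ?thesis by (simp add: fun_eq_iff[symmetric])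
qed

lemma smooth_Exp: "Ck_at k \<E> G Exp \<nu>"
\<comment> \<open>The formula for the differential at \<open>\<nu>\<close> involves
  \<open>Exp\<close> on the whole segment from \<open>- \<nu>\<close> to 0, so the induction has to
  run over all base points at once.\<close>
proof (induction k arbitrary: \<nu>)
  case 0 then show ?case using Ck_at_0 has_lderiv_isCont[OF csE has_lderiv_Exp] by blast
next
  case (Suc k)
  have "Ck_near k (\<lambda>p. (snd p - 1) *\<^sub>R fst p) p" for p :: "'a \<times> real"
    by (intro Ck_near_scaleR Ck_near_fst) (simp only: diff_conv_add_uminus, intro Ck_near_add Ck_near_snd Ck_near_const)
  then have "Ck_at k \<E> \<E> (\<lambda>p. Adj (Exp ((snd p - 1) *\<^sub>R fst p)) v) p" for v and p :: "'a \<times> real"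
    by (intro Ck_at_Ad[OF csE Ck_at_compose[OF csE csE _ Suc]]) simp
  then have "Ck_near k (\<lambda>\<nu>. dexp \<nu> v) \<nu>" for v \<nu>
    unfolding dexp_def by (intro Ck_near_integral_param) simp
  then show ?case
    by (intro Ck_at_Suc_of_ltriv[where \<tau>=dexp] Suc) (simp_all add: has_lderiv_Exp)
qed

lemma smooth_dexp: "Ck_near k (\<lambda>\<nu>. dexp \<nu> v) \<nu>"
proof -
  have "(\<lambda>\<nu>. \<theta> (Exp \<nu>) (tangent_map \<E> G Exp \<nu> v)) = (\<lambda>\<nu>. dexp \<nu> v)"
    using has_lderiv_left_mc[OF csE has_lderiv_Exp] by auto
  then show ?thesis using Ck_near_ltriv[OF smooth_Exp Ck_near_const, of k v \<nu>] by simp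
qed

end

section \<open>The Cartan 3-form and its primitive\<close>

lemma nths_singleton_index: "i < length vs \<Longrightarrow> nths vs {i} = [vs ! i]"
proof (induction vs arbitrary: i)
  case (Cons v vs)
  show ?case
  proof (cases i)
    case (Suc j)
    have "{j. Suc j \<in> {i}} = {j}" "0 \<notin> {i}" using Suc by auto
    then show ?thesis using Cons Suc by (simp add: nths_Cons)
  qed (simp add: nths_Cons)
qed simp

lemma nths_delete_index: "i < length vs \<Longrightarrow> nths vs (- {i}) = take i vs @ drop (Suc i) vs"
proof (induction vs arbitrary: i)
  case (Cons v vs)
  show ?case
  proof (cases i)
    case 0
    have "{j. Suc j \<in> - {i}} = UNIV" using 0 by auto
    then show ?thesis using 0 by (simp add: nths_Cons nths_all)
  next
    case (Suc j)
    have "{j. Suc j \<in> - {i}} = - {j}" "0 \<in> - {i}" using Suc by auto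
    then show ?thesis using Cons Suc by (simp add: nths_Cons)
  qed
qed simp

text \<open>A one-form vanishes on lists of length other than 1, so only the singletons among the
  subsets contribute; the sign of \<open>{i}\<close> counts the \<open>i\<close> positions before
  it.\<close>

lemma wedge_via_one_form:
  assumes b: "\<And>y. b 0 y = 0"
  shows "wedge_via b (one_form \<alpha>) \<phi> p vs =
    (\<Sum>i<length vs. (- 1) ^ i *\<^sub>R b (\<alpha> p (vs ! i)) (\<phi> p (take i vs @ drop (Suc i) vs)))"
proof -
  let ?n = "length vs"
  let ?f = "\<lambda>S. (- 1) ^ card {(i, j). i \<in> S \<and> j \<in> {..<?n} - S \<and> j < i} *\<^sub>R
        b (one_form \<alpha> p (nths vs S)) (\<phi> p (nths vs (- S)))"
  have zero: "?f S = 0" if S: "S \<in> Pow {..<?n} - (\<lambda>i. {i}) ` {..<?n}" for S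
  proof -
    have "{i. i < ?n \<and> i \<in> S} = S" "finite S" using S by (auto intro: finite_subset)
    moreover have "card S \<noteq> 1" using S by (auto simp: card_1_singleton_iff)
    ultimately have "length (nths vs S) \<noteq> 1" by (simp add: length_nths)
    then have "one_form \<alpha> p (nths vs S) = 0" by (auto simp: one_form_def split: list.split)
    then show ?thesis by (simp add: b)
  qed
  have "wedge_via b (one_form \<alpha>) \<phi> p vs = sum ?f (Pow {..<?n})" by (simp add: wedge_via_def)
  also have "\<dots> = sum ?f ((\<lambda>i. {i}) ` {..<?n})"
    by (rule sum.mono_neutral_right) (use zero in auto)
  also have "\<dots> = (\<Sum>i<?n. ?f {i})" by (subst sum.reindex) (auto simp: inj_on_def)
  also have "\<dots> = (\<Sum>i<?n. (- 1) ^ i *\<^sub>R b (\<alpha> p (vs ! i)) (\<phi> p (take i vs @ drop (Suc i) vs)))"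
  proof (rule sum.cong[OF refl])
    fix i assume "i \<in> {..<?n}"
    then have i: "i < ?n" by simp
    have "{(i', j). i' \<in> {i} \<and> j \<in> {..<?n} - {i} \<and> j < i'} = Pair i ` {..<i}" using i by auto
    then have "card {(i', j). i' \<in> {i} \<and> j \<in> {..<?n} - {i} \<and> j < i'} = i" by (simp add: card_image inj_on_def)
    then show "?f {i} = (- 1) ^ i *\<^sub>R b (\<alpha> p (vs ! i)) (\<phi> p (take i vs @ drop (Suc i) vs))"
      using i by (simp add: nths_singleton_index nths_delete_index one_form_def)
  qed
  finally show ?thesis .
qed

lemma wedge_degree_gt:
  assumes "has_degree \<eta> k" "length vs < k"
  shows "wedge \<eta> \<phi> p vs = 0"
  unfolding wedge_via_def
proof (rule sum.neutral, intro ballI)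
  fix S assume "S \<in> Pow {..<length vs}"
  have "{i. i < length vs \<and> i \<in> S} \<subseteq> {..<length vs}" by auto
  then have "length (nths vs S) \<noteq> k"
    using assms(2) card_mono[of "{..<length vs}" "{i. i < length vs \<and> i \<in> S}"] by (simp add: length_nths)
  then show "(- 1) ^ card {(i, j). i \<in> S \<and> j \<in> {..<length vs} - S \<and> j < i} *\<^sub>R (\<eta> p (nths vs S) * \<phi> p (nths vs (- S))) = 0"
    using assms(1) by (simp add: has_degree_def)
qed

lemma wedge_degree_eq:
  assumes \<eta>: "has_degree \<eta> k" and k: "length vs = k"
  shows "wedge \<eta> \<phi> p vs = \<eta> p vs * \<phi> p []"
proof -
  let ?f = "\<lambda>S. (- 1) ^ card {(i, j). i \<in> S \<and> j \<in> {..<length vs} - S \<and> j < i} *\<^sub>R (\<eta> p (nths vs S) * \<phi> p (nths vs (- S)))"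
  have zero: "?f S = 0" if S: "S \<in> Pow {..<length vs} - {{..<length vs}}" for S
  proof -
    have "{i. i < length vs \<and> i \<in> S} = S" "S \<subset> {..<length vs}" using S by auto
    then have "length (nths vs S) < k" using psubset_card_mono[of "{..<length vs}" S] k by (simp add: length_nths)
    then show ?thesis using \<eta> by (simp add: has_degree_def)
  qed
  have "wedge \<eta> \<phi> p vs = sum ?f (Pow {..<length vs})" by (simp add: wedge_via_def)
  also have "\<dots> = sum ?f {{..<length vs}}"
    by (rule sum.mono_neutral_right) (use zero in auto)
  also have "\<dots> = \<eta> p vs * \<phi> p []"
  proof -
    have "{(i, j). i < length vs \<and> j \<in> {..<length vs} - {..<length vs} \<and> j < i} = {}" by auto
    moreover have "length (nths vs (- {..<length vs})) = 0" by (simp add: length_nths)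
    ultimately show ?thesis by (simp add: nths_all)
  qed
  finally show ?thesis .
qed

section \<open>The Cartan form as an alternating trilinear map\<close>

context lie_grp_form begin

text \<open>The factor is 6/12: the inner wedge yields twice the bracket, and the outer one adds
  three terms that are equal by invariance of \<open>B\<close>.\<close>

definition cartan3 :: "'a \<Rightarrow> 'a \<Rightarrow> 'a \<Rightarrow> real" where
  "cartan3 x y z = 1 / 2 * B x \<lbrakk>y, z\<rbrakk>"

lemma cartan_form_eq:
  "cartan_form G B g vs = (case vs of [a, b, c] \<Rightarrow> cartan3 (\<theta> g a) (\<theta> g b) (\<theta> g c) | _ \<Rightarrow> 0)"
proof -
  have inner: "wedge_via (lie_bracket G) (one_form \<theta>) (one_form \<theta>) g us =
      (case us of [a, b] \<Rightarrow> 2 *\<^sub>R \<lbrakk>\<theta> g a, \<theta> g b\<rbrakk> | _ \<Rightarrow> 0)" for us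
  proof (cases "length us = 2")
    case True
    then obtain a b where us: "us = [a, b]" by (auto simp: length_Suc_conv numeral_2_eq_2)
    have "wedge_via (lie_bracket G) (one_form \<theta>) (one_form \<theta>) g us = \<lbrakk>\<theta> g a, \<theta> g b\<rbrakk> - \<lbrakk>\<theta> g b, \<theta> g a\<rbrakk>"
      unfolding us by (subst wedge_via_one_form) (simp_all add: brk_simps one_form_def numeral_2_eq_2)
    then show ?thesis using lie_bracket_antisym[of "\<theta> g b"] by (simp add: us scaleR_2)
  next
    case False
    have "one_form \<theta> g (take i us @ drop (Suc i) us) = 0" if "i < length us" for i
      using that False by (auto simp: one_form_def split: list.split dest!: arg_cong[of _ _ length])
    then show ?thesis using False
      by (subst wedge_via_one_form) (auto simp: brk_simps split: list.split)
  qed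
  show ?thesis
  proof (cases "length vs = 3")
    case True
    then obtain a b c where vs: "vs = [a, b, c]" by (auto simp: length_Suc_conv numeral_3_eq_3)
    have "wedge_via B (one_form \<theta>) (wedge_via (lie_bracket G) (one_form \<theta>) (one_form \<theta>)) g vs =
      2 * B (\<theta> g a) \<lbrakk>\<theta> g b, \<theta> g c\<rbrakk> - 2 * B (\<theta> g b) \<lbrakk>\<theta> g a, \<theta> g c\<rbrakk> + 2 * B (\<theta> g c) \<lbrakk>\<theta> g a, \<theta> g b\<rbrakk>"
      unfolding vs by (subst wedge_via_one_form) (simp_all add: B_simps inner numeral_3_eq_3)
    also have "\<dots> = 6 * B (\<theta> g a) \<lbrakk>\<theta> g b, \<theta> g c\<rbrakk>"
      using B_cyclic[of "\<theta> g c" "\<theta> g a" "\<theta> g b"] B_cyclic[of "\<theta> g b" "\<theta> g c" "\<theta> g a"]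
        lie_bracket_antisym[of "\<theta> g a" "\<theta> g c"] by (simp add: B_simps)
    finally show ?thesis by (simp add: cartan_form_def vs cartan3_def)
  next
    case False
    have "(case take i vs @ drop (Suc i) vs of [a, b] \<Rightarrow> 2 *\<^sub>R \<lbrakk>\<theta> g a, \<theta> g b\<rbrakk> | _ \<Rightarrow> 0) = 0" if "i < length vs" for i
      using that False by (auto split: list.split dest!: arg_cong[of _ _ length])
    then show ?thesis using False
      unfolding cartan_form_def by (subst wedge_via_one_form) (auto simp: B_simps inner split: list.split)
  qed
qed

lemma cartan3_swap: "cartan3 x y z = - cartan3 y x z" "cartan3 x y z = - cartan3 x z y"
  and cartan3_cyclic: "cartan3 x y z = cartan3 y z x"
proof -
  show c: "cartan3 x y z = cartan3 y z x" for x y z by (simp add: cartan3_def B_cyclic[of x])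
  show s: "cartan3 x y z = - cartan3 x z y" for x y z
    using lie_bracket_antisym[of y z] by (simp add: cartan3_def B_simps)
  show "cartan3 x y z = - cartan3 y x z" using c[of x y z] s[of y z x] by simp
qed

lemmas cartan3_simps = cartan3_def B_simps brk_simps

lemma cartan3_linear:
  "linear (\<lambda>x. cartan3 x y z)" "linear (\<lambda>y. cartan3 x y z)" "linear (\<lambda>z. cartan3 x y z)"
  by (auto intro!: linearI simp: cartan3_simps algebra_simps)

lemma cartan3_has_derivative:
  assumes "(f has_derivative f') (at x within S)" "(g has_derivative g') (at x within S)"
    "(h has_derivative h') (at x within S)"
  shows "((\<lambda>x. cartan3 (f x) (g x) (h x)) has_derivative
    (\<lambda>u. cartan3 (f' u) (g x) (h x) + cartan3 (f x) (g' u) (h x) + cartan3 (f x) (g x) (h' u))) (at x within S)"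
  unfolding cartan3_def
  by (rule has_derivative_eq_rhs[OF has_derivative_mult_right[OF bounded_bilinear.FDERIV[OF bounded_bilinear_B assms(1)
       bounded_bilinear.FDERIV[OF bounded_bilinear_lie_bracket assms(2,3)]]]])
    (auto simp: B_simps algebra_simps)

lemma Ck_near_cartan3:
  "Ck_near k f x \<Longrightarrow> Ck_near k g x \<Longrightarrow> Ck_near k h x \<Longrightarrow> Ck_near k (\<lambda>x. cartan3 (f x) (g x) (h x)) x"
  unfolding cartan3_def
  by (intro Ck_near_bilinear[OF bounded_bilinear_mult Ck_near_const] Ck_near_bilinear[OF bounded_bilinear_B]
      Ck_near_bilinear[OF bounded_bilinear_lie_bracket])

text \<open>
  The algebra behind the closedness of the Cartan form: \<open>\<delta> i j\<close> is the derivative of \<open>\<tau>\<close> on the \<open>i\<close>-th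
  vector in the direction of the \<open>j\<close>-th.
\<close>

lemma cartan3_closed:
  assumes mc: "\<And>i j. \<delta> i j - \<delta> j i = - \<lbrakk>t j, t i\<rbrakk>"
  defines "D \<equiv> \<lambda>j a b c. cartan3 (\<delta> a j) (t b) (t c) + cartan3 (t a) (\<delta> b j) (t c) + cartan3 (t a) (t b) (\<delta> c j)"
  shows "D i j k l - D j i k l + D k i j l - D l i j k = 0"
proof -
  \<comment> \<open>Once every derivative stands in the first slot and its indices are ordered by
    \<open>mc\<close>, the derivatives cancel in pairs and six terms with brackets remain.\<close>
  have e: "\<delta> a b = \<delta> b a - \<lbrakk>t b, t a\<rbrakk>" for a b using mc[of a b] by (simp add: algebra_simps)
  have c1: "cartan3 (x - y) z w = cartan3 x z w - cartan3 y z w" for x y z w by (simp add: cartan3_simps algebra_simps)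
  have f2: "cartan3 x (\<delta> a b) z = - cartan3 (\<delta> a b) x z" for x z a b by (rule cartan3_swap(1))
  have f3: "cartan3 x y (\<delta> a b) = cartan3 (\<delta> a b) x y" for x y a b using cartan3_cyclic[of "\<delta> a b" x y] by simp
  have "D i j k l - D j i k l + D k i j l - D l i j k =
     - cartan3 \<lbrakk>t i, t j\<rbrakk> (t k) (t l) + cartan3 \<lbrakk>t i, t k\<rbrakk> (t j) (t l) - cartan3 \<lbrakk>t i, t l\<rbrakk> (t j) (t k)
     - cartan3 \<lbrakk>t j, t k\<rbrakk> (t i) (t l) + cartan3 \<lbrakk>t j, t l\<rbrakk> (t i) (t k) - cartan3 \<lbrakk>t k, t l\<rbrakk> (t i) (t j)"
    unfolding D_def f2 f3 e[of j i] e[of k i] e[of l i] e[of k j] e[of l j] e[of l k] c1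
    by simp
  also have "\<dots> = 0"
  proof -
    \<comment> \<open>Invariance isolates \<open>t i\<close>: the six terms become
      \<open>B (t i)\<close> of the Jacobi expression, each of whose three summands occurs twice
      with weight 1/2.\<close>
    have r: "cartan3 \<lbrakk>x, y\<rbrakk> z w = 1 / 2 * B x \<lbrakk>y, \<lbrakk>z, w\<rbrakk>\<rbrakk>" for x y z w
      using B_ad[of y x "\<lbrakk>z, w\<rbrakk>"] lie_bracket_antisym[of x y] by (simp add: cartan3_def B_simps)
    have s: "cartan3 \<lbrakk>y, z\<rbrakk> x w = 1 / 2 * B x \<lbrakk>w, \<lbrakk>y, z\<rbrakk>\<rbrakk>" for x y z w
      by (simp add: cartan3_def B_cyclic[of "\<lbrakk>y, z\<rbrakk>" x w])
    have j1: "\<lbrakk>t j, \<lbrakk>t k, t l\<rbrakk>\<rbrakk> - \<lbrakk>t k, \<lbrakk>t j, t l\<rbrakk>\<rbrakk> + \<lbrakk>t l, \<lbrakk>t j, t k\<rbrakk>\<rbrakk> = 0"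
      using jacobi[of "t j" "t k" "t l"] lie_bracket_antisym[of "\<lbrakk>t j, t k\<rbrakk>" "t l"] by simp
    have "B (t i) (\<lbrakk>t j, \<lbrakk>t k, t l\<rbrakk>\<rbrakk> - \<lbrakk>t k, \<lbrakk>t j, t l\<rbrakk>\<rbrakk> + \<lbrakk>t l, \<lbrakk>t j, t k\<rbrakk>\<rbrakk>) = 0" unfolding j1 by (simp add: B_simps)
    then show ?thesis unfolding r[of "t i"] s[of _ _ "t i"] by (simp add: B_simps)
  qed
  finally show ?thesis .
qed

end

lemma ext_deriv_degree:
  assumes "has_degree \<phi> k" "length vs \<noteq> Suc k"
  shows "ext_deriv M \<phi> p vs = (0 :: 'b::real_normed_vector)"
proof -
  have "form_rep M \<phi> p y (take i vs @ drop (Suc i) vs) = 0" if "i < length vs" for i y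
    using assms that by (simp add: form_rep_def Let_def has_degree_def)
  then have "(\<lambda>y. form_rep M \<phi> p y (take i vs @ drop (Suc i) vs)) = (\<lambda>y. 0)" if "i < length vs" for i
    using that by simp
  then show ?thesis unfolding ext_deriv_def by (intro sum.neutral) simp
qed

definition form3 :: "('a \<Rightarrow> 'a \<Rightarrow> 'a \<Rightarrow> real) \<Rightarrow> 'a list \<Rightarrow> real" where
  "form3 C vs = (case vs of [a, b, c] \<Rightarrow> C a b c | _ \<Rightarrow> 0)"

definition form2 :: "('a \<Rightarrow> 'a \<Rightarrow> real) \<Rightarrow> 'a list \<Rightarrow> real" where
  "form2 C vs = (case vs of [a, b] \<Rightarrow> C a b | _ \<Rightarrow> 0)"

lemma form3_simps [simp]: "form3 C [a, b, c] = C a b c" "length vs \<noteq> 3 \<Longrightarrow> form3 C vs = 0"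
  by (auto simp: form3_def split: list.split)

lemma form2_simps [simp]: "form2 C [a, b] = C a b" "length vs \<noteq> 2 \<Longrightarrow> form2 C vs = 0"
  by (auto simp: form2_def split: list.split)

lemma length3: "length vs = 3 \<longleftrightarrow> (\<exists>a b c. vs = [a, b, c])"
  by (auto simp: length_Suc_conv numeral_3_eq_3)

lemma length2: "length vs = 2 \<longleftrightarrow> (\<exists>a b. vs = [a, b])"
  by (auto simp: length_Suc_conv numeral_2_eq_2)

lemma linear_zero_fun: "linear (\<lambda>v. 0)" by (auto intro: linearI)

lemma alternating_form3:
  assumes "\<And>b c. linear (\<lambda>a. C a b c)" "\<And>a c. linear (\<lambda>b. C a b c)" "\<And>a b. linear (\<lambda>c. C a b c)"
    "\<And>a b. C a a b = 0" "\<And>a b. C a b a = 0" "\<And>a b. C b a a = 0"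
  shows "alternating (form3 C)"
  unfolding alternating_def
proof (intro conjI allI impI)
  fix xs ys :: "'a list"
  show "linear (\<lambda>v. form3 C (xs @ v # ys))"
  proof (cases "length xs + length ys = 2")
    case True
    then consider "length xs = 0" "length ys = 2" | "length xs = 1" "length ys = 1" | "length xs = 2" "length ys = 0" by linarith
    then show ?thesis by cases (auto simp: length2 length_Suc_conv assms)
  qed (simp add: linear_zero_fun)
next
  fix xs :: "'a list" assume "\<not> distinct xs"
  then show "form3 C xs = 0" using assms by (cases "length xs = 3") (auto simp: length3)
qed

lemma alternating_form2:
  assumes "\<And>b. linear (\<lambda>a. C a b)" "\<And>a. linear (\<lambda>b. C a b)" "\<And>a. C a a = 0"
  shows "alternating (form2 C)"
  unfolding alternating_def
proof (intro conjI allI impI)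
  fix xs ys :: "'a list"
  show "linear (\<lambda>v. form2 C (xs @ v # ys))"
  proof (cases "length xs + length ys = 1")
    case True
    then consider "length xs = 0" "length ys = 1" | "length xs = 1" "length ys = 0" by linarith
    then show ?thesis by cases (auto simp: length_Suc_conv assms)
  qed (simp add: linear_zero_fun)
next
  fix xs :: "'a list" assume "\<not> distinct xs"
  then show "form2 C xs = 0" using assms by (cases "length xs = 2") (auto simp: length2)
qed

lemma map_form3: "form3 C (map f vs) = form3 (\<lambda>a b c. C (f a) (f b) (f c)) vs"
  by (cases "length vs = 3") (auto simp: length3)

lemma smooth_on_iff_near: "open S \<Longrightarrow> smooth_on S f \<longleftrightarrow> (\<forall>k. \<forall>x\<in>S. Ck_near k f x)"
  by (simp add: smooth_on_def Ck_on_iff_near)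

lemma from_chart_euclidean [simp]: "from_chart \<E> q p v = v"
proof -
  have "coord \<E> p \<circ> chart_inv \<E> q = (\<lambda>x. x)" by auto
  then show ?thesis unfolding from_chart_def by (simp add: frechet_derivative_at[OF has_derivative_ident, symmetric])
qed

lemma to_chart_euclidean [simp]: "to_chart \<E> q p v = v"
proof -
  have "coord \<E> q \<circ> chart_inv \<E> p = (\<lambda>x. x)" by auto
  then show ?thesis unfolding to_chart_def by (simp add: frechet_derivative_at[OF has_derivative_ident, symmetric])
qed

lemma form_rep_euclidean [simp]: "form_rep \<E> \<phi> q y vs = \<phi> y vs"
  by (simp add: form_rep_def Let_def map_idI)

section \<open>The Maurer-Cartan form in charts and the second derivative of the exponential
  map\<close>

context lie_grp begin

lemma from_chart_tangent_map:
  "y \<in> chart_img G q \<Longrightarrow> from_chart G q (chart_inv G q y) = tangent_map \<E> G (chart_inv G q) y"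
  using has_mderiv_tangent_map[OF has_mderiv_chart_inv[OF sm]] by metis

text \<open>Since \<open>from_chart\<close> is the tangent map of the inverse chart, this is the
  trivialised differential of \<open>chart_inv G q\<close>, so \<open>Ck_near_ltriv\<close> and
  \<open>maurer_cartan\<close> apply to it.\<close>

definition mc_rep :: "'g \<Rightarrow> 'a \<Rightarrow> 'a \<Rightarrow> 'a" where
  "mc_rep q w y = \<theta> (chart_inv G q y) (from_chart G q (chart_inv G q y) w)"

lemma mc_rep_ev: "y \<in> chart_img G q \<Longrightarrow>
  \<forall>\<^sub>F z in nhds y. \<theta> (chart_inv G q z) (tangent_map \<E> G (chart_inv G q) z w) = mc_rep q w z"
proof (rule eventually_mono)
  show "y \<in> chart_img G q \<Longrightarrow> \<forall>\<^sub>F z in nhds y. z \<in> chart_img G q"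
    using eventually_nhds_in_open[OF chart_systemD(3)[OF cs]] .
  show "\<theta> (chart_inv G q z) (tangent_map \<E> G (chart_inv G q) z w) = mc_rep q w z" if z: "z \<in> chart_img G q" for z
    unfolding mc_rep_def from_chart_tangent_map[OF z] ..
qed

lemma Ck_near_mc_rep: "y \<in> chart_img G q \<Longrightarrow> Ck_near k (mc_rep q w) y"
  by (rule Ck_near_cong[OF Ck_near_ltriv[OF Ck_at_chart_inv[OF sm] Ck_near_const] mc_rep_ev])

lemma mc_rep_maurer_cartan:
  assumes y: "y \<in> chart_img G q"
  shows "frechet_derivative (mc_rep q w) (at y) v - frechet_derivative (mc_rep q v) (at y) w = - \<lbrakk>mc_rep q v y, mc_rep q w y\<rbrakk>"
proof -
  have "frechet_derivative (\<lambda>z. \<theta> (chart_inv G q z) (tangent_map \<E> G (chart_inv G q) z w)) (at y)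
      = frechet_derivative (mc_rep q w) (at y)" for w
    by (rule frechet_derivative_cong_ev[OF mc_rep_ev[OF y]])
  then show ?thesis
    using maurer_cartan[OF Ck_at_chart_inv[OF sm y], of w v] by (simp add: mc_rep_def from_chart_tangent_map[OF y])
qed

lemma linear_dexp: "linear (dexp \<nu>)"
  using has_lderiv_Exp has_mderiv_linear unfolding has_lderiv_def by blast

definition d2exp :: "'a \<Rightarrow> 'a \<Rightarrow> 'a \<Rightarrow> 'a" where
  "d2exp \<mu> w u = frechet_derivative (\<lambda>\<mu>. dexp \<mu> w) (at \<mu>) u"

lemma dexp_eq: "\<theta> (Exp \<mu>) (tangent_map \<E> G Exp \<mu> w) = dexp \<mu> w"
  by (rule has_lderiv_left_mc[OF csE has_lderiv_Exp])

lemma dexp_has_derivative: "((\<lambda>\<mu>. dexp \<mu> w) has_derivative d2exp \<mu> w) (at \<mu>)"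
  unfolding d2exp_def by (rule Ck_near_has_derivative[OF smooth_dexp])

lemma d2exp_maurer_cartan: "d2exp \<mu> w v - d2exp \<mu> v w = - \<lbrakk>dexp \<mu> v, dexp \<mu> w\<rbrakk>"
  using maurer_cartan[OF smooth_Exp, where ?x0.0=\<mu> and w=w and v=v] by (simp add: dexp_eq d2exp_def)

lemma Ck_near_d2exp: "Ck_near k (\<lambda>\<mu>. d2exp \<mu> w u) \<mu>"
  unfolding d2exp_def by (rule Ck_near_frechet[OF smooth_dexp])

lemma d2exp_expand: "d2exp \<mu> w u = (\<Sum>b\<in>Basis. (w \<bullet> b) *\<^sub>R d2exp \<mu> b u)"
proof -
  have "((\<lambda>\<mu>. \<Sum>b\<in>Basis. (w \<bullet> b) *\<^sub>R dexp \<mu> b) has_derivative (\<lambda>u. \<Sum>b\<in>Basis. (w \<bullet> b) *\<^sub>R d2exp \<mu> b u)) (at \<mu>)"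
    by (intro has_derivative_sum has_derivative_scaleR_right dexp_has_derivative)
  moreover have "(\<lambda>\<mu>. \<Sum>b\<in>Basis. (w \<bullet> b) *\<^sub>R dexp \<mu> b) = (\<lambda>\<mu>. dexp \<mu> w)"
    using linear_expand[OF linear_dexp] by metis
  ultimately have "(\<lambda>u. \<Sum>b\<in>Basis. (w \<bullet> b) *\<^sub>R d2exp \<mu> b u) = d2exp \<mu> w"
    by (intro has_derivative_unique[OF _ dexp_has_derivative]) simp
  then show ?thesis by metis
qed

text \<open>The derivative in \<open>t\<close> contains the bracket of \<open>\<nu>\<close> with
  itself.\<close>

lemma Ad_Exp_self: "Adj (Exp (t *\<^sub>R \<nu>)) \<nu> = \<nu>"
proof -
  have "((\<lambda>t. Adj (Exp (t *\<^sub>R \<nu>)) \<nu>) has_derivative (\<lambda>s. 0)) (at t within UNIV)" for t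
    using has_mderiv_Ad_of[OF csE has_lderiv_Exp_line[of \<nu> t], of \<nu>] linear_0[OF linear_Ad] by (simp add: brk_simps)
  from has_derivative_zero_constant[OF convex_UNIV this]
  obtain c where "\<And>t. Adj (Exp (t *\<^sub>R \<nu>)) \<nu> = c" by blast
  then show ?thesis by (metis Ad_one Exp_0 scaleR_zero_left)
qed

lemma dexp_self: "dexp (t *\<^sub>R \<nu>) \<nu> = \<nu>"
  using Ad_Exp_self[of "(s - 1) * t" \<nu> for s] by (simp add: dexp_def)

lemma Ad_Exp_has_vector_derivative:
  "((\<lambda>t. Adj (Exp (t *\<^sub>R \<nu>)) w) has_vector_derivative \<lbrakk>\<nu>, Adj (Exp (t *\<^sub>R \<nu>)) w\<rbrakk>) (at t)"
  using has_mderiv_Ad_of[OF csE has_lderiv_Exp_line[of \<nu> t], of w]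
  by (simp add: has_vector_derivative_def brk_simps linear_scale[OF linear_Ad] Ad_lie_bracket Ad_Exp_self)

end

section \<open>Closedness of the Cartan form, and the radial primitive\<close>

context lie_grp_form begin

lemma cartan_form_eq3: "cartan_form G B g = form3 (\<lambda>a b c. cartan3 (\<theta> g a) (\<theta> g b) (\<theta> g c))"
  by (auto simp: fun_eq_iff cartan_form_eq form3_def)

lemma cartan3_alt [simp]: "cartan3 x x y = 0" "cartan3 x y x = 0" "cartan3 y x x = 0"
  using cartan3_swap(1)[of x x y] cartan3_swap(2)[of y x x] cartan3_swap(2)[of x y x] cartan3_swap(1)[of x x y] by auto

lemma alternating_cartan3:
  assumes "linear L" shows "alternating (form3 (\<lambda>a b c. cartan3 (L a) (L b) (L c)))"
  by (rule alternating_form3)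
    (auto intro!: linear_compose[OF assms cartan3_linear(1), unfolded o_def]
      linear_compose[OF assms cartan3_linear(2), unfolded o_def] linear_compose[OF assms cartan3_linear(3), unfolded o_def])

lemma has_degree_cartan_form: "has_degree (cartan_form G B) 3"
  by (simp add: has_degree_def cartan_form_eq3)

lemma form_rep_cartan:
  "form_rep G (cartan_form G B) q y = form3 (\<lambda>a b c. cartan3 (mc_rep q a y) (mc_rep q b y) (mc_rep q c y))"
  by (auto simp: form_rep_def Let_def cartan_form_eq3 map_form3 mc_rep_def)

lemma smooth_cartan_form: "smooth_form G (cartan_form G B)"
  unfolding smooth_form_def
proof (intro conjI allI)
  show "alternating (cartan_form G B p)" for p
    unfolding cartan_form_eq3 by (rule alternating_cartan3[OF linear_left_mc])
  fix q vs
  show "smooth_on (chart_img G q) (\<lambda>y. form_rep G (cartan_form G B) q y vs)"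
    unfolding form_rep_cartan smooth_on_iff_near[OF chart_systemD(3)[OF cs]]
    by (cases "length vs = 3") (auto simp: length3 intro!: Ck_near_cartan3 Ck_near_mc_rep Ck_near_const)
qed

lemma ext_deriv_cartan_form: "ext_deriv G (cartan_form G B) p vs = 0"
proof (cases "length vs = 4")
  case False
  then show ?thesis using ext_deriv_degree[OF has_degree_cartan_form] by simp
next
  case True
  then obtain a b c d where vs: "vs = [a, b, c, d]"
    by (auto simp: length_Suc_conv numeral_eq_Suc)
  let ?y = "coord G p p"
  let ?\<delta> = "\<lambda>w. frechet_derivative (mc_rep p w) (at ?y)"
  let ?D = "\<lambda>j a b c. cartan3 (?\<delta> a j) (mc_rep p b ?y) (mc_rep p c ?y) + cartan3 (mc_rep p a ?y) (?\<delta> b j) (mc_rep p c ?y)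
     + cartan3 (mc_rep p a ?y) (mc_rep p b ?y) (?\<delta> c j)"
  note y = coord_self(2)[OF cs, of p]
  have d: "(mc_rep p w has_derivative ?\<delta> w) (at ?y)" for w
    by (rule Ck_near_has_derivative[OF Ck_near_mc_rep[OF y]])
  have D: "frechet_derivative (\<lambda>y. form_rep G (cartan_form G B) p y [a, b, c]) (at ?y) j = ?D j a b c" for a b c j
    unfolding form_rep_cartan form3_simps
    using frechet_derivative_at[OF cartan3_has_derivative[OF d d d], symmetric] by simp
  have "ext_deriv G (cartan_form G B) p vs = ?D a b c d - ?D b a c d + ?D c a b d - ?D d a b c"
    unfolding ext_deriv_def vs by (simp add: D numeral_eq_Suc del: form3_simps)
  also have "\<dots> = 0"
    by (rule cartan3_closed) (rule mc_rep_maurer_cartan[OF y])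
  finally show ?thesis .
qed

lemma pullback_Exp:
  "pullback \<E> G Exp (cartan_form G B) \<mu> = form3 (\<lambda>a b c. cartan3 (dexp \<mu> a) (dexp \<mu> b) (dexp \<mu> c))"
  by (auto simp: pullback_def cartan_form_eq3 map_form3 dexp_eq)

lemma tangent_map_scale: "tangent_map \<E> \<E> (\<lambda>(s, x). s *\<^sub>R x) (t, \<nu>) (a, b) = a *\<^sub>R \<nu> + t *\<^sub>R (b::'a)"
proof -
  have "((\<lambda>p. fst p *\<^sub>R snd p) has_derivative (\<lambda>p. fst p *\<^sub>R \<nu> + t *\<^sub>R snd p)) (at (t, \<nu>))"
    by (auto intro!: derivative_eq_intros simp: add.commute)
  then have "has_mderiv \<E> \<E> (\<lambda>(s, x). s *\<^sub>R x) (t, \<nu>) (\<lambda>p. fst p *\<^sub>R \<nu> + t *\<^sub>R snd p)"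
    by (simp add: case_prod_beta')
  from has_mderiv_tangent_map[OF this] show ?thesis by simp
qed

text \<open>Scaling sends the time direction to the radial vector \<open>\<nu>\<close> and a vector
  \<open>v\<close> to \<open>t *\<^sub>R v\<close>, which explains the three slots.\<close>

definition varpi2 :: "'a \<Rightarrow> 'a \<Rightarrow> 'a \<Rightarrow> real" where
  "varpi2 \<nu> v w = integral {0..1} (\<lambda>t. cartan3 (dexp (t *\<^sub>R \<nu>) \<nu>) (dexp (t *\<^sub>R \<nu>) (t *\<^sub>R v)) (dexp (t *\<^sub>R \<nu>) (t *\<^sub>R w)))"

lemma varpi_eq: "varpi G B \<nu> = form2 (varpi2 \<nu>)"
proof
  fix vs
  show "varpi G B \<nu> vs = form2 (varpi2 \<nu>) vs"
  proof (cases "length vs = 2")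
    case True
    then obtain v w where "vs = [v, w]" by (auto simp: length2)
    then show ?thesis
      unfolding varpi_def radial_homotopy_op_def
      by (simp add: pullback_def[of \<E> \<E>] pullback_Exp tangent_map_scale varpi2_def)
  next
    case False
    then show ?thesis unfolding varpi_def radial_homotopy_op_def
      by (simp add: pullback_def[of \<E> \<E>] pullback_Exp)
  qed
qed

lemma has_degree_varpi: "has_degree (varpi G B) 2"
  by (simp add: has_degree_def varpi_eq)

text \<open>The parameter and the integration variable come last, the order in which the results on
  parameter integrals take them.\<close>

definition varpi_integrand :: "'a \<Rightarrow> 'a \<Rightarrow> 'a \<Rightarrow> real \<Rightarrow> real" where
  "varpi_integrand v w \<nu> t = cartan3 (dexp (t *\<^sub>R \<nu>) \<nu>) (dexp (t *\<^sub>R \<nu>) (t *\<^sub>R v)) (dexp (t *\<^sub>R \<nu>) (t *\<^sub>R w))"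

lemma varpi2_eq: "varpi2 \<nu> v w = integral {0..1} (varpi_integrand v w \<nu>)"
  by (simp add: varpi2_def varpi_integrand_def[abs_def])

lemma Ck_near_dexp_scale: "Ck_near k (\<lambda>p. dexp (snd p *\<^sub>R fst p) (snd p *\<^sub>R w)) (p :: 'a \<times> real)"
proof -
  have "Ck_near k (\<lambda>p. snd p *\<^sub>R dexp (snd p *\<^sub>R fst p) w) p"
    by (rule Ck_near_scaleR[OF Ck_near_snd Ck_near_compose[OF smooth_dexp Ck_near_scaleR[OF Ck_near_snd Ck_near_fst]]])
  then show ?thesis by (simp add: linear_scale[OF linear_dexp])
qed

lemma Ck_near_varpi_integrand: "Ck_near k (\<lambda>p. varpi_integrand v w (fst p) (snd p)) p"
  unfolding varpi_integrand_def dexp_self by (intro Ck_near_cartan3 Ck_near_dexp_scale Ck_near_fst)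

lemma smooth_varpi2: "Ck_near k (\<lambda>\<nu>. varpi2 \<nu> v w) \<nu>"
  unfolding varpi2_eq by (rule Ck_near_integral_param[OF Ck_near_varpi_integrand])

lemma varpi2_integrable: "varpi_integrand v w \<nu> integrable_on {0..1}"
proof (rule integrable_continuous_real)
  have "continuous_on UNIV (\<lambda>p. varpi_integrand v w (fst p) (snd p))"
    by (rule Ck_near_imp_continuous_on[OF Ck_near_varpi_integrand])
  moreover have "continuous_on {0..1} (\<lambda>t. (\<nu>, t))" for \<nu> :: 'a by (intro continuous_intros)
  ultimately have "continuous_on {0..1} (\<lambda>t. varpi_integrand v w (fst (\<nu>, t)) (snd (\<nu>, t)))"
    by (rule continuous_on_compose2) simp
  then show "continuous_on {0..1} (varpi_integrand v w \<nu>)" by simp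
qed

lemma varpi2_linear: "linear (\<lambda>v. varpi2 \<nu> v w)" "linear (\<lambda>w. varpi2 \<nu> v w)"
proof -
  have l: "linear (\<lambda>v. dexp (t *\<^sub>R \<nu>) (t *\<^sub>R v))" for t
    by (rule linearI) (simp_all add: linear_add[OF linear_dexp] linear_scale[OF linear_dexp] scaleR_add_right)
  have i: "linear (\<lambda>v. varpi_integrand v w \<nu> t)" "linear (\<lambda>w. varpi_integrand v w \<nu> t)" for v w t
    using linear_compose[OF l cartan3_linear(2)] linear_compose[OF l cartan3_linear(3)]
    by (simp_all add: o_def varpi_integrand_def)
  have e: "varpi_integrand (a + b) w \<nu> = (\<lambda>t. varpi_integrand a w \<nu> t + varpi_integrand b w \<nu> t)"
    "varpi_integrand v (a + b) \<nu> = (\<lambda>t. varpi_integrand v a \<nu> t + varpi_integrand v b \<nu> t)"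
    "varpi_integrand (r *\<^sub>R a) w \<nu> = (\<lambda>t. r *\<^sub>R varpi_integrand a w \<nu> t)"
    "varpi_integrand v (r *\<^sub>R a) \<nu> = (\<lambda>t. r *\<^sub>R varpi_integrand v a \<nu> t)" for a b r
    by (rule ext, rule linear_add[OF i(1)] linear_add[OF i(2)] linear_scale[OF i(1)] linear_scale[OF i(2)])+
  show "linear (\<lambda>v. varpi2 \<nu> v w)" "linear (\<lambda>w. varpi2 \<nu> v w)"
    by (rule linearI; simp only: varpi2_eq e integral_add[OF varpi2_integrable varpi2_integrable] integral_cmul)+
qed

lemma varpi2_self: "varpi2 \<nu> v v = 0"
  by (simp add: varpi2_def)

lemma smooth_varpi: "smooth_form \<E> (varpi G B)"
  unfolding smooth_form_def
proof (intro conjI allI)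
  show "alternating (varpi G B p)" for p
    unfolding varpi_eq by (intro alternating_form2 varpi2_linear varpi2_self)
  show "smooth_on (chart_img \<E> q) (\<lambda>y. form_rep \<E> (varpi G B) q y vs)" for q vs
    by (cases "length vs = 2") (auto simp: smooth_on_iff_near varpi_eq length2 smooth_varpi2 Ck_near_const)
qed

text \<open>With \<open>F\<close> the value of the pulled-back form at
  \<open>t *\<^sub>R \<nu>\<close> on the three vectors, differentiation under the integral yields
  three terms \<open>t^2 F\<close> and an alternating sum of \<open>t^3\<close> terms. Closedness
  turns that sum into the radial derivative of the form, so the integrand is the derivative of
  \<open>t^3 F\<close>, and the fundamental theorem of calculus leaves \<open>F\<close> at
  \<open>t = 1\<close>.\<close>

lemma ext_deriv_varpi: "ext_deriv \<E> (varpi G B) \<nu> vs = pullback \<E> G Exp (cartan_form G B) \<nu> vs"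
proof (cases "length vs = 3")
  case False
  then show ?thesis using ext_deriv_degree[OF has_degree_varpi] by (simp add: pullback_Exp)
next
  case True
  then obtain v0 v1 v2 where vs: "vs = [v0, v1, v2]" by (auto simp: length3)
  define \<tau> where "\<tau> w t = dexp (t *\<^sub>R \<nu>) w" for w t
  define \<delta> where "\<delta> w u t = d2exp (t *\<^sub>R \<nu>) w u" for w u t
  define D where "D t j a b c = cartan3 (\<delta> a j t) (\<tau> b t) (\<tau> c t) + cartan3 (\<tau> a t) (\<delta> b j t) (\<tau> c t) + cartan3 (\<tau> a t) (\<tau> b t) (\<delta> c j t)" for t j a b c
  \<comment> \<open>The \<open>t^2\<close> term differentiates the explicit radial vector in the
    first slot; the other term differentiates \<open>dexp\<close> and gains a further
    \<open>t\<close> from the chain rule.\<close>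
  define I where "I v w u t = t\<^sup>2 * cartan3 (\<tau> u t) (\<tau> v t) (\<tau> w t) + t ^ 3 * D t u \<nu> v w" for v w u t
  have scale: "((\<lambda>y. dexp (t *\<^sub>R y) w) has_derivative (\<lambda>u. t *\<^sub>R d2exp (t *\<^sub>R y) w u)) (at y)" for t w y
    using has_derivative_compose[OF has_derivative_scaleR_right[OF has_derivative_ident], of "\<lambda>\<mu>. dexp \<mu> w" "d2exp (t *\<^sub>R y) w" t y UNIV]
      dexp_has_derivative[of w "t *\<^sub>R y"] linear_scale[OF has_derivative_linear[OF dexp_has_derivative]] by simp
  have self: "((\<lambda>y. dexp (t *\<^sub>R y) y) has_derivative (\<lambda>u. dexp (t *\<^sub>R y) u + t *\<^sub>R d2exp (t *\<^sub>R y) y u)) (at y)" for t y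
  proof -
    have "((\<lambda>y. dexp (t *\<^sub>R y) y) has_derivative
      (\<lambda>u. dexp (t *\<^sub>R y) u + (\<Sum>b\<in>Basis. (y \<bullet> b) *\<^sub>R t *\<^sub>R d2exp (t *\<^sub>R y) b u))) (at y)"
      by (rule has_derivative_linear_apply[OF _ scale has_derivative_ident]) (simp add: linear_dexp)
    moreover have "(\<Sum>b\<in>Basis. (y \<bullet> b) *\<^sub>R t *\<^sub>R d2exp (t *\<^sub>R y) b u) = t *\<^sub>R d2exp (t *\<^sub>R y) y u" for u
      by (subst d2exp_expand[of _ y]) (simp add: scaleR_sum_right mult.commute)
    ultimately show ?thesis by simp
  qed
  have integrand: "((\<lambda>y. varpi_integrand v w y t) has_derivative
      (\<lambda>u. t\<^sup>2 * (cartan3 (dexp (t *\<^sub>R y) u + t *\<^sub>R d2exp (t *\<^sub>R y) y u) (dexp (t *\<^sub>R y) v) (dexp (t *\<^sub>R y) w)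
       + cartan3 (dexp (t *\<^sub>R y) y) (t *\<^sub>R d2exp (t *\<^sub>R y) v u) (dexp (t *\<^sub>R y) w)
       + cartan3 (dexp (t *\<^sub>R y) y) (dexp (t *\<^sub>R y) v) (t *\<^sub>R d2exp (t *\<^sub>R y) w u)))) (at y)" for v w t y
  proof -
    have "varpi_integrand v w y t = t\<^sup>2 * cartan3 (dexp (t *\<^sub>R y) y) (dexp (t *\<^sub>R y) v) (dexp (t *\<^sub>R y) w)" for y
      by (simp add: varpi_integrand_def linear_scale[OF linear_dexp] linear_scale[OF cartan3_linear(2)] linear_scale[OF cartan3_linear(3)] power2_eq_square)
    then show ?thesis
      using has_derivative_mult_right[OF cartan3_has_derivative[OF self[of t y] scale[of t v y] scale[of t w y]], of "t\<^sup>2"] by simp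
  qed
  have der: "frechet_derivative (\<lambda>y. varpi2 y v w) (at \<nu>) u = integral {0..1} (I v w u)" for v w u
  proof -
    note has_derivative_integral_param[of "varpi_integrand v w", OF Ck_near_varpi_integrand integrand, of \<nu>]
    from frechet_derivative_at[OF this, symmetric]
    have "frechet_derivative (\<lambda>y. varpi2 y v w) (at \<nu>) u = integral {0..1} (\<lambda>t. t\<^sup>2 *
        (cartan3 (dexp (t *\<^sub>R \<nu>) u + t *\<^sub>R d2exp (t *\<^sub>R \<nu>) \<nu> u) (dexp (t *\<^sub>R \<nu>) v) (dexp (t *\<^sub>R \<nu>) w)
       + cartan3 (dexp (t *\<^sub>R \<nu>) \<nu>) (t *\<^sub>R d2exp (t *\<^sub>R \<nu>) v u) (dexp (t *\<^sub>R \<nu>) w)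
       + cartan3 (dexp (t *\<^sub>R \<nu>) \<nu>) (dexp (t *\<^sub>R \<nu>) v) (t *\<^sub>R d2exp (t *\<^sub>R \<nu>) w u)))"
      by (simp add: varpi2_eq)
    also have "\<dots> = integral {0..1} (I v w u)"
      by (rule integral_cong) (simp add: I_def D_def \<tau>_def \<delta>_def linear_add[OF cartan3_linear(1)] linear_scale[OF cartan3_linear(1)]
         linear_scale[OF cartan3_linear(2)] linear_scale[OF cartan3_linear(3)] power2_eq_square power3_eq_cube algebra_simps)
    finally show ?thesis .
  qed
  have k\<tau>: "Ck_near k (\<tau> w) t" for k w t
    unfolding \<tau>_def by (rule Ck_near_compose[OF smooth_dexp Ck_near_scaleR[OF Ck_near_id Ck_near_const]])
  have k\<delta>: "Ck_near k (\<delta> w u) t" for k w u t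
    unfolding \<delta>_def by (rule Ck_near_compose[OF Ck_near_d2exp Ck_near_scaleR[OF Ck_near_id Ck_near_const]])
  have kI: "Ck_near k (I v w u) t" for k v w u t
    unfolding I_def D_def power2_eq_square power3_eq_cube
    by (intro Ck_near_add Ck_near_bilinear[OF bounded_bilinear_mult] Ck_near_cartan3 k\<tau> k\<delta> Ck_near_id)
  have iI: "I v w u integrable_on {0..1}" for v w u
    by (rule integrable_continuous_real[OF Ck_near_imp_continuous_on[OF kI]])
  \<comment> \<open>Closedness is used with the radial vector as one of the four arguments.\<close>
  have cl0: "D t \<nu> v0 v1 v2 - D t v0 \<nu> v1 v2 + D t v1 \<nu> v0 v2 - D t v2 \<nu> v0 v1 = 0" for t
    unfolding D_def by (rule cartan3_closed[of "\<lambda>w u. \<delta> w u t" "\<lambda>w. \<tau> w t"]) (simp add: \<delta>_def \<tau>_def d2exp_maurer_cartan)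
  have cl: "D t v0 \<nu> v1 v2 - D t v1 \<nu> v0 v2 + D t v2 \<nu> v0 v1 = D t \<nu> v0 v1 v2" for t
    using cl0[of t] by linarith
  let ?F = "\<lambda>t. cartan3 (\<tau> v0 t) (\<tau> v1 t) (\<tau> v2 t)"
  have "ext_deriv \<E> (varpi G B) \<nu> vs = integral {0..1} (I v1 v2 v0) - integral {0..1} (I v0 v2 v1) + integral {0..1} (I v0 v1 v2)"
    unfolding ext_deriv_def vs by (simp add: varpi_eq der numeral_eq_Suc)
  also have "\<dots> = integral {0..1} (\<lambda>t. I v1 v2 v0 t - I v0 v2 v1 t + I v0 v1 v2 t)"
    by (simp add: integral_add integral_diff integrable_diff iI)
  also have "(\<lambda>t. I v1 v2 v0 t - I v0 v2 v1 t + I v0 v1 v2 t) = (\<lambda>t. 3 * t\<^sup>2 * ?F t + t ^ 3 * D t \<nu> v0 v1 v2)"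
  proof
    fix t
    have "I v1 v2 v0 t - I v0 v2 v1 t + I v0 v1 v2 t = t\<^sup>2 * (?F t - cartan3 (\<tau> v1 t) (\<tau> v0 t) (\<tau> v2 t) + cartan3 (\<tau> v2 t) (\<tau> v0 t) (\<tau> v1 t))
       + t ^ 3 * (D t v0 \<nu> v1 v2 - D t v1 \<nu> v0 v2 + D t v2 \<nu> v0 v1)"
      by (simp add: I_def algebra_simps)
    then show "I v1 v2 v0 t - I v0 v2 v1 t + I v0 v1 v2 t = 3 * t\<^sup>2 * ?F t + t ^ 3 * D t \<nu> v0 v1 v2"
      unfolding cl using cartan3_swap(1)[of "\<tau> v1 t" "\<tau> v0 t" "\<tau> v2 t"] cartan3_cyclic[of "\<tau> v2 t" "\<tau> v0 t" "\<tau> v1 t"] by simp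
  qed
  also have "integral {0..1} (\<lambda>t. 3 * t\<^sup>2 * ?F t + t ^ 3 * D t \<nu> v0 v1 v2) = 1 ^ 3 * ?F 1 - 0 ^ 3 * ?F 0"
  proof (rule integral_unique[OF fundamental_theorem_of_calculus])
    fix t :: real
    have d\<tau>: "(\<tau> w has_derivative (\<lambda>s. s *\<^sub>R \<delta> w \<nu> t)) (at t within {0..1})" for w
      unfolding \<tau>_def \<delta>_def
      by (rule has_derivative_eq_rhs[OF has_derivative_compose[OF has_derivative_scaleR_left[OF has_derivative_ident] dexp_has_derivative]])
        (simp add: linear_scale[OF has_derivative_linear[OF dexp_has_derivative]])
    have "(?F has_derivative (\<lambda>s. s * D t \<nu> v0 v1 v2)) (at t within {0..1})"
      by (rule has_derivative_eq_rhs[OF cartan3_has_derivative[OF d\<tau> d\<tau> d\<tau>]])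
        (simp add: D_def linear_scale[OF cartan3_linear(1)] linear_scale[OF cartan3_linear(2)]
          linear_scale[OF cartan3_linear(3)] algebra_simps)
    then show "((\<lambda>t. t ^ 3 * ?F t) has_vector_derivative 3 * t\<^sup>2 * ?F t + t ^ 3 * D t \<nu> v0 v1 v2) (at t within {0..1})"
      unfolding has_vector_derivative_def by (auto intro!: derivative_eq_intros simp: algebra_simps power2_eq_square power3_eq_cube)
  qed simp
  finally show ?thesis by (simp add: pullback_Exp vs \<tau>_def)
qed

end

section \<open>The Courant bracket in a frame\<close>

lemma ext_deriv_1: "ext_deriv M \<phi> p [w] = frechet_derivative (\<lambda>z. \<phi> (chart_inv M p z) []) (at (coord M p p)) w"
  by (simp add: ext_deriv_def form_rep_def Let_def)

lemma ext_deriv_2: "ext_deriv M \<phi> p [v, w] =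
    frechet_derivative (\<lambda>z. form_rep M \<phi> p z [w]) (at (coord M p p)) v -
    frechet_derivative (\<lambda>z. form_rep M \<phi> p z [v]) (at (coord M p p)) w"
  by (simp add: ext_deriv_def numeral_2_eq_2 lessThan_Suc)

lemma ext_deriv_cong:
  assumes "length vs = Suc n" "\<And>q us. length us = n \<Longrightarrow> \<phi> q us = \<psi> q us"
  shows "ext_deriv M \<phi> p vs = ext_deriv M \<psi> p vs"
proof -
  have "form_rep M \<phi> p y (take i vs @ drop (Suc i) vs) = form_rep M \<psi> p y (take i vs @ drop (Suc i) vs)" if "i < length vs" for i y
    using assms that by (simp add: form_rep_def Let_def)
  then show ?thesis unfolding ext_deriv_def by (intro sum.cong refl) simp
qed

lemma spinor_action_simps:
  "spinor_action x \<phi> p [] = \<phi> p [fst (x p)]"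
  "spinor_action x \<phi> p [w] = blinfun_apply (snd (x p)) w * \<phi> p [] + \<phi> p [fst (x p), w]"
  "spinor_action x \<phi> p [v, w] = blinfun_apply (snd (x p)) v * \<phi> p [w] - blinfun_apply (snd (x p)) w * \<phi> p [v] + \<phi> p [fst (x p), v, w]"
  by (simp_all add: spinor_action_def wedge_via_one_form numeral_2_eq_2 lessThan_Suc)

lemma twisted_deriv_simps:
  assumes "has_degree \<eta> 3"
  shows "twisted_deriv M \<eta> \<phi> p [] = 0" "twisted_deriv M \<eta> \<phi> p [u] = ext_deriv M \<phi> p [u]"
    "twisted_deriv M \<eta> \<phi> p [u, v] = ext_deriv M \<phi> p [u, v]"
    "twisted_deriv M \<eta> \<phi> p [u, v, w] = ext_deriv M \<phi> p [u, v, w] + \<eta> p [u, v, w] * \<phi> p []"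
  using wedge_degree_gt[OF assms] wedge_degree_eq[OF assms]
  by (simp_all add: twisted_deriv_def) (simp add: ext_deriv_def)

definition one0 :: "('m, 'a, real) form" where "one0 p vs = (if vs = [] then 1 else 0)"

lemma smooth_one0: "smooth_form M one0"
proof -
  have "form_rep M one0 q y vs = (if vs = [] then 1 else 0)" for q y and vs :: "'b list"
    by (simp add: form_rep_def one0_def Let_def)
  then show ?thesis
    by (auto simp: smooth_form_def alternating_def one0_def smooth_on_def Ck_on_const linear_zero_fun)
qed

lemma ext_deriv_one0: "ext_deriv M one0 p vs = 0"
proof -
  have "(\<lambda>y. form_rep M one0 p y us) = (\<lambda>y. if us = [] then 1 else 0)" for us
    by (auto simp: form_rep_def one0_def Let_def)
  then show ?thesis by (simp add: ext_deriv_def)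
qed

text \<open>On the constant function 1 a section acts by its covector part. Degree 1 of the defining
  identity then reads as the Lie derivative of the second covector along the first vector, minus the
  contraction of the differential of the first covector with the second vector, minus the
  contraction of \<open>\<eta>\<close> with both vectors.\<close>

lemma courant_bracket_covector:
  assumes cb: "is_courant_bracket M \<eta> x1 x2 y" and \<eta>: "has_degree \<eta> 3"
  shows "blinfun_apply (snd (y p)) w =
    frechet_derivative (\<lambda>z. blinfun_apply (snd (x2 (chart_inv M p z))) (fst (x1 (chart_inv M p z)))) (at (coord M p p)) w
    + ext_deriv M (one_form (\<lambda>p. blinfun_apply (snd (x2 p)))) p [fst (x1 p), w]
    - ext_deriv M (one_form (\<lambda>p. blinfun_apply (snd (x1 p)))) p [fst (x2 p), w]
    - \<eta> p [fst (x1 p), fst (x2 p), w]"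
proof -
  note t = twisted_deriv_simps[OF \<eta>] and s = spinor_action_simps
  have e: "ext_deriv M (spinor_action x one0) p [u, v] = ext_deriv M (one_form (\<lambda>p. blinfun_apply (snd (x p)))) p [u, v]" for x u v
    by (rule ext_deriv_cong[of _ 1]) (auto simp: length_Suc_conv s one0_def one_form_def)
  have "spinor_action y one0 p [w] =
    (twisted_deriv M \<eta> (spinor_action x1 (spinor_action x2 one0)) p [w] + spinor_action x1 (twisted_deriv M \<eta> (spinor_action x2 one0)) p [w])
    - spinor_action x2 (\<lambda>p vs. twisted_deriv M \<eta> (spinor_action x1 one0) p vs + spinor_action x1 (twisted_deriv M \<eta> one0) p vs) p [w]"
    using cb smooth_one0[of M] unfolding is_courant_bracket_def Let_def by blast
  then show ?thesis
    by (simp add: s t e ext_deriv_one0 one0_def ext_deriv_1[of M "spinor_action _ _"])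
qed

text \<open>Degree 0 of the defining identity on a one-form. The right-hand side is Cartan's formula
  for \<open>\<beta>\<close> on the commutator of the two vector fields.\<close>

lemma courant_bracket_vector:
  fixes \<beta> :: "'m \<Rightarrow> 'a::real_normed_vector \<Rightarrow> real"
  assumes cb: "is_courant_bracket M \<eta> x1 x2 y" and \<eta>: "has_degree \<eta> 3" and \<beta>: "smooth_form M (one_form \<beta>)"
  shows "\<beta> p (fst (y p)) =
    frechet_derivative (\<lambda>z. \<beta> (chart_inv M p z) (fst (x2 (chart_inv M p z)))) (at (coord M p p)) (fst (x1 p))
    - frechet_derivative (\<lambda>z. \<beta> (chart_inv M p z) (fst (x1 (chart_inv M p z)))) (at (coord M p p)) (fst (x2 p))
    - ext_deriv M (one_form \<beta>) p [fst (x1 p), fst (x2 p)]"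
proof -
  note t = twisted_deriv_simps[OF \<eta>] and s = spinor_action_simps
  let ?\<phi> = "one_form \<beta>"
  have "spinor_action y ?\<phi> p [] =
    (twisted_deriv M \<eta> (spinor_action x1 (spinor_action x2 ?\<phi>)) p [] + spinor_action x1 (twisted_deriv M \<eta> (spinor_action x2 ?\<phi>)) p [])
    - spinor_action x2 (\<lambda>p vs. twisted_deriv M \<eta> (spinor_action x1 ?\<phi>) p vs + spinor_action x1 (twisted_deriv M \<eta> ?\<phi>) p vs) p []"
    using cb \<beta> unfolding is_courant_bracket_def Let_def by blast
  then show ?thesis
    by (simp add: s t one_form_def[of \<beta> _ "[_]"] ext_deriv_1[of M "spinor_action _ _"])
qed

lemma from_chart_self:
  assumes M: "smooth_manifold M" shows "from_chart M p p v = v"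
proof -
  note cM = smooth_manifold_chart_system[OF M]
  have "tangent_map \<E> M (chart_inv M p) (coord M p p) = (\<lambda>v. v)"
    by (rule has_mderiv_tangent_map[OF has_mderiv_chart_inv_self[OF cM]])
  moreover have "tangent_map \<E> M (chart_inv M p) (coord M p p) = from_chart M p p"
    using has_mderiv_tangent_map[OF has_mderiv_chart_inv[OF M coord_self(2)[OF cM]]] coord_self(1)[OF cM] by metis
  ultimately show ?thesis by simp
qed

text \<open>What the two Dirac structures have in common: a global frame form
  \<open>\<theta>\<close> with inverse \<open>X\<close> and a Maurer-Cartan equation with structure
  bracket \<open>br\<close>. On the group this is the left trivialisation with the Lie bracket; on
  the Lie algebra it is the flat frame, with \<open>br\<close> equal to 0.\<close>

locale framed_manifold =
  fixes M :: "('m::{t2_space, second_countable_topology}, 'a::euclidean_space, 'z) charts_scheme"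
    and \<theta> :: "'m \<Rightarrow> 'a \<Rightarrow> 'a" and X :: "'a \<Rightarrow> 'm \<Rightarrow> 'a"
    and br :: "'a \<Rightarrow> 'a \<Rightarrow> 'a" and B :: "'a \<Rightarrow> 'a \<Rightarrow> real"
  assumes M: "smooth_manifold M"
    and lin\<theta>: "linear (\<theta> p)" and linX: "linear (\<lambda>\<xi>. X \<xi> p)"
    and \<theta>X [simp]: "\<theta> p (X \<xi> p) = \<xi>" and X\<theta> [simp]: "X (\<theta> p v) p = v"
    and smooth\<theta>: "y \<in> chart_img M q \<Longrightarrow> Ck_near k (\<lambda>y. \<theta> (chart_inv M q y) (from_chart M q (chart_inv M q y) w)) y"
    and smoothX: "y \<in> chart_img M q \<Longrightarrow> Ck_near k (vf_rep M (X \<xi>) q) y"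
    and mc: "frechet_derivative (\<lambda>y. \<theta> (chart_inv M p y) (from_chart M p (chart_inv M p y) w)) (at (coord M p p)) v
      - frechet_derivative (\<lambda>y. \<theta> (chart_inv M p y) (from_chart M p (chart_inv M p y) v)) (at (coord M p p)) w
      = - br (\<theta> p v) (\<theta> p w)"
    and bbB: "bounded_bilinear B" and B_comm: "B \<xi> \<zeta> = B \<zeta> \<xi>"
    and nondeg: "(\<And>\<zeta>. B \<xi> \<zeta> = 0) \<Longrightarrow> \<xi> = 0"
begin

lemmas cM = smooth_manifold_chart_system[OF M]

lemmas Bs = bounded_bilinear.add_left[OF bbB] bounded_bilinear.add_right[OF bbB]
  bounded_bilinear.diff_left[OF bbB] bounded_bilinear.diff_right[OF bbB]
  bounded_bilinear.minus_left[OF bbB] bounded_bilinear.minus_right[OF bbB]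
  bounded_bilinear.scaleR_left[OF bbB] bounded_bilinear.scaleR_right[OF bbB]
  bounded_bilinear.zero_left[OF bbB] bounded_bilinear.zero_right[OF bbB]

lemma linear_B: "linear (\<lambda>v. B a v)" "linear (\<lambda>a. B a v)"
  using bounded_bilinear.bounded_linear_right[OF bbB] bounded_bilinear.bounded_linear_left[OF bbB]
  by (auto simp: linear_conv_bounded_linear)

text \<open>\<open>J\<close> expresses \<open>B\<close> through the Euclidean inner product.
  Non-degeneracy makes it injective, hence surjective in finite dimension; definiteness of
  \<open>B\<close> does not enter.\<close>

lemma dual_basis_exists: "\<exists>d. \<forall>\<zeta>. B d \<zeta> = b \<bullet> \<zeta>"
proof -
  define J where "J x = (\<Sum>c\<in>Basis. B x c *\<^sub>R c)" for x
  have lJ: "linear J" unfolding J_def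
    by (rule linearI) (simp_all add: Bs scaleR_add_left sum.distrib scaleR_sum_right)
  have Ji: "J x \<bullet> c = B x c" if "c \<in> Basis" for x c
    using that by (simp add: J_def inner_sum_left inner_Basis if_distrib cong: if_cong)
  have "inj J" unfolding linear_injective_0[OF lJ]
  proof (intro allI impI)
    fix x assume "J x = 0"
    then have "B x c = 0" if "c \<in> Basis" for c using Ji[OF that, of x] by simp
    then have "B x \<zeta> = 0" for \<zeta> using linear_expand[OF linear_B(1), of x \<zeta>] by simp
    then show "x = 0" by (rule nondeg)
  qed
  then have "surj J" by (rule linear_inj_imp_surj[OF lJ])
  then obtain d where d: "J d = b" by (metis surjD)
  have "B d \<zeta> = b \<bullet> \<zeta>" for \<zeta>
  proof -
    have "B d \<zeta> = (\<Sum>c\<in>Basis. (\<zeta> \<bullet> c) *\<^sub>R B d c)" by (rule linear_expand[OF linear_B(1)])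
    also have "\<dots> = (\<Sum>c\<in>Basis. (b \<bullet> c) * (\<zeta> \<bullet> c))" using Ji[of _ d] d by (intro sum.cong refl) (simp add: mult.commute)
    also have "\<dots> = b \<bullet> \<zeta>" by (rule euclidean_inner[symmetric])
    finally show ?thesis .
  qed
  then show ?thesis by blast
qed

definition dual :: "'a \<Rightarrow> 'a" where "dual b = (SOME d. \<forall>\<zeta>. B d \<zeta> = b \<bullet> \<zeta>)"

lemma dual: "B (dual b) \<zeta> = b \<bullet> \<zeta>"
  unfolding dual_def using someI_ex[OF dual_basis_exists[of b]] by blast

lemma represent: "linear l \<Longrightarrow> B (\<Sum>b\<in>Basis. l b *\<^sub>R dual b) \<zeta> = l \<zeta>"
  by (subst linear_expand[of l \<zeta>], assumption)
    (simp add: linear_sum[OF linear_B(2)] Bs dual inner_commute mult.commute)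

lemma B_eqI: "(\<And>\<zeta>. B \<xi> \<zeta> = B \<xi>' \<zeta>) \<Longrightarrow> \<xi> = \<xi>'"
  using nondeg[of "\<xi> - \<xi>'"] by (simp add: Bs)

text \<open>Coordinates of a generalised tangent vector as two Lie algebra elements:
  \<open>\<theta>\<close> reads the vector, and \<open>B\<close> represents the covector. The
  inverse is \<open>elt\<close>.\<close>

definition vpart :: "'a gtangent \<Rightarrow> 'm \<Rightarrow> 'a" where "vpart w p = \<theta> p (fst w)"
definition cpart :: "'a gtangent \<Rightarrow> 'm \<Rightarrow> 'a" where "cpart w p = (\<Sum>b\<in>Basis. blinfun_apply (snd w) (X b p) *\<^sub>R dual b)"
definition elt :: "'m \<Rightarrow> 'a \<Rightarrow> 'a \<Rightarrow> 'a gtangent" where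
  "elt p u a = (X u p, Blinfun (\<lambda>v. B (\<theta> p v) a))"

lemma fst_elt: "fst (elt p u a) = X u p" by (simp add: elt_def)
lemma snd_elt: "blinfun_apply (snd (elt p u a)) v = B a (\<theta> p v)"
proof -
  have "linear (\<lambda>v. B (\<theta> p v) a)" using linear_compose[OF lin\<theta> linear_B(2)] by (simp add: o_def)
  then show ?thesis by (simp add: elt_def bounded_linear_Blinfun_apply linear_conv_bounded_linear B_comm)
qed

lemma fst_vpart: "fst w = X (vpart w p) p" by (simp add: vpart_def)

lemma snd_cpart: "blinfun_apply (snd w) v = B (cpart w p) (\<theta> p v)"
proof -
  have "linear (\<lambda>\<xi>. blinfun_apply (snd w) (X \<xi> p))"
    using linear_compose[OF linX bounded_linear.linear[OF blinfun.bounded_linear_right]] by (simp add: o_def)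
  from represent[OF this, of "\<theta> p v"] show ?thesis by (simp add: cpart_def)
qed

lemma elt_parts: "elt p (vpart w p) (cpart w p) = w"
  by (rule prod_eqI) (simp_all add: fst_elt fst_vpart[symmetric] blinfun_eqI snd_elt snd_cpart[of w _ p])

lemma parts_elt: "vpart (elt p u a) p = u" "cpart (elt p u a) p = a"
proof -
  show "vpart (elt p u a) p = u" by (simp add: vpart_def fst_elt)
  show "cpart (elt p u a) p = a"
    using snd_cpart[of "elt p u a" "X \<zeta> p" p for \<zeta>] by (intro B_eqI) (simp add: snd_elt)
qed

lemma pairing_elt: "pairing (elt p u a) (elt p u' a') = B a u' + B a' u"
  by (simp add: pairing_def fst_elt snd_elt)

lemma linear_elt: "linear (\<lambda>w. elt p (fst w) (snd w))"
proof (rule linearI)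
  show "elt p (fst (a + b)) (snd (a + b)) = elt p (fst a) (snd a) + elt p (fst b) (snd b)" for a b
    by (rule prod_eqI) (simp_all add: fst_elt linear_add[OF linX] blinfun_eqI snd_elt Bs blinfun.add_left)
  show "elt p (fst (r *\<^sub>R a)) (snd (r *\<^sub>R a)) = r *\<^sub>R elt p (fst a) (snd a)" for r a
    by (rule prod_eqI) (simp_all add: fst_elt linear_scale[OF linX] blinfun_eqI snd_elt Bs blinfun.scaleR_left)
qed

lemma smooth_section_parts:
  assumes x: "smooth_section_on M UNIV x" and y: "y \<in> chart_img M q"
  shows "Ck_near k (\<lambda>y. vpart (x (chart_inv M q y)) (chart_inv M q y)) y"
    "Ck_near k (\<lambda>y. cpart (x (chart_inv M q y)) (chart_inv M q y)) y"
proof -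
  let ?c = "chart_inv M q"
  let ?\<alpha> = "\<lambda>v y. form_rep M (one_form (\<lambda>p. blinfun_apply (snd (x p)))) q y [v]"
  have img: "coord M q ` (chart_dom M q \<inter> UNIV) = chart_img M q" for q by (simp add: chart_img_def)
  have v: "Ck_near k (vf_rep M (\<lambda>p. fst (x p)) q) y" and \<alpha>: "Ck_near k (?\<alpha> w) y" for w k
    using x y unfolding smooth_section_on_def smooth_vf_on_def img smooth_on_iff_near[OF chart_systemD(3)[OF cM]] by auto
  have ft: "from_chart M q (?c z) (vf_rep M Y q z) = Y (?c z)" if "z \<in> chart_img M q" for z Y
    using to_chart_from_chart(1)[OF M coord_chart_inv(2)[OF cM that]] by (simp add: vf_rep_def Let_def)
  have lf: "linear (from_chart M q (?c z))" if "z \<in> chart_img M q" for z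
    by (rule has_mderiv_linear[OF has_mderiv_chart_inv[OF M that]])
  have ev: "\<forall>\<^sub>F z in nhds y. z \<in> chart_img M q" by (rule eventually_nhds_in_open[OF chart_systemD(3)[OF cM] y])
  have "Ck_near k (\<lambda>z. \<Sum>b\<in>Basis. (vf_rep M (\<lambda>p. fst (x p)) q z \<bullet> b) *\<^sub>R \<theta> (?c z) (from_chart M q (?c z) b)) y"
    by (intro Ck_near_sum Ck_near_scaleR Ck_near_inner_const v smooth\<theta>[OF y])
  then show "Ck_near k (\<lambda>y. vpart (x (?c y)) (?c y)) y"
  proof (rule Ck_near_cong, use ev in eventually_elim)
    fix z assume z: "z \<in> chart_img M q"
    show "(\<Sum>b\<in>Basis. (vf_rep M (\<lambda>p. fst (x p)) q z \<bullet> b) *\<^sub>R \<theta> (?c z) (from_chart M q (?c z) b)) = vpart (x (?c z)) (?c z)"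
      using linear_expand[OF linear_compose[OF lf[OF z] lin\<theta>], of "?c z" "vf_rep M (\<lambda>p. fst (x p)) q z"] ft[OF z]
      by (simp add: vpart_def)
  qed
  have "Ck_near k (\<lambda>z. \<Sum>b\<in>Basis. (\<Sum>c\<in>Basis. (vf_rep M (X b) q z \<bullet> c) *\<^sub>R ?\<alpha> c z) *\<^sub>R dual b) y"
    by (intro Ck_near_sum Ck_near_scaleR Ck_near_inner_const \<alpha> smoothX[OF y] Ck_near_const)
  then show "Ck_near k (\<lambda>y. cpart (x (?c y)) (?c y)) y"
  proof (rule Ck_near_cong, use ev in eventually_elim)
    fix z assume z: "z \<in> chart_img M q"
    have "linear (\<lambda>v. blinfun_apply (snd (x (?c z))) (from_chart M q (?c z) v))"
      using linear_compose[OF lf[OF z] bounded_linear.linear[OF blinfun.bounded_linear_right]] by (simp add: o_def)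
    from linear_expand[OF this, of "vf_rep M (X b) q z" for b]
    have "(\<Sum>c\<in>Basis. (vf_rep M (X b) q z \<bullet> c) *\<^sub>R ?\<alpha> c z) = blinfun_apply (snd (x (?c z))) (X b (?c z))" for b
      by (simp add: ft[OF z] form_rep_def one_form_def Let_def)
    then show "(\<Sum>b\<in>Basis. (\<Sum>c\<in>Basis. (vf_rep M (X b) q z \<bullet> c) *\<^sub>R ?\<alpha> c z) *\<^sub>R dual b) = cpart (x (?c z)) (?c z)"
      by (simp add: cpart_def)
  qed
qed

lemma smooth_section_elt:
  assumes u: "\<And>q y k. y \<in> chart_img M q \<Longrightarrow> Ck_near k (\<lambda>y. u (chart_inv M q y)) y"
    and a: "\<And>q y k. y \<in> chart_img M q \<Longrightarrow> Ck_near k (\<lambda>y. a (chart_inv M q y)) y"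
  shows "smooth_section_on M UNIV (\<lambda>p. elt p (u p) (a p))"
proof -
  have img: "coord M q ` (chart_dom M q \<inter> UNIV) = chart_img M q" for q by (simp add: chart_img_def)
  have "Ck_near k (vf_rep M (\<lambda>p. X (u p) p) q) y" if y: "y \<in> chart_img M q" for q y k
  proof -
    have "Ck_near k (\<lambda>z. \<Sum>b\<in>Basis. (u (chart_inv M q z) \<bullet> b) *\<^sub>R vf_rep M (X b) q z) y"
      by (intro Ck_near_sum Ck_near_scaleR Ck_near_inner_const u smoothX y)
    then show ?thesis
    proof (rule Ck_near_cong, use eventually_nhds_in_open[OF chart_systemD(3)[OF cM] y] in eventually_elim)
      fix z assume z: "z \<in> chart_img M q"
      have "linear (\<lambda>\<xi>. vf_rep M (X \<xi>) q z)"
        using linear_compose[OF linX has_mderiv_linear[OF has_mderiv_coord[OF M coord_chart_inv(2)[OF cM z]]]]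
        by (simp add: vf_rep_def Let_def o_def)
      from linear_expand[OF this, of "u (chart_inv M q z)"]
      show "(\<Sum>b\<in>Basis. (u (chart_inv M q z) \<bullet> b) *\<^sub>R vf_rep M (X b) q z) = vf_rep M (\<lambda>p. X (u p) p) q z"
        by (simp add: vf_rep_def Let_def)
    qed
  qed
  moreover have "Ck_near k (\<lambda>y. B (a (chart_inv M q y)) (\<theta> (chart_inv M q y) (from_chart M q (chart_inv M q y) v))) y"
    if y: "y \<in> chart_img M q" for q y k v
    by (intro Ck_near_bilinear[OF bbB] a smooth\<theta> y)
  ultimately show ?thesis
    unfolding smooth_section_on_def smooth_vf_on_def img smooth_on_iff_near[OF chart_systemD(3)[OF cM]]
    by (simp add: fst_elt form_rep_def one_form_def Let_def snd_elt)
qed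

abbreviation mder :: "('m \<Rightarrow> 'a) \<Rightarrow> 'm \<Rightarrow> 'a \<Rightarrow> 'a" where
  "mder f p \<equiv> frechet_derivative (\<lambda>z. f (chart_inv M p z)) (at (coord M p p))"

lemma \<theta>rep_has_derivative:
  "((\<lambda>y. \<theta> (chart_inv M p y) (from_chart M p (chart_inv M p y) w)) has_derivative
    frechet_derivative (\<lambda>y. \<theta> (chart_inv M p y) (from_chart M p (chart_inv M p y) w)) (at (coord M p p))) (at (coord M p p))"
  by (rule Ck_near_has_derivative[OF smooth\<theta>[OF coord_self(2)[OF cM]]])

text \<open>The product rule for a coefficient paired with \<open>\<theta>\<close>, where
  \<open>mc\<close> replaces the differential of \<open>\<theta>\<close> by \<open>br\<close>. The
  pairing \<open>h\<close> is left open because it is used with \<open>B\<close> and, for constant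
  coefficients, with the Euclidean inner product.\<close>

lemma ext_deriv_frame:
  fixes h :: "'b::euclidean_space \<Rightarrow> 'a \<Rightarrow> real"
  assumes h: "bounded_bilinear h"
    and \<alpha>: "\<And>p v. \<alpha> p v = h (a p) (\<theta> p v)"
    and a: "((\<lambda>z. a (chart_inv M p z)) has_derivative a') (at (coord M p p))"
  shows "ext_deriv M (one_form \<alpha>) p [v, w] = h (a' v) (\<theta> p w) - h (a' w) (\<theta> p v) - h (a p) (br (\<theta> p v) (\<theta> p w))"
proof -
  let ?t = "\<lambda>w y. \<theta> (chart_inv M p y) (from_chart M p (chart_inv M p y) w)"
  have "((\<lambda>z. form_rep M (one_form \<alpha>) p z [w]) has_derivative
     (\<lambda>v. h (a p) (frechet_derivative (?t w) (at (coord M p p)) v) + h (a' v) (\<theta> p w))) (at (coord M p p))" for w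
    using bounded_bilinear.FDERIV[OF h a \<theta>rep_has_derivative[of p w]]
    by (simp add: form_rep_def Let_def one_form_def \<alpha> coord_self(1)[OF cM] from_chart_self[OF M])
  from frechet_derivative_at[OF this, symmetric]
  have "ext_deriv M (one_form \<alpha>) p [v, w] = (h (a p) (frechet_derivative (?t w) (at (coord M p p)) v) + h (a' v) (\<theta> p w)) -
      (h (a p) (frechet_derivative (?t v) (at (coord M p p)) w) + h (a' w) (\<theta> p v))"
    by (simp add: ext_deriv_2)
  also have "\<dots> = h (a' v) (\<theta> p w) - h (a' w) (\<theta> p v) + h (a p) (frechet_derivative (?t w) (at (coord M p p)) v - frechet_derivative (?t v) (at (coord M p p)) w)"
    by (simp add: bounded_bilinear.diff_right[OF h])
  finally show ?thesis unfolding mc by (simp add: bounded_bilinear.minus_right[OF h])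
qed

lemma courant_in_frame:
  assumes cb: "is_courant_bracket M \<eta> x1 x2 y" and \<eta>: "has_degree \<eta> 3"
    and x1: "smooth_section_on M UNIV x1" and x2: "smooth_section_on M UNIV x2"
  defines "u1 \<equiv> \<lambda>p. vpart (x1 p) p" and "u2 \<equiv> \<lambda>p. vpart (x2 p) p"
    and "a1 \<equiv> \<lambda>p. cpart (x1 p) p" and "a2 \<equiv> \<lambda>p. cpart (x2 p) p"
  shows "vpart (y p) p = mder u2 p (fst (x1 p)) - mder u1 p (fst (x2 p)) + br (u1 p) (u2 p)"
    and "B (cpart (y p) p) (\<theta> p w) = B (a2 p) (mder u1 p w) + B (mder a1 p w) (u2 p)
      + B (mder a2 p (fst (x1 p)) - mder a1 p (fst (x2 p))) (\<theta> p w)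
      - B (a2 p) (br (u1 p) (\<theta> p w)) + B (a1 p) (br (u2 p) (\<theta> p w)) - \<eta> p [fst (x1 p), fst (x2 p), w]"
proof -
  let ?y = "coord M p p"
  have d: "((\<lambda>z. u1 (chart_inv M p z)) has_derivative mder u1 p) (at ?y)" "((\<lambda>z. u2 (chart_inv M p z)) has_derivative mder u2 p) (at ?y)"
    "((\<lambda>z. a1 (chart_inv M p z)) has_derivative mder a1 p) (at ?y)" "((\<lambda>z. a2 (chart_inv M p z)) has_derivative mder a2 p) (at ?y)"
    unfolding u1_def u2_def a1_def a2_def
    by (intro Ck_near_has_derivative smooth_section_parts[OF x1] smooth_section_parts[OF x2] coord_self(2)[OF cM])+
  have \<theta>f: "\<theta> p (fst (x1 p)) = u1 p" "\<theta> p (fst (x2 p)) = u2 p" for p by (simp_all add: u1_def u2_def vpart_def)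
  have s1: "blinfun_apply (snd (x1 p)) v = B (a1 p) (\<theta> p v)" and s2: "blinfun_apply (snd (x2 p)) v = B (a2 p) (\<theta> p v)" for p v
    by (simp_all add: a1_def a2_def snd_cpart[of _ _ p])
  have f21: "frechet_derivative (\<lambda>z. blinfun_apply (snd (x2 (chart_inv M p z))) (fst (x1 (chart_inv M p z)))) (at ?y) w
      = B (a2 p) (mder u1 p w) + B (mder a2 p w) (u1 p)" for w
    using frechet_derivative_at[OF bounded_bilinear.FDERIV[OF bbB d(4) d(1)], symmetric]
    by (simp add: s2 \<theta>f coord_self(1)[OF cM])
  have "B (cpart (y p) p) (\<theta> p w) = blinfun_apply (snd (y p)) w" by (simp add: snd_cpart[of _ _ p])
  then show "B (cpart (y p) p) (\<theta> p w) = B (a2 p) (mder u1 p w) + B (mder a1 p w) (u2 p)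
      + B (mder a2 p (fst (x1 p)) - mder a1 p (fst (x2 p))) (\<theta> p w)
      - B (a2 p) (br (u1 p) (\<theta> p w)) + B (a1 p) (br (u2 p) (\<theta> p w)) - \<eta> p [fst (x1 p), fst (x2 p), w]"
    unfolding courant_bracket_covector[OF cb \<eta>] f21
      ext_deriv_frame[OF bbB s2 d(4)] ext_deriv_frame[OF bbB s1 d(3)] by (simp add: \<theta>f Bs)
  \<comment> \<open>The components of the frame form are smooth test forms with constant
    coefficients, and together they determine the vector part.\<close>
  have "vpart (y p) p \<bullet> b = (mder u2 p (fst (x1 p)) - mder u1 p (fst (x2 p)) + br (u1 p) (u2 p)) \<bullet> b" for b
  proof -
    let ?\<beta> = "\<lambda>p v. b \<bullet> \<theta> p v"
    have sm: "smooth_form M (one_form ?\<beta>)"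
      unfolding smooth_form_def
    proof (intro conjI allI)
      show "alternating (one_form ?\<beta> p)" for p
        unfolding alternating_def
      proof (intro conjI allI impI)
        show "linear (\<lambda>v. one_form ?\<beta> p (xs @ v # ys))" for xs ys
        proof (cases "xs = [] \<and> ys = []")
          case True
          then show ?thesis
            by (auto simp: one_form_def linear_add[OF lin\<theta>] linear_scale[OF lin\<theta>] inner_add_right intro!: linearI)
        next
          case False
          then have "(\<lambda>v. one_form ?\<beta> p (xs @ v # ys)) = (\<lambda>v. 0)"
            by (auto simp: one_form_def fun_eq_iff append_eq_Cons_conv split: list.split)
          then show ?thesis by (simp add: linear_zero_fun)
        qed
        show "one_form ?\<beta> p xs = 0" if "\<not> distinct xs" for xs
          using that by (auto simp: one_form_def split: list.split)
      qed
      show "smooth_on (chart_img M q) (\<lambda>y. form_rep M (one_form ?\<beta>) q y vs)" for q vs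
        by (cases vs rule: list.exhaust; cases "tl vs")
          (auto simp: smooth_on_iff_near[OF chart_systemD(3)[OF cM]] form_rep_def one_form_def Let_def
            intro!: Ck_near_const Ck_near_bilinear[OF bounded_bilinear_inner] smooth\<theta>)
    qed
    have f: "frechet_derivative (\<lambda>z. b \<bullet> u (chart_inv M p z)) (at ?y) = (\<lambda>v. b \<bullet> u' v)"
      if "((\<lambda>z. u (chart_inv M p z)) has_derivative u') (at ?y)" for u u'
      using frechet_derivative_at[OF has_derivative_inner_right[OF that], symmetric] .
    have e: "ext_deriv M (one_form ?\<beta>) p [v, w] = - (b \<bullet> br (\<theta> p v) (\<theta> p w))" for v w
      using ext_deriv_frame[OF bounded_bilinear_inner, of ?\<beta> "\<lambda>p. b" p "\<lambda>v. 0" v w] by simp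
    have "b \<bullet> vpart (y p) p = b \<bullet> mder u2 p (fst (x1 p)) - b \<bullet> mder u1 p (fst (x2 p)) + b \<bullet> br (u1 p) (u2 p)"
      using courant_bracket_vector[OF cb \<eta> sm, of p] f[OF d(1)] f[OF d(2)] by (simp add: e \<theta>f vpart_def)
    then show ?thesis by (simp add: inner_commute[of _ b] inner_diff_right inner_add_right)
  qed
  then show "vpart (y p) p = mder u2 p (fst (x1 p)) - mder u1 p (fst (x2 p)) + br (u1 p) (u2 p)"
    by (rule euclidean_eqI)
qed

section \<open>The two Dirac structures\<close>

lemma linear_family_derivative:
  fixes U :: "'m \<Rightarrow> 'a \<Rightarrow> 'a"
  assumes lin: "\<And>p. linear (U p)"
    and d: "\<And>\<xi>. ((\<lambda>z. U (chart_inv M p z) \<xi>) has_derivative U' \<xi>) (at (coord M p p))"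
    and w: "((\<lambda>z. w (chart_inv M p z)) has_derivative w') (at (coord M p p))"
  shows "((\<lambda>z. U (chart_inv M p z) (w (chart_inv M p z))) has_derivative (\<lambda>v. U p (w' v) + U' (w p) v)) (at (coord M p p))"
    (is "(?f has_derivative _) (at ?y)")
proof -
  let ?c = "chart_inv M p"
  \<comment> \<open>Linearity of the derivative in \<open>\<xi>\<close> is a consequence of
    uniqueness of derivatives.\<close>
  have "U' \<xi> = (\<lambda>v. \<Sum>b\<in>Basis. (\<xi> \<bullet> b) *\<^sub>R U' b v)" for \<xi>
  proof (rule has_derivative_unique[OF d])
    have "((\<lambda>z. \<Sum>b\<in>Basis. (\<xi> \<bullet> b) *\<^sub>R U (?c z) b) has_derivative (\<lambda>v. \<Sum>b\<in>Basis. (\<xi> \<bullet> b) *\<^sub>R U' b v)) (at ?y)"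
      by (intro has_derivative_sum has_derivative_scaleR_right d)
    moreover have "(\<lambda>z. \<Sum>b\<in>Basis. (\<xi> \<bullet> b) *\<^sub>R U (?c z) b) = (\<lambda>z. U (?c z) \<xi>)"
      using linear_expand[OF lin] by metis
    ultimately show "((\<lambda>z. U (?c z) \<xi>) has_derivative (\<lambda>v. \<Sum>b\<in>Basis. (\<xi> \<bullet> b) *\<^sub>R U' b v)) (at ?y)" by simp
  qed
  then have U': "U' \<xi> v = (\<Sum>b\<in>Basis. (\<xi> \<bullet> b) *\<^sub>R U' b v)" for \<xi> v by metis
  have "(?f has_derivative (\<lambda>v. U (?c ?y) (w' v) + (\<Sum>b\<in>Basis. (w (?c ?y) \<bullet> b) *\<^sub>R U' b v))) (at ?y)"
    by (rule has_derivative_linear_apply[OF _ d w]) (simp add: lin)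
  then show ?thesis by (simp add: coord_self(1)[OF cM] U'[symmetric])
qed

lemma linear_elt_of:
  assumes "linear u" "linear a" shows "linear (\<lambda>\<xi>. elt p (u \<xi>) (a \<xi>))"
proof (rule linearI)
  note l = linear_elt[of p]
  show "elt p (u (\<xi> + \<zeta>)) (a (\<xi> + \<zeta>)) = elt p (u \<xi>) (a \<xi>) + elt p (u \<zeta>) (a \<zeta>)" for \<xi> \<zeta>
    using linear_add[OF l, of "(u \<xi>, a \<xi>)" "(u \<zeta>, a \<zeta>)"] by (simp add: linear_add[OF assms(1)] linear_add[OF assms(2)])
  show "elt p (u (r *\<^sub>R \<xi>)) (a (r *\<^sub>R \<xi>)) = r *\<^sub>R elt p (u \<xi>) (a \<xi>)" for r \<xi>
    using linear_scale[OF l, of r "(u \<xi>, a \<xi>)"] by (simp add: linear_scale[OF assms(1)] linear_scale[OF assms(2)])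
qed

lemma span_range_linear: "linear f \<Longrightarrow> span (range f) = range f"
  using linear_subspace_image[OF _ subspace_UNIV] by (simp add: span_eq_iff)

text \<open>
  Modulo sections of a Lagrangian family, the Courant bracket of its sections is tensorial. So
  integrability is checked on constant \<open>\<xi>\<close> and \<open>\<zeta>\<close> only, which gives \<open>T1\<close> for the vector part and \<open>T2\<close>
  for the covector part.
\<close>

lemma dirac_manifold_of_frame:
  fixes U K :: "'m \<Rightarrow> 'a \<Rightarrow> 'a" and U' K' :: "'m \<Rightarrow> 'a \<Rightarrow> 'a \<Rightarrow> 'a" and \<kappa> :: real
  defines "gen \<equiv> \<lambda>p \<xi>. elt p (U p \<xi>) (K p \<xi>)"
  assumes linU: "\<And>p. linear (U p)" and linK: "\<And>p. linear (K p)"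
    and rec: "\<And>p \<xi>. K p \<xi> + \<kappa> *\<^sub>R U p \<xi> = \<xi>"
    and iso: "\<And>p \<xi> \<zeta>. B (K p \<xi>) (U p \<zeta>) + B (K p \<zeta>) (U p \<xi>) = 0"
    and max: "\<And>p u a. (\<And>\<zeta>. B a (U p \<zeta>) + B (K p \<zeta>) u = 0) \<Longrightarrow> \<exists>\<xi>. u = U p \<xi> \<and> a = K p \<xi>"
    and smU: "\<And>q y k \<xi>. y \<in> chart_img M q \<Longrightarrow> Ck_near k (\<lambda>y. U (chart_inv M q y) \<xi>) y"
    and smK: "\<And>q y k \<xi>. y \<in> chart_img M q \<Longrightarrow> Ck_near k (\<lambda>y. K (chart_inv M q y) \<xi>) y"
    and dU: "\<And>p \<xi>. ((\<lambda>z. U (chart_inv M p z) \<xi>) has_derivative U' p \<xi>) (at (coord M p p))"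
    and dK: "\<And>p \<xi>. ((\<lambda>z. K (chart_inv M p z) \<xi>) has_derivative K' p \<xi>) (at (coord M p p))"
    and \<eta>: "smooth_form M \<eta>" "has_degree \<eta> 3" "\<And>p vs. ext_deriv M \<eta> p vs = 0"
    and T1: "\<And>p \<xi> \<zeta>. U' p \<zeta> (X (U p \<xi>) p) - U' p \<xi> (X (U p \<zeta>) p) + br (U p \<xi>) (U p \<zeta>) = U p (lb \<xi> \<zeta>)"
    and T2: "\<And>p \<xi> \<zeta> w. B (K p \<zeta>) (U' p \<xi> w) + B (K' p \<xi> w) (U p \<zeta>)
       + B (K' p \<zeta> (X (U p \<xi>) p) - K' p \<xi> (X (U p \<zeta>) p)) (\<theta> p w)
       - B (K p \<zeta>) (br (U p \<xi>) (\<theta> p w)) + B (K p \<xi>) (br (U p \<zeta>) (\<theta> p w))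
       - \<eta> p [X (U p \<xi>) p, X (U p \<zeta>) p, w] = B (K p (lb \<xi> \<zeta>)) (\<theta> p w)"
  shows "dirac_manifold M (\<lambda>p. span (range (gen p))) \<eta>"
proof -
  have lin: "linear (gen p)" for p unfolding gen_def by (rule linear_elt_of[OF linU linK])
  have vgen: "vpart (gen p \<xi>) p = U p \<xi>" and cgen: "cpart (gen p \<xi>) p = K p \<xi>" for p \<xi>
    by (simp_all add: gen_def parts_elt)
  have inj: "inj (gen p)" for p
    by (rule injI) (metis vgen cgen rec)
  have E: "span (range (gen p)) = range (gen p)" for p by (rule span_range_linear[OF lin])
  have "smooth_subbundle M (\<lambda>p. span (range (gen p)))"
  proof -
    obtain f where f: "bij_betw f {..<DIM('a)} (Basis :: 'a set)"
      using ex_bij_betw_nat_finite[OF finite_Basis] by (auto simp: atLeast0LessThan)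
    have s: "smooth_section_on M UNIV (\<lambda>p. gen p (f i))" for i
      unfolding gen_def by (intro smooth_section_elt smU smK)
    have im: "(\<lambda>i. gen q (f i)) ` {..<DIM('a)} = gen q ` Basis" for q
      using f by (auto simp: bij_betw_def image_image[symmetric])
    have "inj_on (\<lambda>i. gen q (f i)) {..<DIM('a)}" for q
      using f inj[of q] by (auto simp: bij_betw_def inj_on_def)
    moreover have "independent (gen q ` Basis)" for q
      by (rule linear_independent_injective_image[OF lin independent_Basis]) (use inj in \<open>auto intro: inj_on_subset\<close>)
    moreover have "span (range (gen q)) = span (gen q ` Basis)" for q
      by (simp add: linear_span_image[OF lin] E)
    ultimately show ?thesis unfolding smooth_subbundle_def im[symmetric]
      by (intro allI exI[of _ UNIV] exI[of _ "DIM('a)"] exI[of _ "\<lambda>i p. gen p (f i)"]) (auto simp: s)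
  qed
  moreover have "lagrangian (span (range (gen p)))" for p
  proof -
    have pg: "pairing (gen p \<xi>) (gen p \<zeta>) = 0" for \<xi> \<zeta> by (simp add: gen_def pairing_elt iso)
    have "x \<in> range (gen p)" if x: "\<forall>y\<in>range (gen p). pairing x y = 0" for x
    proof -
      have "B (cpart x p) (U p \<zeta>) + B (K p \<zeta>) (vpart x p) = 0" for \<zeta>
        using x pairing_elt[of p "vpart x p" "cpart x p" "U p \<zeta>" "K p \<zeta>"] by (simp add: elt_parts gen_def)
      from max[OF this] obtain \<xi> where "vpart x p = U p \<xi>" "cpart x p = K p \<xi>" by blast
      then have "x = gen p \<xi>" using elt_parts[of p x] by (simp add: gen_def)
      then show ?thesis by blast
    qed
    then have "range (gen p) = {x. \<forall>y\<in>range (gen p). pairing x y = 0}" using pg by blast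
    then show ?thesis unfolding lagrangian_def E
      using linear_subspace_image[OF lin subspace_UNIV] by blast
  qed
  moreover have "y \<in> sections M (\<lambda>p. span (range (gen p)))"
    if x1: "x1 \<in> sections M (\<lambda>p. span (range (gen p)))" and x2: "x2 \<in> sections M (\<lambda>p. span (range (gen p)))"
      and y: "is_courant_bracket M \<eta> x1 x2 y" for x1 x2 y
  proof -
    define u1 u2 a1 a2 where "u1 p = vpart (x1 p) p" and "u2 p = vpart (x2 p) p"
      and "a1 p = cpart (x1 p) p" and "a2 p = cpart (x2 p) p" for p
    \<comment> \<open>By \<open>rec\<close> these are the parameters of the two sections. The
      formula is linear in the parts, so the parameters are differentiable.\<close>
    define z1 z2 where "z1 p = a1 p + \<kappa> *\<^sub>R u1 p" and "z2 p = a2 p + \<kappa> *\<^sub>R u2 p" for p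
    have s: "smooth_section_on M UNIV x1" "smooth_section_on M UNIV x2" using x1 x2 by (auto simp: sections_def)
    have "x1 p \<in> range (gen p)" "x2 p \<in> range (gen p)" for p using x1 x2 by (auto simp: sections_def E)
    then have xg: "x1 p = gen p (z1 p)" "x2 p = gen p (z2 p)" for p
      by (metis (no_types, lifting) a1_def u1_def z1_def vgen cgen rec imageE)
        (metis (no_types, lifting) \<open>\<And>p. x2 p \<in> range (gen p)\<close> a2_def u2_def z2_def vgen cgen rec imageE)
    have uz: "u1 p = U p (z1 p)" "u2 p = U p (z2 p)" "a1 p = K p (z1 p)" "a2 p = K p (z2 p)" for p
      using vgen[of p "z1 p"] vgen[of p "z2 p"] cgen[of p "z1 p"] cgen[of p "z2 p"]
      by (simp_all add: xg[symmetric] u1_def u2_def a1_def a2_def)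
    have fx: "fst (x1 p) = X (U p (z1 p)) p" "fst (x2 p) = X (U p (z2 p)) p" for p
      by (simp_all add: xg gen_def fst_elt)
    have "\<exists>\<xi>. y p = gen p \<xi>" for p
    proof -
      let ?y = "coord M p p"
      have "\<exists>D. ((\<lambda>z. cpart (x (chart_inv M p z)) (chart_inv M p z) + \<kappa> *\<^sub>R vpart (x (chart_inv M p z)) (chart_inv M p z)) has_derivative D) (at ?y)"
        if "smooth_section_on M UNIV x" for x
        using has_derivative_add[OF Ck_near_has_derivative[OF smooth_section_parts(2)[OF that coord_self(2)[OF cM]]]
          has_derivative_scaleR_right[OF Ck_near_has_derivative[OF smooth_section_parts(1)[OF that coord_self(2)[OF cM]]]]] by blast
      then obtain d1 d2 where d: "((\<lambda>z. z1 (chart_inv M p z)) has_derivative d1) (at ?y)" "((\<lambda>z. z2 (chart_inv M p z)) has_derivative d2) (at ?y)"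
        using s unfolding z1_def z2_def u1_def u2_def a1_def a2_def by meson
      have mU: "mder u1 p v = U p (d1 v) + U' p (z1 p) v" "mder u2 p v = U p (d2 v) + U' p (z2 p) v"
        "mder a1 p v = K p (d1 v) + K' p (z1 p) v" "mder a2 p v = K p (d2 v) + K' p (z2 p) v" for v
        unfolding uz
        using linear_family_derivative[OF linU dU d(1)] linear_family_derivative[OF linU dU d(2)]
          linear_family_derivative[OF linK dK d(1)] linear_family_derivative[OF linK dK d(2)]
        by (metis (no_types, lifting) frechet_derivative_at)+
      let ?v1 = "X (U p (z1 p)) p" and ?v2 = "X (U p (z2 p)) p"
      \<comment> \<open>The parameter of the bracket: \<open>lb\<close> for frozen parameters,
        corrected by the derivatives of each parameter along the other vector field.\<close>
      define \<zeta> where "\<zeta> = d2 ?v1 - d1 ?v2 + lb (z1 p) (z2 p)"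
      note cf = courant_in_frame[OF y \<eta>(2) s, of p, folded u1_def u2_def a1_def a2_def, unfolded mU fx]
      have "vpart (y p) p = U p \<zeta>"
        unfolding cf(1) uz \<zeta>_def linear_add[OF linU] linear_diff[OF linU] T1[symmetric] by simp
      moreover have "cpart (y p) p = K p \<zeta>"
      proof (rule B_eqI)
        fix \<omega>
        define w where "w = X \<omega> p"
        have \<omega>: "\<omega> = \<theta> p w" by (simp add: w_def)
        \<comment> \<open>The covector part also contains the derivative of the first parameter
          along the test vector; isotropy removes these terms.\<close>
        have i: "B (K p (z2 p)) (U p (d1 w)) + B (K p (d1 w)) (U p (z2 p)) = 0" by (rule iso)
        show "B (cpart (y p) p) \<omega> = B (K p \<zeta>) \<omega>"
          unfolding \<omega> cf(2) uz \<zeta>_def linear_add[OF linK] linear_diff[OF linK] Bs T2[symmetric] using i by simp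
      qed
      ultimately have "y p = gen p \<zeta>" using elt_parts[of p "y p"] by (simp add: gen_def)
      then show ?thesis by blast
    qed
    then have "y p \<in> range (gen p)" for p by blast
    then show ?thesis using y by (simp add: sections_def is_courant_bracket_def E)
  qed
  ultimately show ?thesis unfolding dirac_manifold_def using M \<eta> by blast
qed

end

section \<open>The Cartan-Dirac structure and the linear Poisson structure as framed
  examples\<close>

context lie_grp_form begin

sublocale GF: framed_manifold G "left_mc G" "left_inv_vf G" "lie_bracket G" B
proof (rule framed_manifold.intro)
  show "smooth_manifold G" by (rule sm)
  show "Ck_near k (\<lambda>y. \<theta> (chart_inv G q y) (from_chart G q (chart_inv G q y) w)) y" if "y \<in> chart_img G q" for y q k w
    using Ck_near_mc_rep[OF that] by (simp add: mc_rep_def[abs_def])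
  show "Ck_near k (vf_rep G (lvf \<xi>) q) y" if y: "y \<in> chart_img G q" for y q k \<xi>
    using Ck_near_lvf[OF Ck_at_chart_inv[OF sm y] coord_chart_inv(2)[OF cs y] Ck_near_const]
    by (simp add: vf_rep_def[abs_def] Let_def)
  show "frechet_derivative (\<lambda>y. \<theta> (chart_inv G p y) (from_chart G p (chart_inv G p y) w)) (at (coord G p p)) v
      - frechet_derivative (\<lambda>y. \<theta> (chart_inv G p y) (from_chart G p (chart_inv G p y) v)) (at (coord G p p)) w
      = - \<lbrakk>\<theta> p v, \<theta> p w\<rbrakk>" for p v w
    using mc_rep_maurer_cartan[OF coord_self(2)[OF cs], of p w v]
    by (simp add: mc_rep_def[abs_def] coord_self(1)[OF cs] from_chart_self[OF sm])
qed (simp_all add: linear_left_mc linear_lvf bounded_bilinear_B B_sym B_nondegenerate)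

lemma B_flip: "B x \<lbrakk>y, w\<rbrakk> = B w \<lbrakk>x, y\<rbrakk>" "B x \<lbrakk>w, y\<rbrakk> = B w \<lbrakk>y, x\<rbrakk>"
  using B_cyclic[of x y w] B_cyclic[of y w x] B_cyclic[of x w y] by simp_all

lemma B_Ad_ivs: "B (Adj (ivs g) x) y = B x (Adj g y)" "B x (Adj (ivs g) y) = B (Adj g x) y"
  using B_Ad[of "ivs g" x "Adj g y"] B_Ad[of "ivs g" "Adj g x" y] by simp_all

lemma cartan_dirac_gen_eq:
  "cartan_dirac_gen G B \<xi> p = GF.elt p (\<xi> - Adj (ivs p) \<xi>) ((1 / 2) *\<^sub>R (\<xi> + Adj (ivs p) \<xi>))"
proof -
  have "B (\<theta> p v) ((1 / 2) *\<^sub>R (\<xi> + Adj (ivs p) \<xi>)) = B ((1 / 2) *\<^sub>R (\<theta> p v + right_mc G p v)) \<xi>" for v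
    by (simp add: B_simps right_mc_eq B_Ad_ivs)
  then show ?thesis
    by (simp add: GF.elt_def cartan_dirac_gen_def linear_diff[OF linear_lvf] right_inv_vf_eq)
qed

lemma dirac_manifold_cartan: "dirac_manifold G (cartan_dirac G B) (cartan_form G B)"
proof -
  define U where "U p \<xi> = \<xi> - Adj (ivs p) \<xi>" for p \<xi>
  define K where "K p \<xi> = (1 / 2) *\<^sub>R (\<xi> + Adj (ivs p) \<xi>)" for p \<xi>
  define U' where "U' p \<xi> v = \<lbrakk>\<theta> p v, Adj (ivs p) \<xi>\<rbrakk>" for p \<xi> v
  define K' where "K' p \<xi> v = - (1 / 2) *\<^sub>R \<lbrakk>\<theta> p v, Adj (ivs p) \<xi>\<rbrakk>" for p \<xi> v
  have gen: "GF.elt p (U p \<xi>) (K p \<xi>) = cartan_dirac_gen G B \<xi> p" for p \<xi>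
    by (simp add: cartan_dirac_gen_eq U_def K_def)
  have sA: "Ck_near k (\<lambda>y. Adj (ivs (chart_inv G q y)) \<xi>) y" if "y \<in> chart_img G q" for q y k \<xi>
    using Ck_at_Ad[OF csE Ck_at_ivs[OF csE Ck_at_chart_inv[OF sm that]]] by simp
  have dA: "((\<lambda>z. Adj (ivs (chart_inv G p z)) \<xi>) has_derivative (\<lambda>v. - \<lbrakk>\<theta> p v, Adj (ivs p) \<xi>\<rbrakk>)) (at (coord G p p))" for p \<xi>
    using has_mderiv_Ad_ivs_of[OF cs has_lderivI[OF cs has_mderiv_id[OF cs]]] by (simp add: has_mderiv_def)
  have "dirac_manifold G (\<lambda>p. span (range (\<lambda>\<xi>. GF.elt p (U p \<xi>) (K p \<xi>)))) (cartan_form G B)"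
  proof (rule GF.dirac_manifold_of_frame[where \<kappa>="1 / 2" and U'=U' and K'=K' and lb="lie_bracket G"])
    show "linear (U p)" "linear (K p)" for p
      by (auto intro!: linearI simp: U_def K_def linear_add[OF linear_Ad] linear_scale[OF linear_Ad] algebra_simps)
    show "K p \<xi> + (1 / 2) *\<^sub>R U p \<xi> = \<xi>" for p \<xi>
      by (simp add: U_def K_def algebra_simps) (simp add: scaleR_add_left[symmetric])
    show "B (K p \<xi>) (U p \<zeta>) + B (K p \<zeta>) (U p \<xi>) = 0" for p \<xi> \<zeta>
      using B_sym[of \<xi> \<zeta>] B_sym[of "Adj (ivs p) \<xi>" \<zeta>] B_sym[of "Adj (ivs p) \<zeta>" \<xi>] B_Ad[of "ivs p" \<zeta> \<xi>] B_Ad[of "ivs p" \<xi> \<zeta>]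
      by (simp add: U_def K_def B_simps field_simps)
    show "\<exists>\<xi>. u = U p \<xi> \<and> a = K p \<xi>" if h: "\<And>\<zeta>. B a (U p \<zeta>) + B (K p \<zeta>) u = 0" for p u a
    proof -
      \<comment> \<open>Orthogonality to all generators, with \<open>Ad\<close> moved across
        \<open>B\<close>. It says that the inverse of \<open>Ad\<close> takes
        \<open>a + u / 2\<close> to \<open>a - u / 2\<close>, exactly what makes
        \<open>a + u / 2\<close> the parameter of the pair.\<close>
      have "a - Adj p a + (1 / 2) *\<^sub>R (u + Adj p u) = 0"
      proof (rule B_nondegenerate)
        fix \<zeta> show "B (a - Adj p a + (1 / 2) *\<^sub>R (u + Adj p u)) \<zeta> = 0"
          using h[of \<zeta>] B_sym[of \<zeta> u] B_sym[of "Adj (ivs p) \<zeta>" u] by (simp add: U_def K_def B_simps B_Ad_ivs algebra_simps)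
      qed
      then have "Adj (ivs p) (a - Adj p a + (1 / 2) *\<^sub>R (u + Adj p u)) = 0" by (simp add: linear_0[OF linear_Ad])
      then have e: "Adj (ivs p) a + (1 / 2) *\<^sub>R Adj (ivs p) u = a - (1 / 2) *\<^sub>R u"
        by (simp add: linear_add[OF linear_Ad] linear_diff[OF linear_Ad] linear_scale[OF linear_Ad] algebra_simps)
      have e': "Adj (ivs p) (a + (1 / 2) *\<^sub>R u) = a - (1 / 2) *\<^sub>R u"
        by (simp add: linear_add[OF linear_Ad] linear_scale[OF linear_Ad] e)
      have "u = U p (a + (1 / 2) *\<^sub>R u)" "a = K p (a + (1 / 2) *\<^sub>R u)"
        unfolding U_def K_def e' by (simp_all add: algebra_simps scaleR_add_left[symmetric])
      then show ?thesis by blast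
    qed
    show "Ck_near k (\<lambda>y. U (chart_inv G q y) \<xi>) y" if y: "y \<in> chart_img G q" for q y k \<xi>
    proof -
      have "Ck_near k (\<lambda>y. \<xi> + (-1) *\<^sub>R Adj (ivs (chart_inv G q y)) \<xi>) y"
        by (intro Ck_near_add Ck_near_scaleR Ck_near_const sA y)
      then show ?thesis by (simp add: U_def)
    qed
    show "Ck_near k (\<lambda>y. K (chart_inv G q y) \<xi>) y" if y: "y \<in> chart_img G q" for q y k \<xi>
      unfolding K_def by (intro Ck_near_add Ck_near_scaleR Ck_near_const sA y)
    show "((\<lambda>z. U (chart_inv G p z) \<xi>) has_derivative U' p \<xi>) (at (coord G p p))" for p \<xi>
      unfolding U_def U'_def by (rule has_derivative_eq_rhs[OF has_derivative_diff[OF has_derivative_const dA]]) auto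
    show "((\<lambda>z. K (chart_inv G p z) \<xi>) has_derivative K' p \<xi>) (at (coord G p p))" for p \<xi>
      unfolding K_def K'_def by (rule has_derivative_eq_rhs[OF has_derivative_scaleR_right[OF has_derivative_add[OF has_derivative_const dA]]]) auto
    show "smooth_form G (cartan_form G B)" by (rule smooth_cartan_form)
    show "has_degree (cartan_form G B) 3" by (rule has_degree_cartan_form)
    show "ext_deriv G (cartan_form G B) p vs = 0" for p vs by (rule ext_deriv_cartan_form)
    show "U' p \<zeta> (lvf (U p \<xi>) p) - U' p \<xi> (lvf (U p \<zeta>) p) + \<lbrakk>U p \<xi>, U p \<zeta>\<rbrakk> = U p \<lbrakk>\<xi>, \<zeta>\<rbrakk>" for p \<xi> \<zeta>
      using lie_bracket_antisym[of \<zeta> "Adj (ivs p) \<xi>"] lie_bracket_antisym[of "Adj (ivs p) \<zeta>" "Adj (ivs p) \<xi>"]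
      by (simp add: U'_def U_def brk_simps Ad_lie_bracket)
    show "B (K p \<zeta>) (U' p \<xi> w) + B (K' p \<xi> w) (U p \<zeta>)
       + B (K' p \<zeta> (lvf (U p \<xi>) p) - K' p \<xi> (lvf (U p \<zeta>) p)) (\<theta> p w)
       - B (K p \<zeta>) \<lbrakk>U p \<xi>, \<theta> p w\<rbrakk> + B (K p \<xi>) \<lbrakk>U p \<zeta>, \<theta> p w\<rbrakk>
       - cartan_form G B p [lvf (U p \<xi>) p, lvf (U p \<zeta>) p, w] = B (K p \<lbrakk>\<xi>, \<zeta>\<rbrakk>) (\<theta> p w)" for p \<xi> \<zeta> w
    proof -
      define x1 x2 z1 z2 \<omega> where d: "x1 = \<xi>" "x2 = \<zeta>" "z1 = Adj (ivs p) \<xi>" "z2 = Adj (ivs p) \<zeta>" "\<omega> = \<theta> p w"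
      let ?u1 = "x1 - z1" and ?u2 = "x2 - z2" and ?a1 = "(1/2) *\<^sub>R (x1 + z1)" and ?a2 = "(1/2) *\<^sub>R (x2 + z2)"
      \<comment> \<open>With \<open>\<omega>\<close> isolated in the first slot of \<open>B\<close>
        and the brackets in a fixed order, the identity reduces to comparing coefficients.\<close>
      have f: "B x \<lbrakk>y, \<omega>\<rbrakk> = B \<omega> \<lbrakk>x, y\<rbrakk>" "B x \<lbrakk>\<omega>, y\<rbrakk> = B \<omega> \<lbrakk>y, x\<rbrakk>" "B \<lbrakk>\<omega>, y\<rbrakk> x = B \<omega> \<lbrakk>y, x\<rbrakk>" for x y
        using B_flip(1)[of x y \<omega>] B_flip(2)[of x \<omega> y] B_sym[of "\<lbrakk>\<omega>, y\<rbrakk>" x] by simp_all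
      have as: "\<lbrakk>z1, x1\<rbrakk> = - \<lbrakk>x1, z1\<rbrakk>" "\<lbrakk>z2, x1\<rbrakk> = - \<lbrakk>x1, z2\<rbrakk>" "\<lbrakk>z1, x2\<rbrakk> = - \<lbrakk>x2, z1\<rbrakk>" "\<lbrakk>z2, x2\<rbrakk> = - \<lbrakk>x2, z2\<rbrakk>"
        "\<lbrakk>x2, x1\<rbrakk> = - \<lbrakk>x1, x2\<rbrakk>" "\<lbrakk>z2, z1\<rbrakk> = - \<lbrakk>z1, z2\<rbrakk>" by (rule lie_bracket_antisym)+
      have s: "B \<lbrakk>x, y\<rbrakk> \<omega> = B \<omega> \<lbrakk>x, y\<rbrakk>" for x y by (rule B_sym)
      have "B ?a2 \<lbrakk>\<omega>, z1\<rbrakk> + B (- (1/2) *\<^sub>R \<lbrakk>\<omega>, z1\<rbrakk>) ?u2 + B (- (1/2) *\<^sub>R \<lbrakk>?u1, z2\<rbrakk> - - (1/2) *\<^sub>R \<lbrakk>?u2, z1\<rbrakk>) \<omega>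
        - B ?a2 \<lbrakk>?u1, \<omega>\<rbrakk> + B ?a1 \<lbrakk>?u2, \<omega>\<rbrakk> - 1/2 * B ?u1 \<lbrakk>?u2, \<omega>\<rbrakk> = B ((1/2) *\<^sub>R (\<lbrakk>x1, x2\<rbrakk> + \<lbrakk>z1, z2\<rbrakk>)) \<omega>"
        by (simp add: B_simps brk_simps f s as field_simps)
      then show ?thesis
        by (simp add: U'_def K'_def U_def K_def cartan_form_eq3 cartan3_def Ad_lie_bracket d)
    qed
  qed
  then show ?thesis by (simp add: gen cartan_dirac_def[abs_def])
qed

sublocale EF: framed_manifold "\<E> :: ('a, 'a) charts" "\<lambda>_ v. v" "\<lambda>\<xi> _. \<xi>" "\<lambda>_ _. 0" B
proof (rule framed_manifold.intro)
  show "Ck_near k (vf_rep \<E> (\<lambda>_. \<xi>) q) y" for k \<xi> q and y :: 'a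
    by (simp add: vf_rep_def[abs_def] Let_def Ck_near_const)
qed (simp_all add: smE Ck_near_const frechet_derivative_const bounded_bilinear_B B_sym B_nondegenerate linear_id[unfolded id_def])

lemma lie_alg_dirac_gen_eq: "lie_alg_dirac_gen G B \<xi> \<nu> = EF.elt \<nu> (- \<lbrakk>\<xi>, \<nu>\<rbrakk>) \<xi>"
  by (simp add: EF.elt_def lie_alg_dirac_gen_def)

text \<open>The covector part of a generator is its parameter, hence \<open>\<kappa>\<close> is 0.
  The vector condition is the Jacobi identity and the covector condition is invariance of
  \<open>B\<close>.\<close>

lemma dirac_manifold_lie_alg: "dirac_manifold \<E> (lie_alg_dirac G B) (\<lambda>_ _. 0)"
proof -
  define U where "U p \<xi> = - \<lbrakk>\<xi>, p\<rbrakk>" for p \<xi>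
  have gen: "EF.elt p (U p \<xi>) \<xi> = lie_alg_dirac_gen G B \<xi> p" for p \<xi>
    by (simp add: lie_alg_dirac_gen_eq U_def)
  have "dirac_manifold \<E> (\<lambda>p. span (range (\<lambda>\<xi>. EF.elt p (U p \<xi>) \<xi>))) (\<lambda>_ _. 0)"
  proof (rule EF.dirac_manifold_of_frame[where \<kappa>=0 and K="\<lambda>_ \<xi>. \<xi>" and U'="\<lambda>p \<xi> v. - \<lbrakk>\<xi>, v\<rbrakk>" and K'="\<lambda>_ _ _. 0" and lb="lie_bracket G"])
    show "linear (U p)" for p by (auto intro!: linearI simp: U_def brk_simps)
    show "B \<xi> (U p \<zeta>) + B \<zeta> (U p \<xi>) = 0" for p \<xi> \<zeta>
      using B_flip(1)[of \<xi> \<zeta> p] B_flip(1)[of \<zeta> \<xi> p] lie_bracket_antisym[of \<xi> \<zeta>] by (simp add: U_def B_simps)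
    show "\<exists>\<xi>. u = U p \<xi> \<and> a = \<xi>" if h: "\<And>\<zeta>. B a (U p \<zeta>) + B \<zeta> u = 0" for p u a
    proof -
      have "u + \<lbrakk>a, p\<rbrakk> = 0"
      proof (rule B_nondegenerate)
        fix \<zeta> show "B (u + \<lbrakk>a, p\<rbrakk>) \<zeta> = 0"
          using h[of \<zeta>] B_flip(2)[of a \<zeta> p] lie_bracket_antisym[of a p] B_sym[of u \<zeta>] B_sym[of "\<lbrakk>a, p\<rbrakk>" \<zeta>]
          by (simp add: U_def B_simps)
      qed
      then show ?thesis by (simp add: U_def eq_neg_iff_add_eq_0)
    qed
    show "Ck_near k (\<lambda>y. U (chart_inv \<E> q y) \<xi>) y" for q y k \<xi>
    proof -
      have "linear (\<lambda>p. U p \<xi>)" by (auto intro!: linearI simp: U_def brk_simps)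
      then show ?thesis by (simp add: Ck_near_linear)
    qed
    show "((\<lambda>z. U (chart_inv \<E> p z) \<xi>) has_derivative (\<lambda>v. - \<lbrakk>\<xi>, v\<rbrakk>)) (at (coord \<E> p p))" for p \<xi>
      unfolding U_def euclidean_charts_simps
      by (intro has_derivative_minus bounded_linear_imp_has_derivative
          bounded_bilinear.bounded_linear_right[OF bounded_bilinear_lie_bracket])
    show "smooth_form \<E> (\<lambda>_ _. 0 :: real)"
      by (auto simp: smooth_form_def alternating_def linear_zero_fun smooth_on_def Ck_on_const)
    show "has_degree (\<lambda>_ _. 0 :: real) 3" by (simp add: has_degree_def)
    show "ext_deriv \<E> (\<lambda>_ _. 0 :: real) p vs = 0" for p vs by (simp add: ext_deriv_def frechet_derivative_const)
    show "- \<lbrakk>\<zeta>, U p \<xi>\<rbrakk> - - \<lbrakk>\<xi>, U p \<zeta>\<rbrakk> + 0 = U p \<lbrakk>\<xi>, \<zeta>\<rbrakk>" for p \<xi> \<zeta>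
      using jacobi[of \<xi> \<zeta> p] by (simp add: U_def brk_simps)
    show "B \<zeta> (- \<lbrakk>\<xi>, w\<rbrakk>) + B 0 (U p \<zeta>) + B (0 - 0) w - B \<zeta> 0 + B \<xi> 0 - 0 = B \<lbrakk>\<xi>, \<zeta>\<rbrakk> w" for p \<xi> \<zeta> w
      by (simp add: B_simps B_ad)
  qed (auto simp: Ck_near_const linear_id[unfolded id_def])
  then show ?thesis by (simp add: gen lie_alg_dirac_def[abs_def])
qed

end

section \<open>The exponential map as a Dirac morphism\<close>

context lie_grp begin

lemma Ad_Exp_neg_has_vector_derivative:
  "((\<lambda>t. Adj (Exp ((- t) *\<^sub>R \<nu>)) w) has_vector_derivative - \<lbrakk>\<nu>, Adj (Exp ((- t) *\<^sub>R \<nu>)) w\<rbrakk>) (at t within S)"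
  using has_vector_derivative_at_within[OF Ad_Exp_has_vector_derivative[of "- \<nu>" w t]] by (simp add: brk_simps)

text \<open>The substitution \<open>u = (1 - s) * t\<close> moves \<open>t\<close> from the
  integrand to the upper limit, where it can be differentiated.\<close>

lemma dexp_scale_eq_integral:
  assumes t: "t \<in> {0..1}"
  shows "dexp (t *\<^sub>R \<nu>) (t *\<^sub>R w) = integral {0..t} (\<lambda>s. Adj (Exp ((- s) *\<^sub>R \<nu>)) w)"
proof -
  let ?h = "\<lambda>s. Adj (Exp ((- s) *\<^sub>R \<nu>)) w"
  let ?F = "\<lambda>u. integral {0..u} ?h"
  have hc: "continuous_on {0..1} ?h"
    using continuous_Ad_Exp_line[of "{0..1}" "- \<nu>" w] by simp
  have F: "(?F has_vector_derivative ?h u) (at u within {0..1})" if "u \<in> {0..1}" for u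
    by (rule integral_has_vector_derivative[OF hc that])
  have "((\<lambda>s. t *\<^sub>R ?h ((1 - s) * t)) has_integral (- ?F ((1 - 1) * t) - - ?F ((1 - 0) * t))) {0..1}"
  proof (rule fundamental_theorem_of_calculus)
    fix s :: real assume s: "s \<in> {0..1}"
    have st: "(1 - s) * t \<in> {0..1}" using s t by (auto intro: mult_le_one)
    have i: "((\<lambda>s. (1 - s) * t) has_vector_derivative - t) (at s within {0..1})"
      by (auto intro!: derivative_eq_intros)
    have "(\<lambda>s. (1 - s) * t) ` {0..1} \<subseteq> {0..1}" using t by (auto intro!: mult_le_one)
    then have "(?F has_vector_derivative ?h ((1 - s) * t)) (at ((1 - s) * t) within (\<lambda>s. (1 - s) * t) ` {0..1})"
      using F[OF st] has_vector_derivative_within_subset by blast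
    from vector_diff_chain_within[OF i this]
    have "((\<lambda>s. ?F ((1 - s) * t)) has_vector_derivative (- t) *\<^sub>R ?h ((1 - s) * t)) (at s within {0..1})" by (simp add: o_def)
    then show "((\<lambda>s. - ?F ((1 - s) * t)) has_vector_derivative t *\<^sub>R ?h ((1 - s) * t)) (at s within {0..1})"
      using has_vector_derivative_minus by fastforce
  qed simp
  from integral_unique[OF this] have "integral {0..1} (\<lambda>s. t *\<^sub>R ?h ((1 - s) * t)) = ?F t" by simp
  moreover have "- ((1 - s) * t) = (s - 1) * t" for s by (simp add: algebra_simps)
  ultimately show ?thesis by (simp add: dexp_def linear_scale[OF linear_Ad])
qed

lemma dexp_scale_has_vector_derivative:
  assumes t: "t \<in> {0..1}"
  shows "((\<lambda>t. dexp (t *\<^sub>R \<nu>) (t *\<^sub>R w)) has_vector_derivative Adj (Exp ((- t) *\<^sub>R \<nu>)) w) (at t within {0..1})"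
proof -
  have "continuous_on {0..1} (\<lambda>s. Adj (Exp ((- s) *\<^sub>R \<nu>)) w)"
    using continuous_Ad_Exp_line[of "{0..1}" "- \<nu>" w] by simp
  from integral_has_vector_derivative[OF this t] show ?thesis
    by (rule has_vector_derivative_transform[OF t, rotated]) (simp add: dexp_scale_eq_integral)
qed

lemma constant_on_unit_interval:
  fixes f :: "real \<Rightarrow> 'b::real_normed_vector"
  assumes "\<And>t. t \<in> {0..1} \<Longrightarrow> (f has_vector_derivative 0) (at t within {0..1})" "t \<in> {0..1}"
  shows "f t = f 0"
proof -
  obtain c where "\<And>t. t \<in> {0..1} \<Longrightarrow> f t = c"
    using has_derivative_zero_constant[of "{0..1::real}" f] assms(1) by (auto simp: has_vector_derivative_def)
  then show ?thesis using assms(2) by simp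
qed

lemma Ad_Exp_bracket: "Adj (Exp (t *\<^sub>R \<nu>)) \<lbrakk>\<nu>, w\<rbrakk> = \<lbrakk>\<nu>, Adj (Exp (t *\<^sub>R \<nu>)) w\<rbrakk>"
  by (simp add: Ad_lie_bracket Ad_Exp_self)

text \<open>This is \<open>ad \<nu>\<close> times the quotient
  \<open>(1 - exp (- t ad \<nu>)) / ad \<nu>\<close>. As \<open>ad \<nu>\<close> is never invertible
  for nonzero \<open>\<nu>\<close>, it is obtained by differentiation in \<open>t\<close> from the
  common value at 0.\<close>

lemma bracket_dexp:
  assumes t: "t \<in> {0..1}"
  shows "\<lbrakk>\<nu>, dexp (t *\<^sub>R \<nu>) (t *\<^sub>R w)\<rbrakk> = w - Adj (Exp ((- t) *\<^sub>R \<nu>)) w"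
proof -
  have "((\<lambda>t. \<lbrakk>\<nu>, dexp (t *\<^sub>R \<nu>) (t *\<^sub>R w)\<rbrakk> + Adj (Exp ((- t) *\<^sub>R \<nu>)) w) has_vector_derivative 0) (at t within {0..1})"
    if "t \<in> {0..1}" for t
    using has_vector_derivative_add[OF bounded_linear.has_vector_derivative[OF
        bounded_bilinear.bounded_linear_right[OF bounded_bilinear_lie_bracket, of \<nu>] dexp_scale_has_vector_derivative[OF that, of \<nu> w]]
        Ad_Exp_neg_has_vector_derivative[of \<nu> w]] by simp
  from constant_on_unit_interval[OF this t] show ?thesis
    by (simp add: brk_simps linear_0[OF linear_dexp] Ad_one algebra_simps)
qed

text \<open>The same product in the other order, at time 1. It is the vector half of the relation
  between the generators of the two structures.\<close>

lemma dexp_bracket: "dexp \<nu> \<lbrakk>\<nu>, w\<rbrakk> = w - Adj (Exp (- \<nu>)) w"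
proof -
  have "((\<lambda>t. dexp (t *\<^sub>R \<nu>) (t *\<^sub>R \<lbrakk>\<nu>, w\<rbrakk>) + Adj (Exp ((- t) *\<^sub>R \<nu>)) w) has_vector_derivative 0) (at t within {0..1})"
    if "t \<in> {0..1}" for t
    using has_vector_derivative_add[OF dexp_scale_has_vector_derivative[OF that, of \<nu> "\<lbrakk>\<nu>, w\<rbrakk>"] Ad_Exp_neg_has_vector_derivative[of \<nu> w]]
    by (simp only: Ad_Exp_bracket add.right_inverse)
  from constant_on_unit_interval[OF this, of 1] show ?thesis
    by (simp add: brk_simps linear_0[OF linear_dexp] Ad_one algebra_simps)
qed

lemma tangent_map_Exp: "tangent_map \<E> G Exp \<nu> v = lvf (dexp \<nu> v) (Exp \<nu>)"
  using lvf_left_mc[of "Exp \<nu>" "tangent_map \<E> G Exp \<nu> v"] by (simp add: dexp_eq)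

text \<open>Injectivity is stable: \<open>c\<close> bounds \<open>dexp \<nu>\<close> from below, and
  \<open>S \<mu>\<close> bounds the change from \<open>\<nu>\<close> to \<open>\<mu>\<close>. In
  finite dimension an injective endomorphism is bijective.\<close>

lemma open_exp_regular: "open (exp_regular G)"
  unfolding open_subopen[of "exp_regular G"]
proof
  fix \<nu> assume "\<nu> \<in> exp_regular G"
  then have "bij (\<lambda>v. lvf (dexp \<nu> v) (Exp \<nu>))"
    by (simp add: exp_regular_def tangent_map_Exp[symmetric])
  then have "inj (dexp \<nu>)" by (auto simp: bij_def inj_def)
  then obtain c where c: "c > 0" "\<And>v. c * norm v \<le> norm (dexp \<nu> v)"
    using linear_inj_bounded_below_pos[OF linear_dexp] by metis
  define S where "S \<mu> = (\<Sum>b\<in>Basis. norm (dexp \<mu> b - dexp \<nu> b))" for \<mu>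
  have "isCont S \<mu>" for \<mu>
    unfolding S_def using Ck_near_imp_isCont[OF smooth_dexp] by (intro continuous_intros) auto
  then have "open (S -` {..<c})"
    by (intro open_vimage) (auto intro: continuous_at_imp_continuous_on)
  moreover have "\<nu> \<in> S -` {..<c}" using c by (simp add: S_def)
  moreover have "S -` {..<c} \<subseteq> exp_regular G"
  proof
    fix \<mu> assume \<mu>: "\<mu> \<in> S -` {..<c}"
    have lin: "linear (tangent_map \<E> G Exp \<mu>)"
      using Ck_at_has_mderiv[OF smooth_Exp] has_mderiv_linear by blast
    have "v = 0" if v: "tangent_map \<E> G Exp \<mu> v = 0" for v
    proof (rule ccontr)
      assume "v \<noteq> 0"
      have "dexp \<mu> v = 0" using v dexp_eq[of \<mu> v] linear_0[OF linear_left_mc] by simp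
      have "linear (\<lambda>v. dexp \<mu> v - dexp \<nu> v)" by (intro linear_compose_sub linear_dexp)
      from linear_expand[OF this, of v]
      have "norm (dexp \<mu> v - dexp \<nu> v) \<le> (\<Sum>b\<in>Basis. norm v * norm (dexp \<mu> b - dexp \<nu> b))"
        by (auto intro!: sum_norm_le simp: Basis_le_norm mult_right_mono)
      also have "\<dots> = S \<mu> * norm v" by (simp add: S_def sum_distrib_left mult.commute)
      also have "\<dots> < c * norm v" using \<mu> \<open>v \<noteq> 0\<close> by simp
      finally show False using c(2)[of v] \<open>dexp \<mu> v = 0\<close> by simp
    qed
    then have "inj (tangent_map \<E> G Exp \<mu>)" using linear_injective_0[OF lin] by blast
    then show "\<mu> \<in> exp_regular G"
      using linear_inj_imp_surj[OF lin] by (simp add: exp_regular_def bij_def)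
  qed
  ultimately show "\<exists>T. open T \<and> \<nu> \<in> T \<and> T \<subseteq> exp_regular G" by blast
qed

end

section \<open>Related generators and the forward image\<close>

context lie_grp_form begin

text \<open>The covector half of the relation between generators. By invariance and
  \<open>bracket_dexp\<close> the bracket in the integrand becomes a difference of brackets with
  \<open>\<nu>\<close>, which are derivatives in \<open>t\<close>.\<close>

lemma varpi2_bracket:
  "varpi2 \<nu> \<lbrakk>\<nu>, \<xi>\<rbrakk> w = B ((1 / 2) *\<^sub>R (\<xi> + Adj (Exp (- \<nu>)) \<xi>)) (dexp \<nu> w) - B \<xi> w"
proof -
  let ?A = "\<lambda>t w. Adj (Exp ((- t) *\<^sub>R \<nu>)) w" and ?S = "\<lambda>t. dexp (t *\<^sub>R \<nu>) (t *\<^sub>R w)"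
  \<comment> \<open>The derivative of the first term exceeds the integrand by the constant
    \<open>B \<xi> w\<close>, because invariance removes \<open>Ad\<close> from a product in which
    it acts on both entries; the linear term compensates this.\<close>
  let ?F = "\<lambda>t. B ((1 / 2) *\<^sub>R (\<xi> + ?A t \<xi>)) (?S t) - t * B \<xi> w"
  have "(varpi_integrand \<lbrakk>\<nu>, \<xi>\<rbrakk> w \<nu> has_integral ?F 1 - ?F 0) {0..1}"
  proof (rule fundamental_theorem_of_calculus)
    fix t :: real assume t: "t \<in> {0..1}"
    let ?v = "dexp (t *\<^sub>R \<nu>) (t *\<^sub>R \<lbrakk>\<nu>, \<xi>\<rbrakk>)"
    have "varpi_integrand \<lbrakk>\<nu>, \<xi>\<rbrakk> w \<nu> t = 1 / 2 * B \<nu> \<lbrakk>?v, ?S t\<rbrakk>"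
      by (simp add: varpi_integrand_def cartan3_def dexp_self)
    also have "B \<nu> \<lbrakk>?v, ?S t\<rbrakk> = B \<lbrakk>\<nu>, ?v\<rbrakk> (?S t)"
      using B_flip(1)[of \<nu> ?v "?S t"] B_sym by simp
    also have "\<lbrakk>\<nu>, ?v\<rbrakk> = \<lbrakk>\<nu>, \<xi>\<rbrakk> - \<lbrakk>\<nu>, ?A t \<xi>\<rbrakk>" by (simp only: bracket_dexp[OF t] Ad_Exp_bracket)
    finally have I: "varpi_integrand \<lbrakk>\<nu>, \<xi>\<rbrakk> w \<nu> t = 1 / 2 * B \<lbrakk>\<nu>, \<xi>\<rbrakk> (?S t) - 1 / 2 * B \<lbrakk>\<nu>, ?A t \<xi>\<rbrakk> (?S t)"
      by (simp add: B_simps algebra_simps)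
    have J: "B \<lbrakk>\<nu>, \<xi>\<rbrakk> (?S t) = B \<xi> (?A t w) - B \<xi> w"
      by (simp only: B_ad bracket_dexp[OF t] B_simps)
    have dA: "((\<lambda>t. (1 / 2) *\<^sub>R (\<xi> + ?A t \<xi>)) has_vector_derivative (1 / 2) *\<^sub>R (0 + - \<lbrakk>\<nu>, ?A t \<xi>\<rbrakk>)) (at t within {0..1})"
      by (intro bounded_linear.has_vector_derivative[OF bounded_linear_scaleR_right] has_vector_derivative_add
          has_vector_derivative_const Ad_Exp_neg_has_vector_derivative)
    have "(?F has_vector_derivative (B ((1 / 2) *\<^sub>R (\<xi> + ?A t \<xi>)) (?A t w) + B ((1 / 2) *\<^sub>R (0 + - \<lbrakk>\<nu>, ?A t \<xi>\<rbrakk>)) (?S t)) - B \<xi> w)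
       (at t within {0..1})"
      by (intro has_vector_derivative_diff bounded_bilinear.has_vector_derivative[OF bounded_bilinear_B dA dexp_scale_has_vector_derivative[OF t]])
        (auto intro!: derivative_eq_intros)
    moreover have "(B ((1 / 2) *\<^sub>R (\<xi> + ?A t \<xi>)) (?A t w) + B ((1 / 2) *\<^sub>R (0 + - \<lbrakk>\<nu>, ?A t \<xi>\<rbrakk>)) (?S t)) - B \<xi> w = varpi_integrand \<lbrakk>\<nu>, \<xi>\<rbrakk> w \<nu> t"
      unfolding I J by (simp add: B_simps field_simps)
    ultimately show "(?F has_vector_derivative varpi_integrand \<lbrakk>\<nu>, \<xi>\<rbrakk> w \<nu> t) (at t within {0..1})" by simp
  qed simp
  then have "varpi2 \<nu> \<lbrakk>\<nu>, \<xi>\<rbrakk> w = ?F 1 - ?F 0" unfolding varpi2_eq by (rule integral_unique)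
  then show ?thesis by (simp add: linear_0[OF linear_dexp] B_simps)
qed

lemma dirac_related_gen:
  "dirac_related \<E> G Exp (varpi G B) \<nu> (lie_alg_dirac_gen G B \<xi> \<nu>) (cartan_dirac_gen G B \<xi> (Exp \<nu>))"
proof -
  have "- \<lbrakk>\<xi>, \<nu>\<rbrakk> = \<lbrakk>\<nu>, \<xi>\<rbrakk>" using lie_bracket_antisym[of \<xi> \<nu>] by simp
  then show ?thesis
    unfolding dirac_related_def cartan_dirac_gen_eq lie_alg_dirac_gen_eq
    by (simp add: GF.fst_elt GF.snd_elt EF.fst_elt EF.snd_elt tangent_map_Exp dexp_bracket ivs_Exp varpi_eq varpi2_bracket)
qed

lemma range_cartan_dirac: "cartan_dirac G B g = range (\<lambda>\<xi>. cartan_dirac_gen G B \<xi> g)"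
proof -
  have "linear (\<lambda>\<xi>. cartan_dirac_gen G B \<xi> g)"
    unfolding cartan_dirac_gen_eq
    by (rule GF.linear_elt_of)
      (auto intro!: linearI simp: linear_add[OF linear_Ad] linear_scale[OF linear_Ad] algebra_simps)
  then show ?thesis by (simp add: cartan_dirac_def EF.span_range_linear)
qed

lemma range_lie_alg_dirac: "lie_alg_dirac G B \<nu> = range (\<lambda>\<xi>. lie_alg_dirac_gen G B \<xi> \<nu>)"
proof -
  have "linear (\<lambda>\<xi>. lie_alg_dirac_gen G B \<xi> \<nu>)"
    unfolding lie_alg_dirac_gen_eq by (rule EF.linear_elt_of) (auto intro!: linearI simp: brk_simps)
  then show ?thesis by (simp add: lie_alg_dirac_def EF.span_range_linear)
qed

text \<open>
  The second inclusion goes through isotropy because, where the differential of the exponential map is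
  not surjective, \<open>w\<close> does not determine \<open>w'\<close>.
\<close>

lemma cartan_dirac_forward_image:
  "cartan_dirac G B (Exp \<nu>) = {w'. \<exists>w\<in>lie_alg_dirac G B \<nu>. dirac_related \<E> G Exp (varpi G B) \<nu> w w'}"
proof (intro equalityI subsetI)
  fix w' assume "w' \<in> cartan_dirac G B (Exp \<nu>)"
  then show "w' \<in> {w'. \<exists>w\<in>lie_alg_dirac G B \<nu>. dirac_related \<E> G Exp (varpi G B) \<nu> w w'}"
    using dirac_related_gen by (auto simp: range_cartan_dirac range_lie_alg_dirac)
next
  fix w' assume "w' \<in> {w'. \<exists>w\<in>lie_alg_dirac G B \<nu>. dirac_related \<E> G Exp (varpi G B) \<nu> w w'}"
  then obtain w where w: "w \<in> lie_alg_dirac G B \<nu>" "dirac_related \<E> G Exp (varpi G B) \<nu> w w'" by blast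
  have "pairing w' (cartan_dirac_gen G B \<zeta> (Exp \<nu>)) = 0" for \<zeta>
  proof -
    let ?z = "lie_alg_dirac_gen G B \<zeta> \<nu>"
    have "lagrangian (lie_alg_dirac G B \<nu>)" using dirac_manifold_lie_alg by (simp add: dirac_manifold_def)
    then have "pairing w ?z = 0" using w(1) by (auto simp: lagrangian_def range_lie_alg_dirac)
    \<comment> \<open>Pairings of related elements differ from the original ones by two values of
      the 2-form, which cancel by antisymmetry; thus isotropy passes to the image.\<close>
    moreover have "varpi2 \<nu> (fst ?z) (fst w) = - varpi2 \<nu> (fst w) (fst ?z)"
    proof -
      have "varpi2 \<nu> (a + b) (a + b) = varpi2 \<nu> a a + varpi2 \<nu> a b + (varpi2 \<nu> b a + varpi2 \<nu> b b)" for a b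
        by (simp only: linear_add[OF varpi2_linear(1)] linear_add[OF varpi2_linear(2)])
      from this[of "fst w" "fst ?z"] show ?thesis by (simp add: varpi2_self)
    qed
    ultimately show ?thesis
      using w(2) dirac_related_gen[of \<nu> \<zeta>] by (simp add: dirac_related_def pairing_def varpi_eq)
  qed
  moreover have "lagrangian (cartan_dirac G B (Exp \<nu>))" using dirac_manifold_cartan by (simp add: dirac_manifold_def)
  ultimately show "w' \<in> cartan_dirac G B (Exp \<nu>)" by (auto simp: lagrangian_def range_cartan_dirac)
qed

lemma dirac_morphism_Exp:
  "dirac_morphism \<E> (lie_alg_dirac G B) (\<lambda>_ _. 0) G (cartan_dirac G B) (cartan_form G B) Exp (varpi G B)"
  unfolding dirac_morphism_def smooth_map_iff_Ck_at[OF smE sm]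
  using dirac_manifold_lie_alg dirac_manifold_cartan smooth_Exp smooth_varpi has_degree_varpi
    ext_deriv_varpi cartan_dirac_forward_image by (intro conjI allI) simp_all

text \<open>Injectivity of the differential kills the vector part, and with it the contribution of
  the 2-form; what is left of the relation says that the covector vanishes.\<close>

lemma Exp_strong:
  assumes \<nu>: "\<nu> \<in> exp_regular G" and w: "dirac_related \<E> G Exp (varpi G B) \<nu> w 0"
  shows "w = 0"
proof -
  have "linear (tangent_map \<E> G Exp \<nu>)" using Ck_at_has_mderiv[OF smooth_Exp] has_mderiv_linear by blast
  moreover have "inj (tangent_map \<E> G Exp \<nu>)" using \<nu> by (simp add: exp_regular_def bij_def)
  moreover have "tangent_map \<E> G Exp \<nu> (fst w) = 0" using w by (simp add: dirac_related_def)
  ultimately have f: "fst w = 0" using linear_injective_0 by blast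
  have "blinfun_apply (snd w) u = 0" for u
  proof -
    have "0 = blinfun_apply (snd w) u + varpi2 \<nu> 0 u" using w f by (simp add: dirac_related_def varpi_eq)
    then show ?thesis using linear_0[OF varpi2_linear(1)] by simp
  qed
  then have "snd w = 0" by (intro blinfun_eqI) simp
  then show ?thesis using f by (simp add: prod_eq_iff)
qed

end

theorem theorem3p13:
  fixes G :: "('g::{t2_space, second_countable_topology}, 'a::euclidean_space) lie_group_data"
    and B :: "'a \<Rightarrow> 'a \<Rightarrow> real"
  assumes "lie_group G"
    and "invariant_inner_product G B"
  shows "dirac_morphism euclidean_charts (lie_alg_dirac G B) (\<lambda>_ _. 0)
           G (cartan_dirac G B) (cartan_form G B) (lie_exp G) (varpi G B) \<and>
         strong_dirac_morphism_over (exp_regular G)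
           euclidean_charts (lie_alg_dirac G B) (\<lambda>_ _. 0)
           G (cartan_dirac G B) (cartan_form G B) (lie_exp G) (varpi G B)"
proof -
  interpret lie_grp_form G B
    using assms by unfold_locales
  show ?thesis
    unfolding strong_dirac_morphism_over_def
    using dirac_morphism_Exp open_exp_regular Exp_strong by blast
qed

end
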